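(* Let $d\ge 2$ and let $g$ be a random Riemannian metric on $\mathbb{R}^d$ satisfying the standing assumptions listed in the context. Let $A=\{x\in\mathbb{R}^d:\mu(x)\le 1\}$ and, for $t>0$, let $B_t=\{x\in\mathbb{R}^d: d(0,x)\le t\}$ be the random Riemannian ball of radius $t$ centered at the origin. Then for all $\epsilon>0$, with probability one, there exists a (random) $T>0$ such that if $t\ge T$, then $$(1-\epsilon)A\subseteq \tfrac1t B_t\subseteq (1+\epsilon)A,$$ where $\tfrac1t B_t=\{x\in\mathbb{R}^d: tx\in B_t\}$.
   Context: Setting. Let $d\ge2$, let $\mathrm{SPD}$ be the set of symmetric positive-definite $d\times d$ real matrices, let $\Omega=C(\mathbb{R}^d,\mathrm{SPD})$ with the $\sigma$-algebra generated by cylinder sets, and let $\mathbb{P}$ be a probability measure on $\Omega$; $g\in\Omega$ denotes the random Riemannian metric with law $\mathbb{P}$. Standing assumptions: (i) $\mathbb{P}$ is translation-invariant; (ii) $\mathbb{P}$ has finite-range dependence: there exists $R>0$ such that if $|x-y|\ge R$, then $g(x)$ and $g(y)$ are independent; (iii) with $C_0=[-1/2,1/2)^d$ and $\Lambda_0=\sup_{x\in C_0}(\text{maximum eigenvalue of }g(x))$, one has $\mathbb{E}[e^{r\Lambda_0}]<\infty$ for all $r\in\mathbb{R}$. Distance. For a $C^1$-curve $\gamma:[a,b]\to\mathbb{R}^d$, its Riemannian length is $R(\gamma)=\int_a^b\sqrt{\langle\dot\gamma(t),g(\gamma(t))\dot\gamma(t)\rangle}\,dt$; $d(x,y)=\inf_\gamma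 R(\gamma)$ over all $C^1$-curves $\gamma$ connecting $x$ to $y$. $|\cdot|$ is the Euclidean norm. Constants. By Kingman's subadditive ergodic theorem, for each $v\in S^{d-1}$ there is a non-random constant $\mu_v\ge0$ with $\lim_{t\to\infty}\tfrac1t d(0,tv)=\mu_v$ almost surely and in $L^1$. Define $\mu(x)=\mu_{x/|x|}|x|$ for $x\ne0$ and $\mu(0)=0$.
   Formalization: The first inclusion is claimed only for ε<2 (it is false for ε>2, e.g. Euclidean metric), and finite-range dependence means that g restricted to any two sets at distance ≥R is independent, since pairwise independence of g(x), g(y) alone allows random limits, leaving μ_v undefined. *)

theory Defs
  imports "HOL-Probability.Probability"
begin

definition spd :: "(real^'n^'n) set" where
  "spd = {M. transpose M = M \<and> (\<forall>v. v \<noteq> 0 \<longrightarrow> v \<bullet> (M *v v) > 0)}"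

type_synonym 'n metric_field = "real^'n \<Rightarrow> real^'n^'n"

definition Metrics :: "'n::finite metric_field set" where
  "Metrics = {g. continuous_on UNIV g \<and> (\<forall>x. g x \<in> spd)}"

definition cylinders :: "'n::finite metric_field set set" where
  "cylinders = {{g \<in> Metrics. \<forall>x\<in>F. g x \<in> B x} | F B. finite F \<and> (\<forall>x\<in>F. B x \<in> sets borel)}"

text \<open>Only the measurable space matters here; \<^const>\<open>sigma\<close> equips it with the zero measure.\<close>

definition metric_space_algebra :: "'n::finite metric_field measure" where
  "metric_space_algebra = sigma Metrics cylinders"

definition translation_invariant :: "'n::finite metric_field measure \<Rightarrow> bool" where
  "translation_invariant P \<longleftrightarrow> (\<forall>z. distr P P (\<lambda>g x. g (x + z)) = P)"

text \<open>Finite-range dependence of a random field: the restrictions of \<open>g\<close> to any two sets of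
  points at distance at least \<open>R\<close> are independent. One-point sets give the independence of
  \<open>g x\<close> and \<open>g y\<close> when \<open>norm (x - y) \<ge> R\<close>. Asking for one-point sets only would not suffice:
  with \<open>A\<close> uniform on \<open>[0,1]\<close> and \<open>B\<close> an independent random vector whose characteristic function
  has compact support, the plane wave \<open>A + B \<bullet> x\<close> mod 1 has independent values at any two
  distant points, yet it is not ergodic, and conformal metrics that are functions of it have random
  limits of \<open>d(0, t v) / t\<close>.\<close>

definition finite_range_dependence :: "'n::finite metric_field measure \<Rightarrow> bool" where
  "finite_range_dependence P \<longleftrightarrow>
     (\<exists>R>0. \<forall>U V. (\<forall>x\<in>U. \<forall>y\<in>V. norm (x - y) \<ge> R) \<longrightarrow>
        prob_space.indep_var P
          (Pi\<^sub>M U (\<lambda>_. borel)) (\<lambda>g. restrict g U)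
          (Pi\<^sub>M V (\<lambda>_. borel)) (\<lambda>g. restrict g V))"

definition max_eigenvalue :: "real^'n^'n \<Rightarrow> real" where
  "max_eigenvalue M = Max {l. \<exists>v. v \<noteq> 0 \<and> M *v v = l *\<^sub>R v}"

definition unit_cell :: "(real^'n) set" where
  "unit_cell = {x. \<forall>i. - 1/2 \<le> x $ i \<and> x $ i < 1/2}"

definition Lambda0 :: "'n::finite metric_field \<Rightarrow> real" where
  "Lambda0 g = (SUP x\<in>unit_cell. max_eigenvalue (g x))"

definition exponential_moments :: "'n::finite metric_field measure \<Rightarrow> bool" where
  "exponential_moments P \<longleftrightarrow> (\<forall>r::real. integrable P (\<lambda>g. exp (r * Lambda0 g)))"

definition riemannian_length ::
    "'n::finite metric_field \<Rightarrow> real \<Rightarrow> real \<Rightarrow> (real \<Rightarrow> real^'n) \<Rightarrow> real" where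
  "riemannian_length g a b \<gamma> =
     integral {a..b} (\<lambda>t. sqrt (vector_derivative \<gamma> (at t) \<bullet> (g (\<gamma> t) *v vector_derivative \<gamma> (at t))))"

text \<open>\<^const>\<open>C1_differentiable_on\<close> asks for two-sided derivatives at \<open>a\<close> and \<open>b\<close> too. This
  loses no curves: a curve that is \<open>C\<^sup>1\<close> on \<open>{a..b}\<close> with one-sided derivatives at the ends can be
  extended linearly, and only its values on \<open>{a..b}\<close> count.\<close>

definition rdist :: "'n::finite metric_field \<Rightarrow> real^'n \<Rightarrow> real^'n \<Rightarrow> real" where
  "rdist g x y = Inf {riemannian_length g a b \<gamma> | a b \<gamma>.
     a < b \<and> \<gamma> C1_differentiable_on {a..b} \<and> \<gamma> a = x \<and> \<gamma> b = y}"

definition is_time_constant :: "'n::finite metric_field measure \<Rightarrow> real^'n \<Rightarrow> real \<Rightarrow> bool" where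
  "is_time_constant P v c \<longleftrightarrow> c \<ge> 0 \<and>
     (AE g in P. ((\<lambda>t. rdist g 0 (t *\<^sub>R v) / t) \<longlongrightarrow> c) at_top) \<and>
     ((\<lambda>t. \<integral>\<^sup>+ g. ennreal \<bar>rdist g 0 (t *\<^sub>R v) / t - c\<bar> \<partial>P) \<longlongrightarrow> 0) at_top"

text \<open>A probability measure has at most one such \<open>c\<close>; that one exists for unit vectors \<open>v\<close>, under
  the standing assumptions, is Kingman's subadditive ergodic theorem.\<close>

definition time_constant :: "'n::finite metric_field measure \<Rightarrow> real^'n \<Rightarrow> real" where
  "time_constant P v = (THE c. is_time_constant P v c)"

definition mu :: "'n::finite metric_field measure \<Rightarrow> real^'n \<Rightarrow> real" where
  "mu P x = (if x = 0 then 0 else time_constant P (x /\<^sub>R norm x) * norm x)"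

definition limit_shape :: "'n::finite metric_field measure \<Rightarrow> (real^'n) set" where
  "limit_shape P = {x. mu P x \<le> 1}"

definition rball :: "'n::finite metric_field \<Rightarrow> real \<Rightarrow> (real^'n) set" where
  "rball g t = {x. rdist g 0 x \<le> t}"

end

theory Submission
  imports Defs "HOL-Real_Asymp.Real_Asymp"
begin

text \<open>
  Distances are infima of lengths of polygonal paths with vertices in a countable dense set; this
  makes them measurable and approximates them from above by observables of bounded windows.

  For each direction \<open>v\<close>, such local approximations satisfy a law of large numbers by finite-range
  dependence, which bounds the upper limit of \<open>d(0, t v) / t\<close> by \<open>inf\<^sub>n E d(0, n v) / n\<close>; the
  Katznelson-Weiss covering argument bounds the lower limit, and Scheffe's lemma upgrades the
  almost sure convergence to \<open>L\<^sup>1\<close>.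

  Chernoff bounds for sums over lattice paths, split into classes of mutually independent cells,
  show that almost surely \<open>d(x, y)\<close> is at most of order \<open>\<delta> r\<close> for all \<open>x, y\<close> in the ball of large
  radius \<open>r\<close> with \<open>|x - y| \<le> \<delta> r\<close>. Hence finitely many directions control all of them. A Peierls
  argument with the same Chernoff bound shows that \<open>d(0, x)\<close> grows at least linearly, so the limit
  shape is bounded.
\<close>

section \<open>Length-distance and polygonal paths\<close>

text \<open>The eigenvalues of \<open>g\<close> have no almost sure bounds, from above or from
  below, so \<open>rdist\<close> is comparable to the Euclidean distance only at large scales. The
  estimates therefore work cell by cell, with random weights from above and with random good and bad
  cells from below, and become almost sure statements through Borel-Cantelli. A distance depends on
  the whole metric, so finite-range dependence does not apply to it directly. From above this is
  repaired by restricting the competing paths to a window; from below such a restriction goes the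
  wrong way, and the lower limit takes another route. There the upper limit, already known to be
  constant, replaces ergodicity: if the lower limit fell below it with positive probability, cheap
  jumps along the ray would push the mean distance below the infimum \<open>tconst\<close>. No
  zero-one law enters.\<close>

definition speed :: "'n::finite metric_field \<Rightarrow> real^'n \<Rightarrow> real^'n \<Rightarrow> real" where
  "speed g p v = sqrt (v \<bullet> (g p *v v))"

definition seg :: "'n::finite metric_field \<Rightarrow> real^'n \<Rightarrow> real^'n \<Rightarrow> real" where
  "seg g p q = integral {0..1} (\<lambda>s. speed g (p + s *\<^sub>R (q - p)) (q - p))"

lemma continuous_on_quadratic_form:
  fixes A :: "'a::topological_space \<Rightarrow> real^'n^'n"
  assumes "continuous_on S A" "continuous_on S f"
  shows "continuous_on S (\<lambda>x. f x \<bullet> (A x *v f x))"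
  unfolding matrix_vector_mult_def inner_vec_def
  by (simp, intro continuous_intros assms)

lemma Metrics_continuous: "g \<in> Metrics \<Longrightarrow> continuous_on S g"
  unfolding Metrics_def using continuous_on_subset by blast

lemma Metrics_pos: "g \<in> Metrics \<Longrightarrow> v \<noteq> 0 \<Longrightarrow> v \<bullet> (g p *v v) > 0"
  unfolding Metrics_def spd_def by auto

lemma Metrics_nonneg: "g \<in> Metrics \<Longrightarrow> v \<bullet> (g p *v v) \<ge> 0"
  using Metrics_pos[of g v p] by (cases "v = 0") auto

lemma continuous_on_speed:
  assumes "g \<in> Metrics" "continuous_on S p" "continuous_on S v"
  shows "continuous_on S (\<lambda>x. speed g (p x) (v x))"
proof -
  have "continuous_on S (\<lambda>x. g (p x))"
    by (rule continuous_on_compose2[OF Metrics_continuous[OF assms(1), of UNIV] assms(2)]) auto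
  then show ?thesis
    unfolding speed_def using assms by (intro continuous_on_real_sqrt continuous_on_quadratic_form)
qed

lemma speed_nonneg: "g \<in> Metrics \<Longrightarrow> speed g p v \<ge> 0"
  unfolding speed_def by (simp add: Metrics_nonneg)

lemma speed_scale: "speed g p (c *\<^sub>R v) = \<bar>c\<bar> * speed g p v"
proof -
  have "(c *\<^sub>R v) \<bullet> (g p *v (c *\<^sub>R v)) = c\<^sup>2 * (v \<bullet> (g p *v v))"
    by (simp add: matrix_vector_mult_scaleR power2_eq_square)
  then show ?thesis unfolding speed_def by (simp add: real_sqrt_mult)
qed

lemma speed_minus: "speed g p (- v) = speed g p v"
  using speed_scale[of g p "-1" v] by simp

lemma speed_0 [simp]: "speed g p 0 = 0"
  unfolding speed_def by simp

lemma continuous_on_seg_integrand: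
  "g \<in> Metrics \<Longrightarrow> continuous_on S (\<lambda>s::real. speed g (p + s *\<^sub>R v) w)"
  by (intro continuous_on_speed continuous_intros)

lemma seg_integrable: "g \<in> Metrics \<Longrightarrow> (\<lambda>s::real. speed g (p + s *\<^sub>R v) w) integrable_on {a..b}"
  by (intro integrable_continuous_interval continuous_on_seg_integrand)

lemma seg_nonneg: "g \<in> Metrics \<Longrightarrow> seg g p q \<ge> 0"
  unfolding seg_def by (intro integral_nonneg seg_integrable speed_nonneg)

lemma seg_self [simp]: "seg g p p = 0"
  unfolding seg_def by simp

lemma seg_le:
  assumes "g \<in> Metrics" "\<And>s. 0 \<le> s \<Longrightarrow> s \<le> 1 \<Longrightarrow>
      (q - p) \<bullet> (g (p + s *\<^sub>R (q - p)) *v (q - p)) \<le> B * (norm (q - p))\<^sup>2"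
  shows "seg g p q \<le> norm (q - p) * sqrt B"
proof -
  have "seg g p q \<le> integral {0..1} (\<lambda>s::real. norm (q - p) * sqrt B)"
    unfolding seg_def
  proof (intro integral_le seg_integrable assms)
    fix s :: real assume "s \<in> {0..1}"
    then have "speed g (p + s *\<^sub>R (q - p)) (q - p) \<le> sqrt (B * (norm (q - p))\<^sup>2)"
      unfolding speed_def using assms(2)[of s] by (intro real_sqrt_le_mono) auto
    then show "speed g (p + s *\<^sub>R (q - p)) (q - p) \<le> norm (q - p) * sqrt B"
      by (simp add: real_sqrt_mult mult.commute)
  qed auto
  then show ?thesis by simp
qed

lemma seg_ge:
  assumes "g \<in> Metrics" "B \<ge> 0" "\<And>s. 0 \<le> s \<Longrightarrow> s \<le> 1 \<Longrightarrow>
      (q - p) \<bullet> (g (p + s *\<^sub>R (q - p)) *v (q - p)) \<ge> B * (norm (q - p))\<^sup>2"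
  shows "seg g p q \<ge> norm (q - p) * sqrt B"
proof -
  have "integral {0..1} (\<lambda>s::real. norm (q - p) * sqrt B) \<le> seg g p q"
    unfolding seg_def
  proof (intro integral_le seg_integrable assms)
    fix s :: real assume "s \<in> {0..1}"
    then have "speed g (p + s *\<^sub>R (q - p)) (q - p) \<ge> sqrt (B * (norm (q - p))\<^sup>2)"
      unfolding speed_def using assms(3)[of s] by (intro real_sqrt_le_mono) auto
    then show "norm (q - p) * sqrt B \<le> speed g (p + s *\<^sub>R (q - p)) (q - p)"
      by (simp add: real_sqrt_mult mult.commute)
  qed auto
  then show ?thesis by simp
qed

section \<open>Riemann sums over uniform partitions\<close>

lemma integral_uniform_partition:
  fixes F :: "real \<Rightarrow> real"
  assumes "continuous_on {a..b} F" "h \<ge> 0" "a + real N * h \<le> b"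
  shows "integral {a..a + real N * h} F = (\<Sum>i<N. integral {a + real i * h..a + real (Suc i) * h} F)"
  using assms(3)
proof (induction N)
  case (Suc N)
  have le: "a + real N * h \<le> a + real (Suc N) * h" using \<open>h \<ge> 0\<close> by (simp add: algebra_simps)
  have "integral {a..a + real N * h} F + integral {a + real N * h..a + real (Suc N) * h} F
      = integral {a..a + real (Suc N) * h} F"
    using le \<open>h \<ge> 0\<close> Suc.prems
    by (intro Henstock_Kurzweil_Integration.integral_combine integrable_continuous_interval continuous_on_subset[OF assms(1)]) auto
  with Suc le show ?case by simp
qed simp

text \<open>The samples \<open>c i\<close> need not be values of \<open>F\<close>. For Riemann sums
  they are, but in the polygonal approximation of a curve they are chord lengths divided by the
  step, which are only close to the speed.\<close>

lemma riemann_approx: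
  fixes F :: "real \<Rightarrow> real"
  assumes F: "continuous_on {a..b} F" and h: "h \<ge> 0" "a + real N * h = b"
    and c: "\<And>i t. i < N \<Longrightarrow> a + real i * h \<le> t \<Longrightarrow> t \<le> a + real (Suc i) * h \<Longrightarrow> \<bar>F t - c i\<bar> \<le> \<eta>"
  shows "\<bar>integral {a..b} F - (\<Sum>i<N. h * c i)\<bar> \<le> \<eta> * (b - a)"
proof -
  have piece: "\<bar>integral {a + real i * h..a + real (Suc i) * h} F - h * c i\<bar> \<le> \<eta> * h" if "i < N" for i
  proof -
    have "real (Suc i) * h \<le> real N * h" using that h by (intro mult_right_mono) auto
    then have sub: "{a + real i * h..a + real (Suc i) * h} \<subseteq> {a..b}"
      using h mult_nonneg_nonneg[of "real i" h] by auto
    have cF: "continuous_on {a + real i * h..a + real (Suc i) * h} F"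
      by (rule continuous_on_subset[OF F sub])
    have le: "a + real i * h \<le> a + real (Suc i) * h" using h by (simp add: algebra_simps)
    have "norm (integral {a + real i * h..a + real (Suc i) * h} (\<lambda>t. F t - c i))
        \<le> \<eta> * (a + real (Suc i) * h - (a + real i * h))"
      using c[OF that] by (intro integral_bound le continuous_intros cF) auto
    moreover have "integral {a + real i * h..a + real (Suc i) * h} (\<lambda>t. F t - c i)
        = integral {a + real i * h..a + real (Suc i) * h} F - h * c i"
      using le by (subst integral_diff[OF integrable_continuous_interval[OF cF]]) (auto simp: algebra_simps)
    ultimately show ?thesis by (simp add: algebra_simps)
  qed
  have "integral {a..b} F = (\<Sum>i<N. integral {a + real i * h..a + real (Suc i) * h} F)"
    using integral_uniform_partition[OF F, of h N] h by simp
  then have "\<bar>integral {a..b} F - (\<Sum>i<N. h * c i)\<bar>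
      = \<bar>\<Sum>i<N. integral {a + real i * h..a + real (Suc i) * h} F - h * c i\<bar>"
    by (simp add: sum_subtractf)
  also have "\<dots> \<le> (\<Sum>i<N. \<eta> * h)"
    using piece by (intro order_trans[OF sum_abs] sum_mono) auto
  also have "\<dots> = \<eta> * (b - a)" using h by (auto simp: algebra_simps)
  finally show ?thesis .
qed

text \<open>Each sum uses finitely many values of the integrand; in this way measurability passes
  from evaluations of \<open>g\<close> at points to \<open>seg\<close>.\<close>

lemma riemann_sum_tendsto:
  fixes F :: "real \<Rightarrow> real"
  assumes "continuous_on {0..1} F"
  shows "(\<lambda>N. (\<Sum>i<N. F (real i / real N)) / real N) \<longlonglongrightarrow> integral {0..1} F"
proof (rule LIMSEQ_I)
  fix r :: real assume "r > 0"
  have "uniformly_continuous_on {0..1} F"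
    by (intro compact_uniformly_continuous assms) auto
  with \<open>r > 0\<close> obtain d where "d > 0"
    and d: "\<And>x y. x \<in> {0..1} \<Longrightarrow> y \<in> {0..1} \<Longrightarrow> dist y x < d \<Longrightarrow> dist (F y) (F x) < r/2"
    unfolding uniformly_continuous_on_def by (meson half_gt_zero)
  obtain N0 :: nat where N0: "N0 > 0" "inverse (real N0) < d"
    using reals_Archimedean[OF \<open>d > 0\<close>] by (metis zero_less_Suc)
  have "norm ((\<Sum>i<N. F (real i / real N)) / real N - integral {0..1} F) < r" if "N \<ge> N0" for N
  proof -
    have N: "N > 0" "1 / real N < d"
      using that N0 le_less_trans[OF _ N0(2), of "1 / real N"] by (auto simp: inverse_eq_divide frac_le)
    have "\<bar>integral {0..1} F - (\<Sum>i<N. (1/N) * F (real i / N))\<bar> \<le> (r/2) * (1 - 0)"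
    proof (rule riemann_approx[OF assms])
      fix i t assume *: "i < N" "0 + real i * (1 / real N) \<le> t" "t \<le> 0 + real (Suc i) * (1 / real N)"
      have "real (Suc i) * (1 / real N) \<le> 1" using * N by (simp add: field_simps)
      with *(3) have t1: "t \<le> 1" by linarith
      moreover have "real i / N \<ge> 0" by simp
      moreover have "real i / N \<le> 1" using * by simp
      ultimately have "t \<in> {0..1}" "real i / N \<in> {0..1}"
        using * t1 order_trans[of 0 "real i / N" t] by auto
      moreover have "dist t (real i / N) < d"
        using * N by (simp add: dist_real_def abs_if field_simps)
      ultimately have "dist (F t) (F (real i / N)) < r / 2"
        by (intro d) auto
      then show "\<bar>F t - F (real i / real N)\<bar> \<le> r / 2" by (simp add: dist_real_def)
    qed (use N in auto)
    then show ?thesis using \<open>r > 0\<close> by (simp add: sum_divide_distrib abs_minus_commute)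
  qed
  then show "\<exists>no. \<forall>n\<ge>no. norm ((\<Sum>i<n. F (real i / real n)) / real n - integral {0..1} F) < r"
    by blast
qed

section \<open>Lengths of smooth curves and the triangle inequality\<close>

lemma has_vector_derivative_imp_continuous_on:
  assumes "\<And>t. t \<in> S \<Longrightarrow> (\<gamma> has_vector_derivative D t) (at t)"
  shows "continuous_on S \<gamma>"
  using assms by (meson continuous_at_imp_continuous_on has_vector_derivative_continuous)

lemma riemannian_length_eq:
  assumes "\<And>t. t \<in> {a..b} \<Longrightarrow> (\<gamma> has_vector_derivative D t) (at t)"
  shows "riemannian_length g a b \<gamma> = integral {a..b} (\<lambda>t. speed g (\<gamma> t) (D t))"
  unfolding riemannian_length_def speed_def
  by (intro integral_cong) (auto simp: vector_derivative_at[OF assms])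

lemma riemannian_length_nonneg:
  assumes "g \<in> Metrics" "\<gamma> C1_differentiable_on {a..b}"
  shows "riemannian_length g a b \<gamma> \<ge> 0"
proof -
  obtain D where D: "\<And>t. t \<in> {a..b} \<Longrightarrow> (\<gamma> has_vector_derivative D t) (at t)" "continuous_on {a..b} D"
    using assms(2) unfolding C1_differentiable_on_def by blast
  have "riemannian_length g a b \<gamma> = integral {a..b} (\<lambda>t. speed g (\<gamma> t) (D t))"
    by (rule riemannian_length_eq[OF D(1)])
  also have "\<dots> \<ge> 0"
    by (intro integral_nonneg integrable_continuous_interval continuous_on_speed assms D speed_nonneg
        has_vector_derivative_imp_continuous_on[OF D(1)])
  finally show ?thesis .
qed

definition curve_lengths :: "'n::finite metric_field \<Rightarrow> real^'n \<Rightarrow> real^'n \<Rightarrow> real set" where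
  "curve_lengths g x y = {riemannian_length g a b \<gamma> | a b \<gamma>.
     a < b \<and> \<gamma> C1_differentiable_on {a..b} \<and> \<gamma> a = x \<and> \<gamma> b = y}"

lemma rdist_Inf: "rdist g x y = Inf (curve_lengths g x y)"
  unfolding rdist_def curve_lengths_def ..

lemma seg_in_curve_lengths: "seg g p q \<in> curve_lengths g p q"
proof -
  have d: "((\<lambda>s. p + s *\<^sub>R (q - p)) has_vector_derivative (q - p)) (at t)" for t :: real
    by (auto intro!: derivative_eq_intros)
  then have "(\<lambda>s. p + s *\<^sub>R (q - p)) C1_differentiable_on {0..1}"
    unfolding C1_differentiable_on_def by (intro exI[of _ "\<lambda>_. q - p"]) auto
  moreover have "seg g p q = riemannian_length g 0 1 (\<lambda>s. p + s *\<^sub>R (q - p))"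
    unfolding seg_def by (rule riemannian_length_eq[symmetric]) (rule d)
  ultimately show ?thesis unfolding curve_lengths_def
    by (intro CollectI exI[of _ 0] exI[of _ 1] exI[of _ "\<lambda>s. p + s *\<^sub>R (q - p)"]) auto
qed

lemma curve_lengths_nonneg: "g \<in> Metrics \<Longrightarrow> l \<in> curve_lengths g x y \<Longrightarrow> l \<ge> 0"
  unfolding curve_lengths_def using riemannian_length_nonneg by blast

lemma curve_lengths_bdd: "g \<in> Metrics \<Longrightarrow> bdd_below (curve_lengths g x y)"
  using curve_lengths_nonneg by (meson bdd_belowI)

lemma rdist_le_curve: "g \<in> Metrics \<Longrightarrow> l \<in> curve_lengths g x y \<Longrightarrow> rdist g x y \<le> l"
  unfolding rdist_Inf by (intro cInf_lower curve_lengths_bdd)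

lemma rdist_le_seg: "g \<in> Metrics \<Longrightarrow> rdist g x y \<le> seg g x y"
  by (intro rdist_le_curve seg_in_curve_lengths)

lemma rdist_nonneg: "g \<in> Metrics \<Longrightarrow> rdist g x y \<ge> 0"
  unfolding rdist_Inf using seg_in_curve_lengths curve_lengths_nonneg
  by (metis cInf_greatest empty_iff)

lemma rdist_self [simp]: "g \<in> Metrics \<Longrightarrow> rdist g x x = 0"
  using rdist_le_seg[of g x x] rdist_nonneg[of g x x] by simp

text \<open>The smoothstep \<open>3s\<^sup>2 - 2s\<^sup>3\<close> makes the velocity vanish at both ends, so that curves can be
  concatenated without losing differentiability.\<close>

lemma smoothstep_reparametrization:
  assumes g: "g \<in> Metrics" and l: "l \<in> curve_lengths g x y"
  obtains \<eta> E where "\<And>t. t \<in> {c..c+1} \<Longrightarrow> (\<eta> has_vector_derivative E t) (at t)"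
    "continuous_on {c..c+1} E" "E c = 0" "E (c+1) = 0" "\<eta> c = x" "\<eta> (c+1) = y"
    "integral {c..c+1} (\<lambda>t. speed g (\<eta> t) (E t)) = l"
proof -
  obtain a b \<gamma> where ab: "a < b" and \<gamma>: "\<gamma> C1_differentiable_on {a..b}" "\<gamma> a = x" "\<gamma> b = y"
    and l: "l = riemannian_length g a b \<gamma>"
    using l unfolding curve_lengths_def by blast
  obtain D where D: "\<And>t. t \<in> {a..b} \<Longrightarrow> (\<gamma> has_vector_derivative D t) (at t)" "continuous_on {a..b} D"
    using \<gamma>(1) unfolding C1_differentiable_on_def by blast
  define \<sigma> where "\<sigma> t = a + (b - a) * (3 * (t - c)^2 - 2 * (t - c)^3)" for t
  define \<sigma>' where "\<sigma>' t = (b - a) * (6 * (t - c) * (1 - (t - c)))" for t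
  have ders: "(\<sigma> has_real_derivative \<sigma>' t) (at t within S)" for t S
    unfolding \<sigma>_def \<sigma>'_def by (auto intro!: derivative_eq_intros simp: power2_eq_square algebra_simps)
  have rng: "\<sigma> t \<in> {a..b}" if "t \<in> {c..c+1}" for t
  proof -
    have *: "0 \<le> 3 * u^2 - 2 * u^3" "3 * u^2 - 2 * u^3 \<le> 1" if "0 \<le> u" "u \<le> 1" for u :: real
    proof -
      have "3 * u^2 - 2 * u^3 = u^2 * (3 - 2 * u)" by (simp add: power2_eq_square power3_eq_cube algebra_simps)
      then show "0 \<le> 3 * u^2 - 2 * u^3" using that by simp
      have "1 - (3 * u^2 - 2 * u^3) = (1 - u)^2 * (1 + 2 * u)"
        by (simp add: power2_eq_square power3_eq_cube algebra_simps)
      moreover have "\<dots> \<ge> 0" using that by simp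
      ultimately show "3 * u^2 - 2 * u^3 \<le> 1" by linarith
    qed
    have "(b - a) * (3 * (t - c)^2 - 2 * (t - c)^3) \<le> (b - a) * 1"
      using *[of "t - c"] that ab by (intro mult_left_mono) auto
    moreover have "0 \<le> (b - a) * (3 * (t - c)^2 - 2 * (t - c)^3)"
      using *[of "t - c"] that ab by simp
    ultimately show ?thesis unfolding \<sigma>_def by auto
  qed
  define \<eta> where "\<eta> = \<gamma> \<circ> \<sigma>"
  define E where "E t = \<sigma>' t *\<^sub>R D (\<sigma> t)" for t
  have dE: "(\<eta> has_vector_derivative E t) (at t)" if "t \<in> {c..c+1}" for t
    unfolding \<eta>_def E_def
    by (rule vector_diff_chain_at)
       (use ders D(1)[OF rng[OF that]] in \<open>auto simp: has_real_derivative_iff_has_vector_derivative\<close>)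
  have conts: "continuous_on S \<sigma>" for S
    unfolding \<sigma>_def by (intro continuous_intros)
  have contE: "continuous_on {c..c+1} E"
    unfolding E_def \<sigma>'_def using rng
    by (intro continuous_intros continuous_on_compose2[OF D(2) conts]) auto
  have contF: "continuous_on {a..b} (\<lambda>t. speed g (\<gamma> t) (D t))"
    by (intro continuous_on_speed g has_vector_derivative_imp_continuous_on[OF D(1)] D(2))
  have sc: "\<sigma> c = a" "\<sigma> (c+1) = b" unfolding \<sigma>_def by auto
  have "((\<lambda>t. \<sigma>' t *\<^sub>R speed g (\<gamma> (\<sigma> t)) (D (\<sigma> t))) has_integral
      integral {\<sigma> c..\<sigma> (c+1)} (\<lambda>t. speed g (\<gamma> t) (D t))) {c..c+1}"
    by (rule has_integral_substitution[where c = a and d = b]) (use rng sc ab contF ders in auto)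
  then have "integral {c..c+1} (\<lambda>t. \<sigma>' t *\<^sub>R speed g (\<gamma> (\<sigma> t)) (D (\<sigma> t))) = l"
    unfolding sc l by (subst riemannian_length_eq[OF D(1)]) (auto intro: integral_unique)
  moreover have "integral {c..c+1} (\<lambda>t. speed g (\<eta> t) (E t))
      = integral {c..c+1} (\<lambda>t. \<sigma>' t *\<^sub>R speed g (\<gamma> (\<sigma> t)) (D (\<sigma> t)))"
  proof (intro integral_cong)
    fix t assume "t \<in> {c..c+1}"
    then have "\<sigma>' t \<ge> 0" unfolding \<sigma>'_def using ab by auto
    then show "speed g (\<eta> t) (E t) = \<sigma>' t *\<^sub>R speed g (\<gamma> (\<sigma> t)) (D (\<sigma> t))"
      unfolding \<eta>_def E_def by (simp add: speed_scale)
  qed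
  moreover have "E c = 0" "E (c+1) = 0" unfolding E_def \<sigma>'_def by auto
  moreover have "\<eta> c = x" "\<eta> (c+1) = y" unfolding \<eta>_def using sc \<gamma> by auto
  ultimately show ?thesis using that[of \<eta> E] dE contE by auto
qed

text \<open>Both curves are first slowed down so that they come to rest at \<open>y\<close>. The
  glued curve then has derivative 0 from both sides at the junction, whatever the angle there, and
  is continuously differentiable.\<close>

lemma curve_lengths_concat:
  assumes g: "g \<in> Metrics" and l1: "l1 \<in> curve_lengths g x y" and l2: "l2 \<in> curve_lengths g y z"
  shows "l1 + l2 \<in> curve_lengths g x z"
proof -
  obtain \<eta>1 E1 where 1: "\<And>t. t \<in> {0..1} \<Longrightarrow> (\<eta>1 has_vector_derivative E1 t) (at t)"
    "continuous_on {0..1} E1" "E1 0 = 0" "E1 1 = 0" "\<eta>1 0 = x" "\<eta>1 1 = y"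
    "integral {0..1} (\<lambda>t. speed g (\<eta>1 t) (E1 t)) = l1"
    using smoothstep_reparametrization[OF g l1, of 0] by auto
  obtain \<eta>2 E2 where 2: "\<And>t. t \<in> {1..2} \<Longrightarrow> (\<eta>2 has_vector_derivative E2 t) (at t)"
    "continuous_on {1..2} E2" "E2 1 = 0" "E2 2 = 0" "\<eta>2 1 = y" "\<eta>2 2 = z"
    "integral {1..2} (\<lambda>t. speed g (\<eta>2 t) (E2 t)) = l2"
    using smoothstep_reparametrization[OF g l2, of 1] by auto
  define \<eta> where "\<eta> t = (if t \<in> {..1} then \<eta>1 t else \<eta>2 t)" for t
  define E where "E t = (if t \<in> {..1} then E1 t else E2 t)" for t
  have d: "(\<eta> has_vector_derivative E t) (at t)" if "t \<in> {0..2}" for t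
  proof -
    have "(\<eta> has_vector_derivative E t) (at t within UNIV)"
      unfolding \<eta>_def E_def
      by (rule has_vector_derivative_If_within_closures[where S = "{..1}" and T = "{1<..}"])
         (use that 1 2 in \<open>auto intro: has_vector_derivative_at_within\<close>)
    then show ?thesis by simp
  qed
  have cE: "continuous_on {0..2} E"
  proof -
    have "continuous_on ({0..1} \<union> {1..2}) (\<lambda>t. if t \<le> 1 then E1 t else E2 t)"
      by (rule continuous_on_cases) (use 1 2 in auto)
    moreover have "{0..1} \<union> {1..2} = {0..2::real}" by auto
    ultimately show ?thesis unfolding E_def by simp
  qed
  have c: "\<eta> C1_differentiable_on {0..2}"
    unfolding C1_differentiable_on_def using d cE by (intro exI[of _ E]) blast
  have cF: "continuous_on {0..2} (\<lambda>t. speed g (\<eta> t) (E t))"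
    by (intro continuous_on_speed g has_vector_derivative_imp_continuous_on[OF d] cE)
  have "riemannian_length g 0 2 \<eta> = integral {0..2} (\<lambda>t. speed g (\<eta> t) (E t))"
    by (rule riemannian_length_eq[OF d])
  also have "\<dots> = integral {0..1} (\<lambda>t. speed g (\<eta> t) (E t)) + integral {1..2} (\<lambda>t. speed g (\<eta> t) (E t))"
    by (rule Henstock_Kurzweil_Integration.integral_combine[symmetric]) (use cF in \<open>auto intro!: integrable_continuous_interval\<close>)
  also have "integral {0..1} (\<lambda>t. speed g (\<eta> t) (E t)) = l1"
    unfolding 1(7)[symmetric] by (rule integral_cong) (auto simp: \<eta>_def E_def)
  also have "integral {1..2} (\<lambda>t. speed g (\<eta> t) (E t)) = l2"
    unfolding 2(7)[symmetric] by (rule integral_cong) (use 1 2 in \<open>auto simp: \<eta>_def E_def dest!: order_antisym\<close>)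
  finally have "l1 + l2 = riemannian_length g 0 2 \<eta>" by simp
  moreover have "\<eta> 0 = x" "\<eta> 2 = z" unfolding \<eta>_def using 1 2 by auto
  ultimately show ?thesis unfolding curve_lengths_def using c
    by (intro CollectI exI[of _ 0] exI[of _ 2] exI[of _ \<eta>]) auto
qed

lemma rdist_less_obtain:
  assumes "rdist g x y < c"
  obtains l where "l \<in> curve_lengths g x y" "l < c"
  using cInf_lessD[of "curve_lengths g x y" c] assms seg_in_curve_lengths unfolding rdist_Inf by blast

lemma rdist_triangle:
  assumes g: "g \<in> Metrics"
  shows "rdist g x z \<le> rdist g x y + rdist g y z"
proof (rule field_le_epsilon)
  fix e :: real assume "e > 0"
  obtain l1 where l1: "l1 \<in> curve_lengths g x y" "l1 < rdist g x y + e/2"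
    using rdist_less_obtain[of g x y "rdist g x y + e/2"] \<open>e > 0\<close> by auto
  obtain l2 where l2: "l2 \<in> curve_lengths g y z" "l2 < rdist g y z + e/2"
    using rdist_less_obtain[of g y z "rdist g y z + e/2"] \<open>e > 0\<close> by auto
  have "rdist g x z \<le> l1 + l2"
    by (rule rdist_le_curve[OF g curve_lengths_concat[OF g l1(1) l2(1)]])
  then show "rdist g x z \<le> rdist g x y + rdist g y z + e" using l1 l2 by simp
qed

lemma rdist_le_sum:
  assumes "g \<in> Metrics"
  shows "rdist g (f 0) (f N) \<le> (\<Sum>i<N. rdist g (f i) (f (Suc i)))"
proof (induction N)
  case (Suc N)
  then show ?case using rdist_triangle[OF assms, of "f 0" "f (Suc N)" "f N"] by simp
qed (use assms in auto)

lemma rdist_le_sum_seg: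
  assumes "g \<in> Metrics"
  shows "rdist g (f 0) (f N) \<le> (\<Sum>i<N. seg g (f i) (f (Suc i)))"
  using rdist_le_sum[OF assms, of f N] sum_mono[of "{..<N}", OF rdist_le_seg[OF assms]]
  by (meson order_trans)

text \<open>The slope of a short chord is uniformly close to the velocity, and
  \<open>speed g\<close> is uniformly continuous on a compact set of points and velocities. Hence
  \<open>seg\<close> divided by the step is an admissible sample in \<open>riemann_approx\<close>.
  The mesh bound \<open>r\<close> serves the lower bound on distances, where only nearby vertices
  can be compared.\<close>

lemma polygon_approx:
  assumes g: "g \<in> Metrics" and l: "l \<in> curve_lengths g x y" and "\<eta> > 0" "r > 0"
  obtains f N where "N > 0" "f 0 = x" "f N = y" "\<And>i. i < N \<Longrightarrow> norm (f (Suc i) - f i) < r"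
    "(\<Sum>i<N. seg g (f i) (f (Suc i))) \<le> l + \<eta>"
proof -
  obtain a b \<gamma> where ab: "a < b" and \<gamma>: "\<gamma> C1_differentiable_on {a..b}" "\<gamma> a = x" "\<gamma> b = y"
    and l: "l = riemannian_length g a b \<gamma>"
    using l unfolding curve_lengths_def by blast
  obtain D where D: "\<And>t. t \<in> {a..b} \<Longrightarrow> (\<gamma> has_vector_derivative D t) (at t)" "continuous_on {a..b} D"
    using \<gamma>(1) unfolding C1_differentiable_on_def by blast
  have c\<gamma>: "continuous_on {a..b} \<gamma>" by (rule has_vector_derivative_imp_continuous_on[OF D(1)])
  have "bounded (\<gamma> ` {a..b} \<union> D ` {a..b})"
    by (intro compact_imp_bounded compact_Un compact_continuous_image c\<gamma> D) auto
  then obtain B where B: "\<And>t. t \<in> {a..b} \<Longrightarrow> norm (\<gamma> t) \<le> B" "\<And>t. t \<in> {a..b} \<Longrightarrow> norm (D t) \<le> B"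
    unfolding bounded_iff by blast
  \<comment> \<open>Chord points stay in the ball of radius \<open>B\<close> by convexity. Chord
    slopes may exceed \<open>B\<close>, but by at most \<open>e2\<close>, which is at most
    1.\<close>
  define K where "K = cball (0::real^'a) B \<times> cball (0::real^'a) (B + 1)"
  have "uniformly_continuous_on K (\<lambda>z. speed g (fst z) (snd z))"
    unfolding K_def
    by (intro compact_uniformly_continuous continuous_on_speed g compact_Times continuous_intros) auto
  moreover have eps: "\<eta> / (b - a) > 0" using \<open>\<eta> > 0\<close> ab by simp
  ultimately obtain d where "d > 0" and d: "\<And>p v p' v'. (p, v) \<in> K \<Longrightarrow> (p', v') \<in> K \<Longrightarrow>
      dist (p', v') (p, v) < d \<Longrightarrow> dist (speed g p' v') (speed g p v) < \<eta> / (b - a)"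
    by (rule uniformly_continuous_onE) (metis fst_conv snd_conv)
  define e1 where "e1 = min (d/2) r"
  define e2 where "e2 = min (d/2) 1"
  have e: "e1 > 0" "e2 > 0" unfolding e1_def e2_def using \<open>d > 0\<close> \<open>r > 0\<close> by auto
  have "uniformly_continuous_on {a..b} \<gamma>" "uniformly_continuous_on {a..b} D"
    by (intro compact_uniformly_continuous c\<gamma> D compact_Icc)+
  note uc = this
  obtain d1 where d1: "d1 > 0" "\<And>t t'. t \<in> {a..b} \<Longrightarrow> t' \<in> {a..b} \<Longrightarrow> dist t' t < d1 \<Longrightarrow> dist (\<gamma> t') (\<gamma> t) < e1"
    using uniformly_continuous_onE[OF uc(1) e(1)] by blast
  obtain d2 where d2: "d2 > 0" "\<And>t t'. t \<in> {a..b} \<Longrightarrow> t' \<in> {a..b} \<Longrightarrow> dist t' t < d2 \<Longrightarrow> dist (D t') (D t) < e2"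
    using uniformly_continuous_onE[OF uc(2) e(2)] by blast
  obtain N :: nat where N: "(b - a) / min d1 d2 < real N" using reals_Archimedean2 by blast
  have "N > 0" using N ab d1 d2 by (metis diff_gt_0_iff_gt divide_pos_pos gr0I less_asym' min_less_iff_conj of_nat_0)
  define h where "h = (b - a) / real N"
  have h: "h > 0" "a + real N * h = b" unfolding h_def using ab \<open>N > 0\<close> by auto
  have "b - a < real N * min d1 d2" using N d1 d2 by (simp add: field_simps)
  then have "h < min d1 d2" unfolding h_def using \<open>N > 0\<close>
    by (simp add: pos_divide_less_eq mult.commute del: min_less_iff_conj)
  then have hd: "h < d1" "h < d2" by auto
  define T where "T i = a + real i * h" for i
  define f where "f i = \<gamma> (T i)" for i
  have T: "T i \<in> {a..b}" if "i \<le> N" for i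
  proof -
    have "real i * h \<le> real N * h" using that h by (intro mult_right_mono) auto
    then show ?thesis using h that unfolding T_def by auto
  qed
  have TS: "T (Suc i) = T i + h" for i unfolding T_def by (simp add: algebra_simps)
  have close: "\<bar>speed g (\<gamma> t) (D t) - seg g (f i) (f (Suc i)) / h\<bar> \<le> \<eta> / (b - a)"
    if i: "i < N" and t: "T i \<le> t" "t \<le> T (Suc i)" for i t
  proof -
    define \<Delta> where "\<Delta> = f (Suc i) - f i"
    have Ti: "T i \<in> {a..b}" "T (Suc i) \<in> {a..b}" using T i by auto
    then have tab: "t \<in> {a..b}" using t by auto
    have near: "\<gamma> (T i) \<in> ball (\<gamma> t) (d/2)" "\<gamma> (T (Suc i)) \<in> ball (\<gamma> t) (d/2)"
      using d1(2)[OF Ti(1) tab] d1(2)[OF Ti(2) tab] t TS[of i] hd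
      unfolding e1_def by (auto simp: dist_real_def)
    have vel: "norm (\<Delta> - h *\<^sub>R D t) \<le> h * e2"
    proof -
      have "norm (\<gamma> (T (Suc i)) - \<gamma> (T i) - (T (Suc i) - T i) *\<^sub>R D t) \<le> norm (T (Suc i) - T i) * e2"
      proof (rule vector_differentiable_bound_linearization[where S = "{T i..T (Suc i)}"])
        show "closed_segment (T i) (T (Suc i)) \<subseteq> {T i..T (Suc i)}"
          using TS[of i] h by (auto simp: closed_segment_eq_real_ivl)
        fix u assume u: "u \<in> {T i..T (Suc i)}"
        then have uab: "u \<in> {a..b}" using Ti by auto
        show "(\<gamma> has_vector_derivative D u) (at u within {T i..T (Suc i)})"
          using D(1)[OF uab] by (rule has_vector_derivative_at_within)
        have "dist u t < d2" using u t TS[of i] hd by (auto simp: dist_real_def)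
        then show "norm (D u - D t) \<le> e2" using d2(2)[OF tab uab] by (simp add: dist_norm)
      qed (use t in auto)
      then show ?thesis using h by (simp add: TS \<Delta>_def f_def)
    qed
    have vel': "norm (\<Delta> /\<^sub>R h - D t) \<le> e2"
    proof -
      have "\<Delta> /\<^sub>R h - D t = (\<Delta> - h *\<^sub>R D t) /\<^sub>R h" using h by (simp add: algebra_simps)
      then have "norm (\<Delta> /\<^sub>R h - D t) = norm (\<Delta> - h *\<^sub>R D t) / h"
        using h by (simp add: divide_inverse mult.commute)
      also have "\<dots> \<le> e2" using vel h by (simp add: pos_divide_le_eq mult.commute)
      finally show ?thesis .
    qed
    have pt: "\<bar>speed g (\<gamma> t) (D t) - speed g (f i + s *\<^sub>R \<Delta>) (\<Delta> /\<^sub>R h)\<bar> \<le> \<eta> / (b - a)"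
      if s: "0 \<le> s" "s \<le> 1" for s
    proof -
      have eq: "f i + s *\<^sub>R \<Delta> = (1 - s) *\<^sub>R \<gamma> (T i) + s *\<^sub>R \<gamma> (T (Suc i))"
        unfolding \<Delta>_def f_def by (simp add: algebra_simps)
      have "f i + s *\<^sub>R \<Delta> \<in> ball (\<gamma> t) (d/2)" unfolding eq
        using convexD_alt[OF convex_ball near] s by auto
      moreover have "f i + s *\<^sub>R \<Delta> \<in> cball 0 B" unfolding eq
        using convexD_alt[OF convex_cball, of "\<gamma> (T i)" 0 B "\<gamma> (T (Suc i))" s] s B(1)[OF Ti(1)] B(1)[OF Ti(2)] by auto
      moreover have "norm (\<Delta> /\<^sub>R h) \<le> B + 1"
        using norm_triangle_sub[of "\<Delta> /\<^sub>R h" "D t"] vel' B(2)[OF tab] unfolding e2_def by linarith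
      moreover have "dist (\<gamma> t, D t) (f i + s *\<^sub>R \<Delta>, \<Delta> /\<^sub>R h) \<le> dist (\<gamma> t) (f i + s *\<^sub>R \<Delta>) + dist (D t) (\<Delta> /\<^sub>R h)"
        unfolding dist_Pair_Pair by (intro sqrt_sum_squares_le_sum) auto
      moreover have "dist (D t) (\<Delta> /\<^sub>R h) \<le> d/2"
        using vel' unfolding e2_def by (simp add: dist_norm norm_minus_commute)
      moreover have "norm (D t) \<le> B + 1" using B(2)[OF tab] by simp
      ultimately have "dist (speed g (\<gamma> t) (D t)) (speed g (f i + s *\<^sub>R \<Delta>) (\<Delta> /\<^sub>R h)) < \<eta> / (b - a)"
        using B(1)[OF tab] by (intro d) (auto simp: K_def)
      then show ?thesis by (simp add: dist_real_def)
    qed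
    have "seg g (f i) (f (Suc i)) / h = integral {0..1} (\<lambda>s. speed g (f i + s *\<^sub>R \<Delta>) (\<Delta> /\<^sub>R h))"
      unfolding seg_def \<Delta>_def[symmetric] using h by (simp add: speed_scale divide_inverse mult.commute)
    then have "speed g (\<gamma> t) (D t) - seg g (f i) (f (Suc i)) / h
        = integral {0..1} (\<lambda>s::real. speed g (\<gamma> t) (D t) - speed g (f i + s *\<^sub>R \<Delta>) (\<Delta> /\<^sub>R h))"
      by (subst integral_diff) (auto intro: seg_integrable[OF g] integrable_const_ivl)
    moreover have "norm (integral {0..1} (\<lambda>s::real. speed g (\<gamma> t) (D t) - speed g (f i + s *\<^sub>R \<Delta>) (\<Delta> /\<^sub>R h)))
        \<le> \<eta> / (b - a) * (1 - 0)"
      using pt by (intro integral_bound continuous_intros continuous_on_seg_integrand[OF g]) auto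
    ultimately show ?thesis by simp
  qed
  have "\<bar>integral {a..b} (\<lambda>t. speed g (\<gamma> t) (D t)) - (\<Sum>i<N. h * (seg g (f i) (f (Suc i)) / h))\<bar>
      \<le> \<eta> / (b - a) * (b - a)"
    by (rule riemann_approx[OF continuous_on_speed[OF g c\<gamma> D(2)]])
       (use h close in \<open>auto simp: T_def\<close>)
  then have "\<bar>l - (\<Sum>i<N. seg g (f i) (f (Suc i)))\<bar> \<le> \<eta>"
    unfolding l using riemannian_length_eq[OF D(1), of a b g] ab h by simp
  moreover have "norm (f (Suc i) - f i) < r" if "i < N" for i
    using d1(2)[of "T i" "T (Suc i)"] T[of i] T[of "Suc i"] TS[of i] that h hd
    unfolding f_def e1_def by (auto simp: dist_real_def dist_norm)
  moreover have "f 0 = x" "f N = y" unfolding f_def T_def using h \<gamma> by auto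
  ultimately show ?thesis using that[of N f] \<open>N > 0\<close> by auto
qed

lemma rdist_polygon:
  assumes "g \<in> Metrics" "rdist g x y < c" "r > 0"
  obtains f N where "N > 0" "f 0 = x" "f N = y" "\<And>i. i < N \<Longrightarrow> norm (f (Suc i) - f i) < r"
    "(\<Sum>i<N. seg g (f i) (f (Suc i))) < c"
proof -
  obtain l where l: "l \<in> curve_lengths g x y" "l < c" using rdist_less_obtain[OF assms(2)] by blast
  show ?thesis
    by (rule polygon_approx[OF assms(1) l(1), of "(c - l)/2" r])
       (use l assms that in \<open>auto simp: field_simps\<close>)
qed

lemma seg_commute:
  assumes "g \<in> Metrics"
  shows "seg g p q = seg g q p"
proof -
  let ?F = "\<lambda>s. speed g (p + s *\<^sub>R (q - p)) (q - p)"
  have "(?F has_integral seg g p q) (cbox 0 1)"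
    unfolding seg_def using seg_integrable[OF assms] by (simp add: has_integral_integral)
  from has_integral_affinity[OF this, of "-1" 1]
  have "((\<lambda>s. ?F (1 - s)) has_integral seg g p q) ((\<lambda>x. 1 - x) ` {0..1})"
    by (simp add: algebra_simps)
  moreover have "(\<lambda>x::real. 1 - x) ` {0..1} = {0..1}"
    by (auto simp: image_iff intro: bexI[of _ "1 - x" for x])
  moreover have "?F (1 - s) = speed g (q + s *\<^sub>R (p - q)) (p - q)" for s
    using speed_minus[of g "q + s *\<^sub>R (p - q)" "p - q"] by (simp add: algebra_simps)
  ultimately show ?thesis unfolding seg_def by (simp add: integral_unique)
qed

text \<open>Polygons are easier to reverse than curves: it suffices to reverse the order of the
  vertices and each single segment.\<close>

lemma rdist_commute:
  assumes g: "g \<in> Metrics"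
  shows "rdist g x y = rdist g y x"
proof -
  have "rdist g y x \<le> rdist g x y" for x y
  proof (rule field_le_epsilon)
    fix e :: real assume "e > 0"
    then obtain f N where f: "N > 0" "f 0 = x" "f N = y"
      "(\<Sum>i<N. seg g (f i) (f (Suc i))) < rdist g x y + e"
      using rdist_polygon[OF g, of x y "rdist g x y + e" 1] by (smt (verit))
    have "rdist g y x \<le> (\<Sum>i<N. seg g (f (N - i)) (f (N - Suc i)))"
      using rdist_le_sum_seg[OF g, of "\<lambda>i. f (N - i)" N] f by simp
    also have "\<dots> = (\<Sum>i<N. seg g (f (Suc (N - Suc i))) (f (N - Suc i)))"
      by (intro sum.cong) (auto simp: Suc_diff_Suc)
    also have "\<dots> = (\<Sum>i<N. seg g (f (Suc i)) (f i))"
      by (rule sum.nat_diff_reindex)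
    also have "\<dots> = (\<Sum>i<N. seg g (f i) (f (Suc i)))"
      by (simp add: seg_commute[OF g])
    finally show "rdist g y x \<le> rdist g x y + e" using f by simp
  qed
  then show ?thesis by (simp add: antisym)
qed

lemma Metrics_translate: "g \<in> Metrics \<Longrightarrow> (\<lambda>x. g (x + z)) \<in> Metrics"
  unfolding Metrics_def by (auto intro!: continuous_on_compose2[of UNIV g] continuous_intros)

lemma seg_translate: "seg (\<lambda>x. g (x + z)) p q = seg g (p + z) (q + z)"
  unfolding seg_def speed_def by (simp add: algebra_simps)

lemma rdist_translate:
  assumes g: "g \<in> Metrics"
  shows "rdist (\<lambda>x. g (x + z)) x y = rdist g (x + z) (y + z)"
proof -
  \<comment> \<open>One inequality suffices: applied to the translated metric with
    \<open>- z\<close> in place of \<open>z\<close> it turns into the other.\<close>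
  have *: "rdist (\<lambda>x. g (x + z)) x y \<le> rdist g (x + z) (y + z)" if g: "g \<in> Metrics" for g z and x y :: "real^'a"
  proof (rule field_le_epsilon)
    fix e :: real assume "e > 0"
    then obtain f N where f: "N > 0" "f 0 = x + z" "f N = y + z"
      "(\<Sum>i<N. seg g (f i) (f (Suc i))) < rdist g (x + z) (y + z) + e"
      using rdist_polygon[OF g, of "x + z" "y + z" "rdist g (x + z) (y + z) + e" 1] by (smt (verit))
    have "rdist (\<lambda>x. g (x + z)) x y \<le> (\<Sum>i<N. seg (\<lambda>x. g (x + z)) (f i - z) (f (Suc i) - z))"
      using rdist_le_sum_seg[OF Metrics_translate[OF g], of z "\<lambda>i. f i - z" N] f by simp
    also have "\<dots> = (\<Sum>i<N. seg g (f i) (f (Suc i)))" by (simp add: seg_translate)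
    finally show "rdist (\<lambda>x. g (x + z)) x y \<le> rdist g (x + z) (y + z) + e" using f by simp
  qed
  show ?thesis
    using *[OF g, of z x y] *[OF Metrics_translate[OF g, of z], of "- z" "x + z" "y + z"] by simp
qed

section \<open>Chains with vertices in a countable dense set\<close>

lemma continuous_on_seg:
  assumes g: "g \<in> Metrics"
  shows "continuous_on UNIV (\<lambda>x. seg g (fst x) (snd x))"
proof -
  have "continuous_on UNIV (\<lambda>x. integral (cbox 0 1)
      (\<lambda>s. speed g (fst x + s *\<^sub>R (snd x - fst x)) (snd x - fst x)))"
    by (rule integral_continuous_on_param)
       (auto simp: split_beta intro!: continuous_on_speed g continuous_intros)
  then show ?thesis unfolding seg_def by simp
qed

text \<open>Vertices are kept in lists because \<open>lists D\<close> is countable whenever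
  \<open>D\<close> is.\<close>

definition clen :: "'n::finite metric_field \<Rightarrow> (real^'n) list \<Rightarrow> real" where
  "clen g xs = (\<Sum>i<length xs - 1. seg g (xs ! i) (xs ! Suc i))"

lemma rdist_le_clen:
  assumes "g \<in> Metrics"
  shows "rdist g x y \<le> clen g (x # xs @ [y])"
  using rdist_le_sum_seg[OF assms, of "\<lambda>i. (x # xs @ [y]) ! i" "Suc (length xs)"]
  by (simp add: clen_def nth_append)

lemma clen_nonneg: "g \<in> Metrics \<Longrightarrow> clen g xs \<ge> 0"
  unfolding clen_def by (intro sum_nonneg seg_nonneg)

text \<open>The slack between \<open>c\<close> and the length of a polygon is divided evenly among
  its edges. Joint continuity of \<open>seg\<close> then lets every inner vertex move into
  \<open>D\<close> at that price, while the two endpoints stay fixed.\<close>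

lemma rdist_dense_chain:
  assumes g: "g \<in> Metrics" and D: "\<And>X. open X \<Longrightarrow> X \<noteq> {} \<Longrightarrow> \<exists>d\<in>D. d \<in> X"
    and c: "rdist g x y < c"
  shows "\<exists>xs\<in>lists D. clen g (x # xs @ [y]) < c"
proof -
  obtain f N where f: "N > 0" "f 0 = x" "f N = y" "(\<Sum>i<N. seg g (f i) (f (Suc i))) < c"
    using rdist_polygon[OF g c, of 1] by (smt (verit))
  define \<eta> where "\<eta> = (c - (\<Sum>i<N. seg g (f i) (f (Suc i)))) / real N"
  have "\<eta> > 0" unfolding \<eta>_def using f by simp
  have "\<exists>d>0. \<forall>p q. dist p (f i) < d \<longrightarrow> dist q (f (Suc i)) < d \<longrightarrow> dist (seg g p q) (seg g (f i) (f (Suc i))) < \<eta>" for i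
  proof -
    obtain d where d: "d > 0" "\<And>z. dist z (f i, f (Suc i)) < d \<Longrightarrow>
        dist (seg g (fst z) (snd z)) (seg g (f i) (f (Suc i))) < \<eta>"
      using continuous_on_seg[OF g] \<open>\<eta> > 0\<close> unfolding continuous_on_iff
      by (metis UNIV_I fst_conv snd_conv)
    have "dist (seg g p q) (seg g (f i) (f (Suc i))) < \<eta>"
      if "dist p (f i) < d/2" "dist q (f (Suc i)) < d/2" for p q
    proof -
      have "dist (p, q) (f i, f (Suc i)) \<le> dist p (f i) + dist q (f (Suc i))"
        unfolding dist_Pair_Pair by (intro sqrt_sum_squares_le_sum) auto
      then show ?thesis using d(2)[of "(p, q)"] that by simp
    qed
    then show ?thesis using d(1) by (intro exI[of _ "d/2"]) auto
  qed
  then obtain d where d: "\<And>i. d i > 0" "\<And>i p q. dist p (f i) < d i \<Longrightarrow> dist q (f (Suc i)) < d i \<Longrightarrow>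
      dist (seg g p q) (seg g (f i) (f (Suc i))) < \<eta>" by metis
  define \<delta> where "\<delta> = Min (d ` {..<N})"
  have \<delta>: "\<delta> > 0" "\<And>i. i < N \<Longrightarrow> \<delta> \<le> d i"
    unfolding \<delta>_def using f(1) d(1) by (auto simp: Min_gr_iff lessThan_empty_iff)
  have "\<exists>p\<in>D. dist p (f i) < \<delta>" for i
    using D[of "ball (f i) \<delta>"] \<delta>(1) by (auto simp: dist_commute)
  then obtain p where p: "\<And>i. p i \<in> D" "\<And>i. dist (p i) (f i) < \<delta>" by metis
  define q where "q i = (if i = 0 then x else if i = N then y else p i)" for i
  have q: "dist (q i) (f i) < \<delta>" for i unfolding q_def using f p \<delta> by auto
  define xs where "xs = map q [1..<N]"
  have "[0..<Suc N] = 0 # [1..<N] @ [N]"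
    using f(1) by (simp add: upt_conv_Cons)
  then have xs: "x # xs @ [y] = map q [0..<Suc N]"
    unfolding xs_def using f(1) by (simp add: q_def del: upt_Suc)
  have "clen g (x # xs @ [y]) = (\<Sum>i<N. seg g (q i) (q (Suc i)))"
    unfolding clen_def xs by (intro sum.cong) (auto simp del: upt_Suc)
  also have "\<dots> < (\<Sum>i<N. seg g (f i) (f (Suc i)) + \<eta>)"
  proof (rule sum_strict_mono)
    fix i assume "i \<in> {..<N}"
    then have "dist (seg g (q i) (q (Suc i))) (seg g (f i) (f (Suc i))) < \<eta>"
      using q[of i] q[of "Suc i"] \<delta>(2)[of i] by (intro d) auto
    then show "seg g (q i) (q (Suc i)) < seg g (f i) (f (Suc i)) + \<eta>" by (simp add: dist_real_def)
  qed (use f in auto)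
  also have "\<dots> = c" unfolding \<eta>_def using f(1) by (simp add: sum.distrib)
  finally have "clen g (x # xs @ [y]) < c" .
  moreover have "xs \<in> lists D" unfolding xs_def q_def using p by auto
  ultimately show ?thesis by blast
qed

lemma rdist_eq_INF:
  assumes g: "g \<in> Metrics" and D: "\<And>X. open X \<Longrightarrow> X \<noteq> {} \<Longrightarrow> \<exists>d\<in>D. d \<in> X"
  shows "rdist g x y = (INF xs\<in>lists D. clen g (x # xs @ [y]))"
proof (rule antisym)
  show "rdist g x y \<le> (INF xs\<in>lists D. clen g (x # xs @ [y]))"
    using rdist_le_clen[OF g] by (intro cINF_greatest) auto
  show "(INF xs\<in>lists D. clen g (x # xs @ [y])) \<le> rdist g x y"
  proof (rule dense_ge)
    fix c assume "rdist g x y < c"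
    then obtain xs where xs: "xs \<in> lists D" "clen g (x # xs @ [y]) < c"
      using rdist_dense_chain[OF g D] by blast
    have "(INF xs\<in>lists D. clen g (x # xs @ [y])) \<le> clen g (x # xs @ [y])"
      using clen_nonneg[OF g] xs by (intro cINF_lower bdd_belowI[of _ 0]) auto
    then show "(INF xs\<in>lists D. clen g (x # xs @ [y])) \<le> c" using xs by simp
  qed
qed

section \<open>Local observables and independence\<close>

text \<open>The events that can be decided from \<open>g\<close> on \<open>U\<close>. They are
  pulled back along \<open>restrict\<close> because finite-range dependence is a statement about
  these restrictions.\<close>

definition loc :: "(real^'n) set \<Rightarrow> 'n::finite metric_field measure" where
  "loc U = vimage_algebra Metrics (\<lambda>g. restrict g U) (Pi\<^sub>M U (\<lambda>_. borel))"

definition transl :: "real^'n \<Rightarrow> 'n::finite metric_field \<Rightarrow> 'n metric_field" where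
  "transl z g = (\<lambda>x. g (x + z))"

lemma transl_Metrics: "g \<in> Metrics \<Longrightarrow> transl z g \<in> Metrics"
  unfolding transl_def by (rule Metrics_translate)

lemma rdist_transl: "g \<in> Metrics \<Longrightarrow> rdist (transl z g) x y = rdist g (x + z) (y + z)"
  unfolding transl_def by (rule rdist_translate)

lemma space_loc [simp]: "space (loc U) = Metrics"
  unfolding loc_def by simp

lemma restrict_measurable_loc: "(\<lambda>g. restrict g U) \<in> loc U \<rightarrow>\<^sub>M Pi\<^sub>M U (\<lambda>_. borel)"
  unfolding loc_def by (rule measurable_vimage_algebra1) (auto simp: space_PiM)

lemma loc_eval:
  assumes "x \<in> U"
  shows "(\<lambda>g. g x) \<in> borel_measurable (loc U)"
proof -
  have "(\<lambda>g. restrict g U x) \<in> borel_measurable (loc U)"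
    by (rule measurable_compose[OF restrict_measurable_loc measurable_component_singleton[OF assms]])
  then show ?thesis using assms by simp
qed

lemma sets_loc: "sets (loc U) = {(\<lambda>g. restrict g U) -` A \<inter> Metrics | A. A \<in> sets (Pi\<^sub>M U (\<lambda>_. borel))}"
  unfolding loc_def by (rule sets_vimage_algebra2) (auto simp: space_PiM)

lemma measurable_into_loc:
  assumes "T \<in> space N \<rightarrow> Metrics" "\<And>x. x \<in> U \<Longrightarrow> (\<lambda>g. T g x) \<in> borel_measurable N"
  shows "T \<in> N \<rightarrow>\<^sub>M loc U"
  unfolding loc_def using assms
  by (intro measurable_vimage_algebra2 measurable_restrict) auto

lemma loc_mono:
  assumes "f \<in> borel_measurable (loc U)" "U \<subseteq> V"
  shows "f \<in> borel_measurable (loc V)"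
proof -
  have "(\<lambda>g. g) \<in> loc V \<rightarrow>\<^sub>M loc U"
    using assms(2) by (intro measurable_into_loc loc_eval) auto
  from measurable_compose[OF this assms(1)] show ?thesis .
qed

lemma loc_transl:
  assumes "f \<in> borel_measurable (loc U)" "(\<lambda>x. x + z) ` U \<subseteq> V"
  shows "(\<lambda>g. f (transl z g)) \<in> borel_measurable (loc V)"
proof (rule measurable_compose[OF _ assms(1)])
  show "transl z \<in> loc V \<rightarrow>\<^sub>M loc U"
  proof (rule measurable_into_loc)
    show "transl z \<in> space (loc V) \<rightarrow> Metrics" using transl_Metrics by auto
    show "(\<lambda>g. transl z g x) \<in> borel_measurable (loc V)" if "x \<in> U" for x
      unfolding transl_def using that assms(2) by (intro loc_eval) auto
  qed
qed

lemma quadratic_form_loc: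
  assumes "x \<in> U"
  shows "(\<lambda>g. v \<bullet> (g x *v v)) \<in> borel_measurable (loc U)"
proof (rule measurable_compose[OF loc_eval[OF assms]])
  show "(\<lambda>A::real^'a^'a. v \<bullet> (A *v v)) \<in> borel_measurable borel"
    by (intro borel_measurable_continuous_onI continuous_on_quadratic_form continuous_intros)
qed

lemma speed_loc: "x \<in> U \<Longrightarrow> (\<lambda>g. speed g x v) \<in> borel_measurable (loc U)"
  unfolding speed_def by (rule measurable_compose[OF quadratic_form_loc borel_measurable_sqrt])

lemma seg_loc:
  assumes "closed_segment p q \<subseteq> U"
  shows "(\<lambda>g. seg g p q) \<in> borel_measurable (loc U)"
proof (rule borel_measurable_LIMSEQ_real)
  fix g :: "'a metric_field" assume "g \<in> space (loc U)"
  then show "(\<lambda>N. (\<Sum>i<N. speed g (p + (real i / real N) *\<^sub>R (q - p)) (q - p)) / real N) \<longlonglongrightarrow> seg g p q"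
    unfolding seg_def by (intro riemann_sum_tendsto continuous_on_seg_integrand) simp
next
  fix N
  have "p + (real i / real N) *\<^sub>R (q - p) \<in> U" if "i < N" for i
  proof -
    have "p + (real i / real N) *\<^sub>R (q - p) = (1 - real i / real N) *\<^sub>R p + (real i / real N) *\<^sub>R q"
      by (simp add: algebra_simps)
    then show ?thesis using that assms by (auto simp: closed_segment_def intro!: subsetD[OF assms] exI[of _ "real i / real N"])
  qed
  then show "(\<lambda>g. (\<Sum>i<N. speed g (p + (real i / real N) *\<^sub>R (q - p)) (q - p)) / real N) \<in> borel_measurable (loc U)"
    by (intro borel_measurable_divide borel_measurable_sum speed_loc borel_measurable_const) auto
qed

lemma clen_loc:
  assumes "convex U" "set xs \<subseteq> U"
  shows "(\<lambda>g. clen g xs) \<in> borel_measurable (loc U)"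
  unfolding clen_def using assms
  by (intro borel_measurable_sum seg_loc closed_segment_subset)
     (auto simp: subset_iff intro!: nth_mem)

lemma rdist_loc: "(\<lambda>g. rdist g x y) \<in> borel_measurable (loc (UNIV :: (real^'n::finite) set))"
proof -
  obtain D :: "(real^'n) set" where D: "countable D" "\<And>X. open X \<Longrightarrow> X \<noteq> {} \<Longrightarrow> \<exists>d\<in>D. d \<in> X"
    using countable_dense_setE by blast
  have "(\<lambda>g. INF xs\<in>lists D. clen g (x # xs @ [y])) \<in> borel_measurable (loc UNIV)"
    by (intro borel_measurable_cINF clen_loc countable_lists D bdd_belowI2[of _ 0] clen_nonneg) auto
  then show ?thesis
    by (rule measurable_cong[THEN iffD1, rotated]) (use rdist_eq_INF[OF _ D(2)] in auto)
qed

section \<open>The random metric: measurability, stationarity and independence\<close>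

locale random_metric = prob_space P for P :: "'n::finite metric_field measure" +
  assumes sets_P: "sets P = sets metric_space_algebra"
    and translation_inv: "translation_invariant P"
    and finite_range: "finite_range_dependence P"
    and exp_moments: "exponential_moments P"
begin

lemma cylinders_Pow: "cylinders \<subseteq> Pow (Metrics :: 'n metric_field set)"
  unfolding cylinders_def by auto

lemma space_P: "space P = Metrics"
  using sets_eq_imp_space_eq[OF sets_P] cylinders_Pow
  unfolding metric_space_algebra_def by (simp add: space_measure_of)

lemma cylinders_P: "A \<in> cylinders \<Longrightarrow> A \<in> sets P"
  unfolding sets_P metric_space_algebra_def using cylinders_Pow by (simp add: in_measure_of)

lemma eval_measurable: "(\<lambda>g. g x) \<in> borel_measurable P"
proof (rule measurableI)
  fix A :: "(real^'n^'n) set" assume "A \<in> sets borel"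
  then have "{g \<in> Metrics. \<forall>y\<in>{x}. g y \<in> A} \<in> cylinders"
    unfolding cylinders_def by (intro CollectI exI[of _ "{x}"] exI[of _ "\<lambda>_. A"]) auto
  then show "(\<lambda>g. g x) -` A \<inter> space P \<in> sets P"
    using cylinders_P by (simp add: space_P vimage_def Int_def conj_commute)
qed simp

lemma id_measurable_loc: "(\<lambda>g. g) \<in> P \<rightarrow>\<^sub>M loc U"
  by (rule measurable_into_loc) (auto simp: space_P eval_measurable)

lemma loc_measurable: "f \<in> borel_measurable (loc U) \<Longrightarrow> f \<in> borel_measurable P"
  using measurable_compose[OF id_measurable_loc] .

lemma rdist_measurable [measurable]: "(\<lambda>g. rdist g x y) \<in> borel_measurable P"
  by (rule loc_measurable[OF rdist_loc])

lemma transl_measurable [measurable]: "transl z \<in> P \<rightarrow>\<^sub>M P"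
proof -
  have "transl z \<in> P \<rightarrow>\<^sub>M (metric_space_algebra :: 'n metric_field measure)"
    unfolding metric_space_algebra_def
  proof (rule measurable_measure_of[OF cylinders_Pow])
    show "transl z \<in> space P \<rightarrow> Metrics" using transl_Metrics by (auto simp: space_P)
    fix A :: "'n metric_field set" assume "A \<in> cylinders"
    then obtain F B where A: "A = {g \<in> Metrics. \<forall>x\<in>F. g x \<in> B x}" "finite F" "\<And>x. x \<in> F \<Longrightarrow> B x \<in> sets borel"
      unfolding cylinders_def by blast
    have "transl z -` A \<inter> space P = {g \<in> Metrics. \<forall>y\<in>(\<lambda>x. x + z) ` F. g y \<in> B (y - z)}"
      unfolding A space_P using transl_Metrics by (auto simp: transl_def)
    also have "\<dots> \<in> cylinders"
      unfolding cylinders_def using A by (intro CollectI exI[of _ "(\<lambda>x. x + z) ` F"] exI[of _ "\<lambda>y. B (y - z)"]) auto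
    finally show "transl z -` A \<inter> space P \<in> sets P" by (rule cylinders_P)
  qed
  then show ?thesis using measurable_cong_sets[OF refl sets_P] by blast
qed

lemma distr_transl: "distr P P (transl z) = P"
  using translation_inv unfolding translation_invariant_def transl_def by blast

lemma expectation_transl:
  fixes f :: "'n metric_field \<Rightarrow> real"
  assumes "f \<in> borel_measurable P"
  shows "expectation (\<lambda>g. f (transl z g)) = expectation f"
  using integral_distr[OF transl_measurable assms, of z] by (simp add: distr_transl)

lemma integrable_transl:
  fixes f :: "'n metric_field \<Rightarrow> real"
  assumes "integrable P f"
  shows "integrable P (\<lambda>g. f (transl z g))"
  using integrable_distr_eq[OF transl_measurable borel_measurable_integrable[OF assms], of z] assms
  by (simp add: distr_transl)

definition "R0 = (SOME R. R > 0 \<and> (\<forall>U V. (\<forall>x\<in>U. \<forall>y\<in>V. norm (x - y) \<ge> R) \<longrightarrow>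
        indep_var (Pi\<^sub>M U (\<lambda>_. borel)) (\<lambda>g. restrict g U) (Pi\<^sub>M V (\<lambda>_. borel)) (\<lambda>g. restrict g V)))"

lemma R0: "R0 > 0" "(\<And>x y. x \<in> U \<Longrightarrow> y \<in> V \<Longrightarrow> norm (x - y) \<ge> R0) \<Longrightarrow>
    indep_var (Pi\<^sub>M U (\<lambda>_. borel)) (\<lambda>g. restrict g U) (Pi\<^sub>M V (\<lambda>_. borel)) (\<lambda>g. restrict g V)"
  using someI_ex[OF finite_range[unfolded finite_range_dependence_def], folded R0_def] by blast+

text \<open>The sigma-algebra generated by a function of \<open>g\<close> on \<open>U\<close> is
  contained in that of the restriction to \<open>U\<close>, and independence passes to smaller
  sigma-algebras.\<close>

lemma loc_indep:
  fixes f h :: "'n metric_field \<Rightarrow> real"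
  assumes sep: "\<And>x y. x \<in> U \<Longrightarrow> y \<in> V \<Longrightarrow> norm (x - y) \<ge> R0"
    and f: "f \<in> borel_measurable (loc U)" and h: "h \<in> borel_measurable (loc V)"
  shows "indep_var borel f borel h"
proof -
  have sub: "sigma_sets (space P) {f -` A \<inter> space P |A. A \<in> sets borel}
      \<subseteq> sigma_sets (space P) {(\<lambda>g. restrict g U) -` A \<inter> space P | A. A \<in> sets (Pi\<^sub>M U (\<lambda>_. borel))}"
    if f: "f \<in> borel_measurable (loc U)" for f :: "'n metric_field \<Rightarrow> real" and U
  proof (rule sigma_sets_mono)
    show "{f -` A \<inter> space P |A. A \<in> sets borel} \<subseteq>
        sigma_sets (space P) {(\<lambda>g. restrict g U) -` A \<inter> space P | A. A \<in> sets (Pi\<^sub>M U (\<lambda>_. borel))}"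
    proof clarify
      fix A :: "real set" assume "A \<in> sets borel"
      then have "f -` A \<inter> space P \<in> sets (loc U)"
        using measurable_sets[OF f] by (simp add: space_P)
      then show "f -` A \<inter> space P \<in> sigma_sets (space P)
          {(\<lambda>g. restrict g U) -` A \<inter> space P | A. A \<in> sets (Pi\<^sub>M U (\<lambda>_. borel))}"
        unfolding sets_loc by (intro sigma_sets.Basic) (simp add: space_P)
    qed
  qed
  have "indep_set
      (sigma_sets (space P) {(\<lambda>g. restrict g U) -` A \<inter> space P | A. A \<in> sets (Pi\<^sub>M U (\<lambda>_. borel))})
      (sigma_sets (space P) {(\<lambda>g. restrict g V) -` A \<inter> space P | A. A \<in> sets (Pi\<^sub>M V (\<lambda>_. borel))})"
    using R0(2)[OF sep] unfolding indep_var_eq by blast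
  then have "indep_set (sigma_sets (space P) {f -` A \<inter> space P |A. A \<in> sets borel})
      (sigma_sets (space P) {h -` A \<inter> space P |A. A \<in> sets borel})"
    unfolding indep_set_def
    by (rule indep_sets_mono_sets) (use sub[OF f] sub[OF h] in \<open>auto split: bool.split\<close>)
  then show ?thesis unfolding indep_var_eq using loc_measurable f h by blast
qed

text \<open>Peel off one index at a time: its window is at distance at least \<open>R0\<close> from
  the union of all the others, so the expectation factors. Pairwise separation of the windows is
  enough because independence holds for arbitrary sets of points.\<close>

lemma exp_sum_separated:
  fixes X :: "'i \<Rightarrow> 'n metric_field \<Rightarrow> real"
  assumes "finite C" and "m \<ge> 0"
    and X: "\<And>z. z \<in> C \<Longrightarrow> X z \<in> borel_measurable (loc (U z))"
    and E: "\<And>z. z \<in> C \<Longrightarrow> integrable P (\<lambda>g. exp (X z g))" "\<And>z. z \<in> C \<Longrightarrow> expectation (\<lambda>g. exp (X z g)) \<le> m"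
    and sep: "\<And>z w x y. z \<in> C \<Longrightarrow> w \<in> C \<Longrightarrow> z \<noteq> w \<Longrightarrow> x \<in> U z \<Longrightarrow> y \<in> U w \<Longrightarrow> norm (x - y) \<ge> R0"
  shows "integrable P (\<lambda>g. exp (\<Sum>z\<in>C. X z g)) \<and> expectation (\<lambda>g. exp (\<Sum>z\<in>C. X z g)) \<le> m ^ card C"
  using assms(1) X E sep
proof (induction C)
  case empty
  show ?case using prob_space by auto
next
  case (insert a C)
  have "integrable P (\<lambda>g. exp (\<Sum>z\<in>C. X z g)) \<and> expectation (\<lambda>g. exp (\<Sum>z\<in>C. X z g)) \<le> m ^ card C"
    by (rule insert.IH; rule insert.prems; simp)
  then have IH: "integrable P (\<lambda>g. exp (\<Sum>z\<in>C. X z g))" "expectation (\<lambda>g. exp (\<Sum>z\<in>C. X z g)) \<le> m ^ card C"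
    by auto
  have "(\<lambda>g. \<Sum>z\<in>C. X z g) \<in> borel_measurable (loc (\<Union>z\<in>C. U z))"
    using insert.prems(1) by (intro borel_measurable_sum loc_mono[OF insert.prems(1)]) auto
  then have mC: "(\<lambda>g. exp (\<Sum>z\<in>C. X z g)) \<in> borel_measurable (loc (\<Union>z\<in>C. U z))"
    by measurable
  have ma: "(\<lambda>g. exp (X a g)) \<in> borel_measurable (loc (U a))"
    using insert.prems(1)[of a] by measurable
  have ind: "indep_var borel (\<lambda>g. exp (X a g)) borel (\<lambda>g. exp (\<Sum>z\<in>C. X z g))"
    by (rule loc_indep[OF _ ma mC]) (use insert.hyps insert.prems(4) in blast)
  have eq: "exp (\<Sum>z\<in>insert a C. X z g) = exp (X a g) * exp (\<Sum>z\<in>C. X z g)" for g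
    using insert.hyps by (simp add: exp_add)
  have "expectation (\<lambda>g. exp (\<Sum>z\<in>insert a C. X z g)) = expectation (\<lambda>g. exp (X a g)) * expectation (\<lambda>g. exp (\<Sum>z\<in>C. X z g))"
    unfolding eq by (rule indep_var_lebesgue_integral[OF ind]) (use insert.prems(2) IH in auto)
  also have "\<dots> \<le> m * m ^ card C"
    using insert.prems(3)[of a] IH \<open>m \<ge> 0\<close> by (intro mult_mono) auto
  finally have "expectation (\<lambda>g. exp (\<Sum>z\<in>insert a C. X z g)) \<le> m ^ card (insert a C)"
    using insert.hyps by simp
  moreover have "integrable P (\<lambda>g. exp (\<Sum>z\<in>insert a C. X z g))"
    unfolding eq by (rule indep_var_integrable[OF ind]) (use insert.prems(2) IH in auto)
  ultimately show ?case by blast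
qed

text \<open>If the total reaches \<open>s\<close>, then one of the \<open>K\<close> colour classes
  reaches \<open>s / K\<close>. Within a class the summands are independent, so the exponential
  Markov inequality applies; a union bound over the colours gives the factor
  \<open>K\<close>.\<close>

lemma chernoff_coloured:
  fixes X :: "'i \<Rightarrow> 'n metric_field \<Rightarrow> real" and m s :: real
  assumes "finite S" "card S \<le> N" and "m \<ge> 1" and Q: "finite Q" "col ` S \<subseteq> Q" "card Q = K" "K > 0"
    and X: "\<And>z. z \<in> S \<Longrightarrow> X z \<in> borel_measurable (loc (U z))"
    and E: "\<And>z. z \<in> S \<Longrightarrow> integrable P (\<lambda>g. exp (X z g))" "\<And>z. z \<in> S \<Longrightarrow> expectation (\<lambda>g. exp (X z g)) \<le> m"
    and sep: "\<And>z w x y. z \<in> S \<Longrightarrow> w \<in> S \<Longrightarrow> z \<noteq> w \<Longrightarrow> col z = col w \<Longrightarrow> x \<in> U z \<Longrightarrow> y \<in> U w \<Longrightarrow> norm (x - y) \<ge> R0"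
  shows "prob {g \<in> space P. (\<Sum>z\<in>S. X z g) \<ge> s} \<le> real K * m ^ N * exp (- s / real K)"
proof -
  define C where "C q = {z \<in> S. col z = q}" for q
  define A where "A q = {g \<in> space P. (\<Sum>z\<in>C q. X z g) \<ge> s / real K}" for q
  have finC: "finite (C q)" for q unfolding C_def using assms(1) by auto
  have mX: "X z \<in> borel_measurable P" if "z \<in> S" for z using loc_measurable[OF X[OF that]] .
  have msum: "(\<lambda>g. \<Sum>z\<in>C q. X z g) \<in> borel_measurable P" for q
    unfolding C_def by (intro borel_measurable_sum mX) auto
  have A: "A q \<in> sets P" for q
    unfolding A_def using msum[of q] by measurable
  have PA: "prob (A q) \<le> m ^ N * exp (- s / real K)" for q
  proof -
    have "integrable P (\<lambda>g. exp (\<Sum>z\<in>C q. X z g)) \<and> expectation (\<lambda>g. exp (\<Sum>z\<in>C q. X z g)) \<le> m ^ card (C q)"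
    proof (rule exp_sum_separated[where U = U, OF finC])
      show "0 \<le> m" using \<open>m \<ge> 1\<close> by simp
      fix z assume z: "z \<in> C q"
      then have zS: "z \<in> S" unfolding C_def by auto
      show "X z \<in> borel_measurable (loc (U z))" by (rule X[OF zS])
      show "integrable P (\<lambda>g. exp (X z g))" "expectation (\<lambda>g. exp (X z g)) \<le> m" by (rule E[OF zS])+
      fix w x y assume w: "w \<in> C q" "z \<noteq> w" "x \<in> U z" "y \<in> U w"
      show "norm (x - y) \<ge> R0"
        by (rule sep[of z w]) (use z w in \<open>auto simp: C_def\<close>)
    qed
    then have es: "integrable P (\<lambda>g. exp (\<Sum>z\<in>C q. X z g))" "expectation (\<lambda>g. exp (\<Sum>z\<in>C q. X z g)) \<le> m ^ card (C q)"
      by auto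
    have "A q = {g \<in> space P. exp (s / real K) \<le> exp (\<Sum>z\<in>C q. X z g)}"
      unfolding A_def by auto
    then have "prob (A q) \<le> (1 / exp (s / real K)) * expectation (\<lambda>g. exp (\<Sum>z\<in>C q. X z g))"
      using integral_Markov_inequality_measure[OF es(1), of "space P" "exp (s / real K)"] by simp
    also have "\<dots> \<le> (1 / exp (s / real K)) * m ^ card (C q)"
      using es by (intro mult_left_mono) auto
    \<comment> \<open>Raising the exponent from the size of the class to \<open>N\<close> uses
      \<open>m \<ge> 1\<close>; the bound is then the same for all colours.\<close>
    also have "\<dots> \<le> (1 / exp (s / real K)) * m ^ N"
      using \<open>m \<ge> 1\<close> \<open>card S \<le> N\<close> card_mono[OF \<open>finite S\<close>, of "C q"]
      by (intro mult_left_mono power_increasing) (auto simp: C_def)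
    finally show ?thesis by (simp add: exp_minus field_simps)
  qed
  have "{g \<in> space P. (\<Sum>z\<in>S. X z g) \<ge> s} \<subseteq> (\<Union>q\<in>Q. A q)"
  proof (rule subsetI, rule ccontr)
    fix g assume g: "g \<in> {g \<in> space P. (\<Sum>z\<in>S. X z g) \<ge> s}" "g \<notin> (\<Union>q\<in>Q. A q)"
    have "(\<Sum>z\<in>S. X z g) = (\<Sum>q\<in>Q. \<Sum>z\<in>C q. X z g)"
      unfolding C_def by (rule sum.group[symmetric]) (use assms in auto)
    also have "\<dots> < (\<Sum>q\<in>Q. s / real K)"
      by (rule sum_strict_mono) (use g Q in \<open>auto simp: A_def\<close>)
    also have "\<dots> = s" using Q by simp
    finally show False using g by simp
  qed
  then have "prob {g \<in> space P. (\<Sum>z\<in>S. X z g) \<ge> s} \<le> prob (\<Union>q\<in>Q. A q)"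
    using A Q by (intro finite_measure_mono) auto
  also have "\<dots> \<le> (\<Sum>q\<in>Q. prob (A q))"
    using A Q by (intro finite_measure_subadditive_finite) auto
  also have "\<dots> \<le> (\<Sum>q\<in>Q. m ^ N * exp (- s / real K))"
    by (intro sum_mono PA)
  finally show ?thesis using Q by simp
qed

end

definition cube :: "int^'n \<Rightarrow> real \<Rightarrow> (real^'n::finite) set" where
  "cube z r = {x. \<forall>i. \<bar>x $ i - real_of_int (z $ i)\<bar> \<le> r}"

lemma finite_vecs:
  assumes "finite A"
  shows "finite {v::'a^'n::finite. \<forall>i. v $ i \<in> A}" "card {v::'a^'n::finite. \<forall>i. v $ i \<in> A} \<le> card A ^ CARD('n)"
proof -
  have eq: "{v::'a^'n. \<forall>i. v $ i \<in> A} = vec_lambda ` (PiE UNIV (\<lambda>_. A))"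
    by (auto simp: image_iff PiE_def Pi_def intro: vec_lambda_eta[symmetric] exI[of _ "($) v" for v])
  show "finite {v::'a^'n. \<forall>i. v $ i \<in> A}" unfolding eq using assms by (intro finite_imageI finite_PiE) auto
  show "card {v::'a^'n. \<forall>i. v $ i \<in> A} \<le> card A ^ CARD('n)"
    unfolding eq using card_image_le[of "PiE UNIV (\<lambda>_. A)" vec_lambda] assms
    by (simp add: card_PiE finite_PiE)
qed

context random_metric
begin

text \<open>A cell is coloured by its coordinates modulo a large integer, so two cells of the same
  colour are far apart in some coordinate. The number \<open>K\<close> of colours depends on
  \<open>r\<close> and \<open>R0\<close> only, not on \<open>S\<close>, \<open>X\<close> or
  \<open>m\<close>; this uniformity is what later makes union bounds over many sets \<open>S\<close>
  possible.\<close>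

lemma chernoff_lattice:
  obtains K :: nat where "K > 0"
    "\<And>(X :: int^'n \<Rightarrow> 'n metric_field \<Rightarrow> real) m S N s. finite S \<Longrightarrow> card S \<le> N \<Longrightarrow> m \<ge> 1 \<Longrightarrow>
      (\<And>z. z \<in> S \<Longrightarrow> X z \<in> borel_measurable (loc (cube z r))) \<Longrightarrow>
      (\<And>z. z \<in> S \<Longrightarrow> integrable P (\<lambda>g. exp (X z g))) \<Longrightarrow>
      (\<And>z. z \<in> S \<Longrightarrow> expectation (\<lambda>g. exp (X z g)) \<le> m) \<Longrightarrow>
      prob {g \<in> space P. (\<Sum>z\<in>S. X z g) \<ge> s} \<le> real K * m ^ N * exp (- s / real K)"
proof -
  obtain M0 :: nat where M0: "R0 + 2 * r \<le> real M0" using real_arch_simple by blast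
  \<comment> \<open>The modulus must exceed \<open>R0\<close> by the two radii \<open>r\<close> of
    the windows.\<close>
  define M where "M = int M0 + 1"
  have M: "M > 0" "R0 + 2 * r \<le> of_int M" using M0 unfolding M_def by auto
  define Q where "Q = {v::int^'n. \<forall>i. v $ i \<in> {0..<M}}"
  define col where "col z = (\<chi> i. z $ i mod M)" for z :: "int^'n"
  have Q: "finite Q" unfolding Q_def by (rule finite_vecs) auto
  have colQ: "col z \<in> Q" for z unfolding col_def Q_def using M by auto
  have K: "card Q > 0" using Q colQ card_gt_0_iff by blast
  have sep: "norm (x - y) \<ge> R0" if "z \<noteq> w" "col z = col w" "x \<in> cube z r" "y \<in> cube w r" for z w x y
  proof -
    obtain i where i: "z $ i \<noteq> w $ i" using \<open>z \<noteq> w\<close> by (auto simp: vec_eq_iff)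
    have "z $ i mod M = w $ i mod M" using that(2) unfolding col_def by (auto simp: vec_eq_iff)
    then have "M dvd z $ i - w $ i" by (simp add: mod_eq_dvd_iff)
    then have "M \<le> \<bar>z $ i - w $ i\<bar>" using i dvd_imp_le_int[of "z $ i - w $ i" M] M by simp
    then have "of_int M \<le> \<bar>real_of_int (z $ i) - real_of_int (w $ i)\<bar>"
      by (metis of_int_abs of_int_diff of_int_le_iff)
    moreover have "\<bar>x $ i - of_int (z $ i)\<bar> \<le> r" "\<bar>y $ i - of_int (w $ i)\<bar> \<le> r"
      using that unfolding cube_def by auto
    ultimately have "R0 \<le> \<bar>(x - y) $ i\<bar>" using M by simp
    also have "\<dots> \<le> norm (x - y)" by (rule component_le_norm_cart)
    finally show ?thesis .
  qed
  show ?thesis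
  proof (rule that[OF K])
    fix X :: "int^'n \<Rightarrow> 'n metric_field \<Rightarrow> real" and m :: real and S :: "(int^'n) set" and N :: nat and s :: real
    assume "finite S" "card S \<le> N" "m \<ge> 1"
      "\<And>z. z \<in> S \<Longrightarrow> X z \<in> borel_measurable (loc (cube z r))"
      "\<And>z. z \<in> S \<Longrightarrow> integrable P (\<lambda>g. exp (X z g))" "\<And>z. z \<in> S \<Longrightarrow> expectation (\<lambda>g. exp (X z g)) \<le> m"
    then show "prob {g \<in> space P. (\<Sum>z\<in>S. X z g) \<ge> s} \<le> real (card Q) * m ^ N * exp (- s / real (card Q))"
      by (intro chernoff_coloured[where col = col and U = "\<lambda>z. cube z r" and Q = Q] Q K refl sep)
         (auto intro: colQ)
  qed
qed

end

section \<open>Upper bounds for the distance\<close>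

lemma symmetric_inner:
  fixes A :: "real^'n^'n"
  assumes "transpose A = A"
  shows "u \<bullet> (A *v w) = w \<bullet> (A *v u)"
  by (metis assms dot_lmul_matrix inner_commute transpose_matrix_vector)

lemma linear_coefficient_zero:
  fixes a c :: real
  assumes "\<And>t. 2 * t * a + t\<^sup>2 * c \<ge> 0"
  shows "a = 0"
proof (rule ccontr)
  assume "a \<noteq> 0"
  define k where "k = \<bar>c\<bar> + 1"
  have "k > 0" unfolding k_def by simp
  have "2 * (- a / k) * a + (- a / k)\<^sup>2 * c = (a\<^sup>2 / k\<^sup>2) * (c - 2 * k)"
    using \<open>k > 0\<close> by (simp add: power2_eq_square field_simps)
  moreover have "(a\<^sup>2 / k\<^sup>2) * (c - 2 * k) < 0"
    using \<open>a \<noteq> 0\<close> \<open>k > 0\<close> by (intro mult_pos_neg) (auto simp: k_def)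
  ultimately show False using assms[of "- a / k"] by simp
qed

text \<open>Eigenvectors of distinct eigenvalues are orthogonal, hence linearly independent.
  Finiteness gives the \<open>Max\<close> in \<open>max_eigenvalue\<close> its meaning.\<close>

lemma finite_symmetric_eigenvalues:
  fixes A :: "real^'n^'n"
  assumes "transpose A = A"
  shows "finite {l. \<exists>v. v \<noteq> 0 \<and> A *v v = l *\<^sub>R v}"
proof -
  let ?E = "{l. \<exists>v. v \<noteq> 0 \<and> A *v v = l *\<^sub>R v}"
  have "\<forall>l\<in>?E. \<exists>v. v \<noteq> 0 \<and> A *v v = l *\<^sub>R v" by simp
  from bchoice[OF this] obtain e where e: "\<And>l. l \<in> ?E \<Longrightarrow> e l \<noteq> 0 \<and> A *v e l = l *\<^sub>R e l" by blast
  have orth: "e l \<bullet> e k = 0" if "l \<in> ?E" "k \<in> ?E" "l \<noteq> k" for l k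
    using symmetric_inner[OF assms, of "e l" "e k"] e[OF that(1)] e[OF that(2)] that(3)
    by (simp add: inner_commute)
  have inj: "inj_on e ?E"
    using orth e by (metis (mono_tags, lifting) inj_onI inner_eq_zero_iff)
  have "pairwise orthogonal (e ` ?E)"
    unfolding pairwise_def orthogonal_def using orth by auto
  moreover have "0 \<notin> e ` ?E" using e by (metis (no_types, lifting) imageE)
  ultimately have "independent (e ` ?E)" by (rule pairwise_orthogonal_independent)
  then show ?thesis using inj independent_imp_finite finite_imageD by blast
qed

text \<open>The quadratic form attains its maximum over the unit sphere at some \<open>u\<close>;
  the first-order condition there says that \<open>u\<close> is an eigenvector.\<close>

lemma symmetric_max_eigenvector:
  fixes A :: "real^'n^'n"
  assumes "transpose A = A"
  obtains l u where "norm u = 1" "A *v u = l *\<^sub>R u" "\<And>v. v \<bullet> (A *v v) \<le> l * (norm v)\<^sup>2"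
proof -
  have "\<exists>u\<in>sphere 0 1. \<forall>v\<in>sphere 0 1. v \<bullet> (A *v v) \<le> u \<bullet> (A *v u)"
    by (intro continuous_attains_sup compact_sphere continuous_on_quadratic_form continuous_intros)
       (auto intro!: exI[of _ "axis undefined 1"] simp: norm_axis_1)
  then obtain u :: "real^'n" where u: "norm u = 1" "\<And>v. norm v = 1 \<Longrightarrow> v \<bullet> (A *v v) \<le> u \<bullet> (A *v u)"
    by auto
  define l where "l = u \<bullet> (A *v u)"
  have le: "v \<bullet> (A *v v) \<le> l * (norm v)\<^sup>2" for v
  proof (cases "v = 0")
    case False
    have "(v /\<^sub>R norm v) \<bullet> (A *v (v /\<^sub>R norm v)) \<le> l"
      unfolding l_def using False by (intro u) simp
    moreover have "(v /\<^sub>R norm v) \<bullet> (A *v (v /\<^sub>R norm v)) = (v \<bullet> (A *v v)) / (norm v)\<^sup>2"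
      by (simp add: matrix_vector_mult_scaleR power2_eq_square divide_inverse)
    ultimately show ?thesis using False by (simp add: pos_divide_le_eq)
  qed simp
  \<comment> \<open>\<open>w\<close> is the defect of \<open>u\<close> as an eigenvector. Moving
    from \<open>u\<close> in the direction \<open>w\<close> has first-order effect
    \<open>2 * t * (w \<bullet> w)\<close> on a nonnegative expression that vanishes at
    \<open>t = 0\<close>, so \<open>w = 0\<close>.\<close>
  define w where "w = l *\<^sub>R u - A *v u"
  have "w \<bullet> w = 0"
  proof (rule linear_coefficient_zero)
    fix t :: real
    have uu: "u \<bullet> u = 1" using u(1) by (simp add: dot_square_norm)
    have "0 \<le> l * (norm (u + t *\<^sub>R w))\<^sup>2 - (u + t *\<^sub>R w) \<bullet> (A *v (u + t *\<^sub>R w))"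
      using le[of "u + t *\<^sub>R w"] by simp
    also have "(norm (u + t *\<^sub>R w))\<^sup>2 = u \<bullet> u + 2 * t * (u \<bullet> w) + t\<^sup>2 * (w \<bullet> w)"
      unfolding power2_norm_eq_inner
      by (simp add: inner_add_left inner_add_right inner_commute[of w u] power2_eq_square algebra_simps)
    also have "l * (u \<bullet> u + 2 * t * (u \<bullet> w) + t\<^sup>2 * (w \<bullet> w)) - (u + t *\<^sub>R w) \<bullet> (A *v (u + t *\<^sub>R w))
        = l * (u \<bullet> u) - u \<bullet> (A *v u) + 2 * t * (l * (u \<bullet> w) - w \<bullet> (A *v u)) + t\<^sup>2 * (l * (w \<bullet> w) - w \<bullet> (A *v w))"
      using symmetric_inner[OF assms, of u w]
      by (simp add: matrix_vector_right_distrib matrix_vector_mult_scaleR inner_add_left inner_add_right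
          inner_commute[of w u] power2_eq_square algebra_simps)
    also have "l * (u \<bullet> u) - u \<bullet> (A *v u) = 0" using uu by (simp add: l_def)
    also have "l * (u \<bullet> w) - w \<bullet> (A *v u) = w \<bullet> w"
      unfolding w_def by (simp add: inner_diff_left inner_diff_right inner_commute algebra_simps)
    finally show "0 \<le> 2 * t * (w \<bullet> w) + t\<^sup>2 * (l * (w \<bullet> w) - w \<bullet> (A *v w))" by simp
  qed
  then have "A *v u = l *\<^sub>R u" unfolding w_def by simp
  then show ?thesis using that u(1) le by blast
qed

lemma max_eigenvalue_bounds:
  fixes A :: "real^'n^'n"
  assumes "transpose A = A"
  shows "v \<bullet> (A *v v) \<le> max_eigenvalue A * (norm v)\<^sup>2"
    and "(\<And>v. norm v = 1 \<Longrightarrow> v \<bullet> (A *v v) \<le> B) \<Longrightarrow> max_eigenvalue A \<le> B"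
proof -
  obtain l u where lu: "norm u = 1" "A *v u = l *\<^sub>R u" "\<And>v. v \<bullet> (A *v v) \<le> l * (norm v)\<^sup>2"
    using symmetric_max_eigenvector[OF assms] by blast
  have "u \<noteq> 0" using lu(1) by auto
  then have mem: "l \<in> {l. \<exists>v. v \<noteq> 0 \<and> A *v v = l *\<^sub>R v}" using lu(2) by auto
  then have l: "l \<le> max_eigenvalue A"
    unfolding max_eigenvalue_def by (intro Max_ge finite_symmetric_eigenvalues assms)
  then have "l * (norm v)\<^sup>2 \<le> max_eigenvalue A * (norm v)\<^sup>2" by (intro mult_right_mono) auto
  with lu(3)[of v] show "v \<bullet> (A *v v) \<le> max_eigenvalue A * (norm v)\<^sup>2" by simp
  assume B: "\<And>v. norm v = 1 \<Longrightarrow> v \<bullet> (A *v v) \<le> B"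
  show "max_eigenvalue A \<le> B"
    unfolding max_eigenvalue_def
  proof (intro Max.boundedI finite_symmetric_eigenvalues assms)
    fix k assume "k \<in> {l. \<exists>v. v \<noteq> 0 \<and> A *v v = l *\<^sub>R v}"
    then obtain v where v: "v \<noteq> 0" "A *v v = k *\<^sub>R v" by blast
    have "(v /\<^sub>R norm v) \<bullet> (A *v (v /\<^sub>R norm v)) \<le> B" using v by (intro B) simp
    moreover have "(v /\<^sub>R norm v) \<bullet> (A *v (v /\<^sub>R norm v)) = (v \<bullet> (A *v v)) / (norm v)\<^sup>2"
      by (simp add: matrix_vector_mult_scaleR power2_eq_square divide_inverse)
    moreover have "v \<bullet> (A *v v) = k * (norm v)\<^sup>2" using v by (simp add: dot_square_norm)
    moreover have "(norm v)\<^sup>2 \<noteq> 0" using v by simp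
    ultimately show "k \<le> B" by simp
  qed (use mem in blast)
qed

lemma Metrics_sym: "g \<in> Metrics \<Longrightarrow> transpose (g x) = g x"
  unfolding Metrics_def spd_def by auto

lemma quadratic_form_bounded:
  fixes g :: "'n::finite metric_field"
  assumes g: "g \<in> Metrics" and "compact K"
  obtains B where "\<And>x (v :: real^'n). x \<in> K \<Longrightarrow> v \<bullet> (g x *v v) \<le> B * (norm v)\<^sup>2"
proof -
  have "continuous_on (K \<times> sphere 0 1) (\<lambda>z. snd z \<bullet> (g (fst z) *v snd z))"
    by (intro continuous_on_quadratic_form continuous_on_compose2[OF Metrics_continuous[OF g, of UNIV]] continuous_intros) auto
  then have "bounded ((\<lambda>z. snd z \<bullet> (g (fst z) *v snd z)) ` (K \<times> sphere 0 1))"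
    by (intro compact_imp_bounded compact_continuous_image compact_Times assms compact_sphere)
  then obtain B where B: "\<And>x v. x \<in> K \<Longrightarrow> norm v = 1 \<Longrightarrow> \<bar>v \<bullet> (g x *v v)\<bar> \<le> B"
    unfolding bounded_iff by fastforce
  show ?thesis
  proof (rule that[of B])
    fix x v :: "real^'n" assume x: "x \<in> K"
    have "max_eigenvalue (g x) \<le> B"
      using B[OF x] by (intro max_eigenvalue_bounds(2) Metrics_sym g) (auto simp: abs_le_iff)
    then have "max_eigenvalue (g x) * (norm v)\<^sup>2 \<le> B * (norm v)\<^sup>2" by (intro mult_right_mono) auto
    then show "v \<bullet> (g x *v v) \<le> B * (norm v)\<^sup>2"
      using max_eigenvalue_bounds(1)[OF Metrics_sym[OF g], of v x] by simp
  qed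
qed

lemma rayleigh_le_Lambda0:
  assumes g: "g \<in> Metrics" and x: "x \<in> unit_cell"
  shows "v \<bullet> (g x *v v) \<le> Lambda0 g * (norm v)\<^sup>2"
proof -
  \<comment> \<open>The supremum in \<open>Lambda0\<close> runs over a half-open cell; it is finite
    because the closed box is compact.\<close>
  obtain B where B: "\<And>x v. x \<in> cbox (\<chi> i. -1/2) (\<chi> i. 1/2) \<Longrightarrow> v \<bullet> (g x *v v) \<le> B * (norm v)\<^sup>2"
    using quadratic_form_bounded[OF g compact_cbox] by blast
  have "max_eigenvalue (g y) \<le> B" if "y \<in> unit_cell" for y
  proof (rule max_eigenvalue_bounds(2)[OF Metrics_sym[OF g]])
    fix v :: "real^'a" assume "norm v = 1"
    moreover have "y \<in> cbox (\<chi> i. -1/2) (\<chi> i. 1/2)"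
      using that unfolding unit_cell_def mem_box_cart by (auto intro: less_imp_le)
    ultimately show "v \<bullet> (g y *v v) \<le> B" using B[of y v] by simp
  qed
  then have "bdd_above ((\<lambda>y. max_eigenvalue (g y)) ` unit_cell)" by (intro bdd_aboveI2)
  then have "max_eigenvalue (g x) \<le> Lambda0 g" unfolding Lambda0_def by (intro cSUP_upper x)
  then have "max_eigenvalue (g x) * (norm v)\<^sup>2 \<le> Lambda0 g * (norm v)\<^sup>2" by (intro mult_right_mono) auto
  then show ?thesis using max_eigenvalue_bounds(1)[OF Metrics_sym[OF g], of v x] by simp
qed

section \<open>Random weights of unit cells\<close>

definition dense_pts :: "(real^'n::finite) set" where
  "dense_pts = (SOME D. countable D \<and> (\<forall>X. open X \<longrightarrow> X \<noteq> {} \<longrightarrow> (\<exists>d\<in>D. d \<in> X)))"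

lemma dense_pts: "countable (dense_pts :: (real^'n::finite) set)"
  "open X \<Longrightarrow> X \<noteq> {} \<Longrightarrow> \<exists>d\<in>dense_pts. d \<in> (X :: (real^'n::finite) set)"
proof -
  have "\<exists>D::(real^'n) set. countable D \<and> (\<forall>X. open X \<longrightarrow> X \<noteq> {} \<longrightarrow> (\<exists>d\<in>D. d \<in> X))"
  proof -
    obtain D :: "(real^'n) set" where "countable D" "\<And>X. open X \<Longrightarrow> X \<noteq> {} \<Longrightarrow> \<exists>d\<in>D. d \<in> X"
      using countable_dense_setE by blast
    then show ?thesis by (intro exI[of _ D]) auto
  qed
  from someI_ex[OF this, folded dense_pts_def]
  show "countable (dense_pts :: (real^'n::finite) set)"
    "open X \<Longrightarrow> X \<noteq> {} \<Longrightarrow> \<exists>d\<in>dense_pts. d \<in> (X :: (real^'n::finite) set)" by blast+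
qed

definition emb :: "int^'n \<Rightarrow> real^'n::finite" where
  "emb z = (\<chi> i. of_int (z $ i))"

definition icube :: "int^'n \<Rightarrow> real \<Rightarrow> (real^'n::finite) set" where
  "icube z r = {x. \<forall>i. \<bar>x $ i - real_of_int (z $ i)\<bar> < r}"

lemma icube_box: "icube z r = box (\<chi> i. of_int (z $ i) - r) (\<chi> i. of_int (z $ i) + r)"
  unfolding icube_def set_eq_iff mem_box_cart by (auto simp: abs_less_iff algebra_simps)

lemma cube_cbox: "cube z r = cbox (\<chi> i. of_int (z $ i) - r) (\<chi> i. of_int (z $ i) + r)"
  unfolding cube_def set_eq_iff mem_box_cart by (auto simp: abs_le_iff algebra_simps)

lemma open_icube: "open (icube z r)" unfolding icube_box by (rule open_box)
lemma compact_cube: "compact (cube z r)" unfolding cube_cbox by (rule compact_cbox)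
lemma convex_cube: "convex (cube z r)" unfolding cube_cbox by (rule convex_box)
lemma icube_subset_cube: "icube z r \<subseteq> cube z r" unfolding icube_def cube_def by (auto intro: less_imp_le)
lemma emb_in_icube: "r > 0 \<Longrightarrow> emb z \<in> icube z r" unfolding icube_def emb_def by auto

lemma cube_subset_closure_icube:
  assumes "r > 0"
  shows "cube z r \<subseteq> closure (icube z r)"
proof -
  have "box (\<chi> i. of_int (z $ i) - r) (\<chi> i. of_int (z $ i) + r) \<noteq> {}"
    using emb_in_icube[OF assms, of z] unfolding icube_box by auto
  then show ?thesis unfolding icube_box cube_cbox using closure_box by blast
qed

lemma closure_dense_pts:
  fixes X :: "(real^'n::finite) set"
  assumes "open X"
  shows "X \<subseteq> closure (dense_pts \<inter> X)"
proof
  fix x assume "x \<in> X"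
  show "x \<in> closure (dense_pts \<inter> X)"
    unfolding closure_iff_nhds_not_empty
  proof clarify
    fix A S assume "S \<subseteq> A" "open S" "x \<in> S" "dense_pts \<inter> X \<inter> A = {}"
    moreover have "\<exists>d\<in>dense_pts. d \<in> X \<inter> S"
      by (rule dense_pts(2)) (use calculation \<open>x \<in> X\<close> assms in auto)
    ultimately show False by blast
  qed
qed

text \<open>A measurable and local stand-in for \<open>Lambda0\<close> on the cell around
  \<open>z\<close>: the largest Rayleigh quotient, taken over countably many points and vectors
  only. Points come from the open cube, where dense points are sure to exist; the closed cube is
  recovered by continuity.\<close>

definition rayleigh :: "int^'n \<Rightarrow> 'n::finite metric_field \<Rightarrow> real" where
  "rayleigh z g = (SUP p\<in>(dense_pts \<inter> icube z (1/2)) \<times> (dense_pts \<inter> - {0}).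
      (snd p \<bullet> (g (fst p) *v snd p)) / (norm (snd p))\<^sup>2)"

lemma rayleigh_index_nonempty: "(dense_pts \<inter> icube z (1/2)) \<times> (dense_pts \<inter> - {0 :: real^'n::finite}) \<noteq> {}"
proof -
  have "\<exists>d\<in>dense_pts. d \<in> icube z (1/2)"
    by (intro dense_pts(2) open_icube) (use emb_in_icube[of "1/2" z] in auto)
  moreover have "\<exists>d\<in>dense_pts. d \<in> - {0 :: real^'n}"
    by (intro dense_pts(2)) (auto intro!: exI[of _ "axis undefined 1"] simp: axis_eq_0_iff)
  ultimately show ?thesis by auto
qed

lemma rayleigh_bdd:
  assumes g: "g \<in> Metrics"
  shows "bdd_above ((\<lambda>p. (snd p \<bullet> (g (fst p) *v snd p)) / (norm (snd p))\<^sup>2) `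
    ((dense_pts \<inter> icube z (1/2)) \<times> (dense_pts \<inter> - {0})))"
proof -
  obtain B where B: "\<And>x v. x \<in> cube z (1/2) \<Longrightarrow> v \<bullet> (g x *v v) \<le> B * (norm v)\<^sup>2"
    using quadratic_form_bounded[OF g compact_cube] by blast
  show ?thesis
  proof (rule bdd_aboveI2[of _ _ B])
    fix p :: "(real^'a) \<times> (real^'a)" assume "p \<in> (dense_pts \<inter> icube z (1/2)) \<times> (dense_pts \<inter> - {0})"
    then have "fst p \<in> cube z (1/2)" "snd p \<noteq> 0" using icube_subset_cube[of z "1/2"] by auto
    then show "(snd p \<bullet> (g (fst p) *v snd p)) / (norm (snd p))\<^sup>2 \<le> B"
      using B[of "fst p" "snd p"] by (simp add: pos_divide_le_eq)
  qed
qed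

lemma rayleigh_loc: "rayleigh z \<in> borel_measurable (loc (cube z (1/2)))"
proof -
  have "(\<lambda>g. rayleigh z g) \<in> borel_measurable (loc (cube z (1/2)))"
    unfolding rayleigh_def
  proof (rule borel_measurable_cSUP)
    show "countable ((dense_pts \<inter> icube z (1/2)) \<times> (dense_pts \<inter> - {0 :: real^'a}))"
      by (intro countable_SIGMA countable_Int1 dense_pts)
    show "(\<lambda>g. (snd p \<bullet> (g (fst p) *v snd p)) / (norm (snd p))\<^sup>2) \<in> borel_measurable (loc (cube z (1/2)))"
      if "p \<in> (dense_pts \<inter> icube z (1/2)) \<times> (dense_pts \<inter> - {0})" for p
    proof -
      have "fst p \<in> cube z (1/2)" using that icube_subset_cube[of z "1/2"] by auto
      then show ?thesis by (intro borel_measurable_divide quadratic_form_loc borel_measurable_const)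
    qed
  qed (use rayleigh_bdd in auto)
  then show ?thesis by simp
qed

lemma rayleigh_nonneg:
  fixes g :: "'n::finite metric_field"
  assumes "g \<in> Metrics"
  shows "rayleigh z g \<ge> 0"
proof -
  obtain p :: "(real^'n) \<times> (real^'n)" where p: "p \<in> (dense_pts \<inter> icube z (1/2)) \<times> (dense_pts \<inter> - {0})"
    using rayleigh_index_nonempty[of z] by blast
  have "0 \<le> (snd p \<bullet> (g (fst p) *v snd p)) / (norm (snd p))\<^sup>2"
    using Metrics_nonneg[OF assms] by simp
  also have "\<dots> \<le> rayleigh z g"
    unfolding rayleigh_def by (rule cSUP_upper2[OF _ p order_refl]) (rule rayleigh_bdd[OF assms])
  finally show ?thesis .
qed

text \<open>The inequality defines a closed set of pairs \<open>(x, v)\<close>, and it holds on the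
  dense set over which the supremum is taken.\<close>

lemma quadratic_form_le_rayleigh:
  fixes g :: "'n::finite metric_field"
  assumes g: "g \<in> Metrics" and x: "x \<in> cube z (1/2)"
  shows "v \<bullet> (g x *v v) \<le> rayleigh z g * (norm v)\<^sup>2"
proof -
  let ?F = "\<lambda>p :: (real^'n) \<times> (real^'n). snd p \<bullet> (g (fst p) *v snd p) - rayleigh z g * (norm (snd p))\<^sup>2"
  have cont: "continuous_on UNIV ?F"
    by (intro continuous_on_diff continuous_on_quadratic_form continuous_on_compose2[OF Metrics_continuous[OF g, of UNIV]] continuous_intros) auto
  have cl: "closed (?F -` {..0})"
    using continuous_on_closed_vimage[of UNIV ?F] cont by auto
  let ?S = "(dense_pts \<inter> icube z (1/2)) \<times> (dense_pts \<inter> - {0})"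
  have "?S \<subseteq> ?F -` {..0}"
  proof
    fix p :: "(real^'n) \<times> (real^'n)" assume p: "p \<in> ?S"
    have "(snd p \<bullet> (g (fst p) *v snd p)) / (norm (snd p))\<^sup>2 \<le> rayleigh z g"
      unfolding rayleigh_def by (rule cSUP_upper[OF p rayleigh_bdd[OF g]])
    moreover have "(norm (snd p))\<^sup>2 > 0" using p by auto
    ultimately show "p \<in> ?F -` {..0}" by (simp add: pos_divide_le_eq)
  qed
  then have "closure ?S \<subseteq> ?F -` {..0}" using cl by (intro closure_minimal)
  moreover have "closure ?S = closure (dense_pts \<inter> icube z (1/2)) \<times> closure (dense_pts \<inter> - {0})"
    by (rule closure_Times)
  moreover have "x \<in> closure (dense_pts \<inter> icube z (1/2))"
  proof -
    have "closure (icube z (1/2)) \<subseteq> closure (dense_pts \<inter> icube z (1/2))"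
      using closure_dense_pts[OF open_icube] by (intro closure_minimal) auto
    then show ?thesis using x cube_subset_closure_icube[of "1/2" z] by auto
  qed
  moreover have "v \<in> closure (dense_pts \<inter> - {0})" if "v \<noteq> 0"
    using closure_dense_pts[of "- {0}"] that by auto
  ultimately have "v \<noteq> 0 \<Longrightarrow> (x, v) \<in> ?F -` {..0}" by blast
  then show ?thesis by (cases "v = 0") auto
qed

text \<open>This gives the weights exponential moments that are uniform in \<open>z\<close>: the
  shift moves the cell around \<open>z\<close> onto the unit cell, and the law of \<open>g\<close>
  does not notice it.\<close>

lemma rayleigh_le_transl_Lambda0:
  fixes g :: "'n::finite metric_field"
  assumes g: "g \<in> Metrics"
  shows "rayleigh z g \<le> Lambda0 (transl (emb z) g)"
  unfolding rayleigh_def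
proof (rule cSUP_least[OF rayleigh_index_nonempty])
  fix p :: "(real^'n) \<times> (real^'n)" assume p: "p \<in> (dense_pts \<inter> icube z (1/2)) \<times> (dense_pts \<inter> - {0})"
  have "fst p - emb z \<in> unit_cell"
  proof -
    have "\<bar>fst p $ i - of_int (z $ i)\<bar> < 1/2" for i using p unfolding icube_def by auto
    then have "\<bar>(fst p - emb z) $ i\<bar> < 1/2" for i
      unfolding emb_def by simp
    then have "- 1/2 \<le> (fst p - emb z) $ i \<and> (fst p - emb z) $ i < 1/2" for i
      by (metis abs_less_iff divide_minus_left less_imp_le minus_less_iff)
    then show ?thesis unfolding unit_cell_def by blast
  qed
  from rayleigh_le_Lambda0[OF transl_Metrics[OF g, of "emb z"] this, of "snd p"]
  have *: "snd p \<bullet> (g (fst p) *v snd p) \<le> Lambda0 (transl (emb z) g) * (norm (snd p))\<^sup>2"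
    by (simp add: transl_def)
  show "(snd p \<bullet> (g (fst p) *v snd p)) / (norm (snd p))\<^sup>2 \<le> Lambda0 (transl (emb z) g)"
  proof -
    have "(norm (snd p))\<^sup>2 > 0" using p by auto
    with * show ?thesis by (simp add: pos_divide_le_eq)
  qed
qed

text \<open>Lengths are governed by the square root of the largest eigenvalue; adding 1 makes the
  weight dominate that root, since \<open>sqrt r \<le> 1 + r\<close>.\<close>

definition wt :: "int^'n \<Rightarrow> 'n::finite metric_field \<Rightarrow> real" where
  "wt z g = 1 + rayleigh z g"

lemma wt_ge_1: "g \<in> Metrics \<Longrightarrow> wt z g \<ge> 1"
  unfolding wt_def using rayleigh_nonneg by auto

lemma wt_loc: "wt z \<in> borel_measurable (loc (cube z (1/2)))"
  unfolding wt_def[abs_def] using rayleigh_loc by (intro borel_measurable_add) auto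

lemma rdist_le_wt:
  fixes g :: "'n::finite metric_field"
  assumes g: "g \<in> Metrics" and p: "p \<in> cube z (1/2)" and q: "q \<in> cube z (1/2)"
  shows "rdist g p q \<le> real CARD('n) * wt z g"
proof -
  have "p + s *\<^sub>R (q - p) \<in> cube z (1/2)" if "0 \<le> s" "s \<le> 1" for s
    using convexD_alt[OF convex_cube p q that] by (simp add: algebra_simps)
  then have "seg g p q \<le> norm (q - p) * sqrt (rayleigh z g)"
    by (intro seg_le g quadratic_form_le_rayleigh)
  also have "\<dots> \<le> real CARD('n) * wt z g"
  proof (rule mult_mono)
    have "\<bar>(q - p) $ i\<bar> \<le> 1" for i
    proof -
      have "\<bar>p $ i - real_of_int (z $ i)\<bar> \<le> 1/2" "\<bar>q $ i - real_of_int (z $ i)\<bar> \<le> 1/2"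
        using p q unfolding cube_def by auto
      then show ?thesis unfolding vector_minus_component by linarith
    qed
    then have "(\<Sum>i\<in>UNIV. \<bar>(q - p) $ i\<bar>) \<le> (\<Sum>i\<in>(UNIV::'n set). 1)" by (intro sum_mono)
    then show "norm (q - p) \<le> real CARD('n)" using norm_le_l1_cart[of "q - p"] by simp
    show "sqrt (rayleigh z g) \<le> wt z g"
      unfolding wt_def using rayleigh_nonneg[OF g, of z]
      by (intro real_le_lsqrt) (auto simp: power2_eq_square algebra_simps)
  qed (use rayleigh_nonneg[OF g] in auto)
  finally show ?thesis using rdist_le_seg[OF g, of p q] by simp
qed

section \<open>King moves on the integer lattice: \<open>kd\<close> is the Chebyshev
  distance\<close>

definition kd :: "int^'n \<Rightarrow> int^'n::finite \<Rightarrow> nat" where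
  "kd z w = Max (range (\<lambda>i. nat \<bar>z $ i - w $ i\<bar>))"

lemma kd_le_iff: "kd z w \<le> m \<longleftrightarrow> (\<forall>i. \<bar>z $ i - w $ i\<bar> \<le> int m)"
  unfolding kd_def by (auto simp: nat_le_iff)

definition king_step :: "int^'n \<Rightarrow> int^'n \<Rightarrow> int^'n::finite" where
  "king_step w z = (\<chi> i. z $ i + sgn (w $ i - z $ i))"

lemma kd_king_step:
  assumes "kd z w \<le> Suc m"
  shows "kd (king_step w z) w \<le> m"
  unfolding kd_le_iff
proof
  fix i
  have "\<bar>z $ i - w $ i\<bar> \<le> int (Suc m)" using assms unfolding kd_le_iff by blast
  then show "\<bar>king_step w z $ i - w $ i\<bar> \<le> int m"
    unfolding king_step_def sgn_if by (simp add: abs_if split: if_splits)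
qed

lemma king_step_kd: "kd z (king_step w z) \<le> 1"
  unfolding kd_le_iff king_step_def by (auto simp: sgn_if)

lemma rdist_neighbours:
  fixes g :: "'n::finite metric_field"
  assumes g: "g \<in> Metrics" and "kd z w \<le> 1"
  shows "rdist g (emb z) (emb w) \<le> real CARD('n) * wt z g + real CARD('n) * wt w g"
proof -
  \<comment> \<open>The midpoint lies in both closed cubes, so each half of the way is paid by the
    weight of one of them.\<close>
  define m where "m = (1/2) *\<^sub>R (emb z + emb w)"
  have h: "\<bar>real_of_int (z $ i) - real_of_int (w $ i)\<bar> \<le> 1" for i
    using assms(2) unfolding kd_le_iff by (metis of_int_1 of_int_abs of_int_diff of_int_le_iff of_nat_1)
  have "\<bar>m $ i - real_of_int (z $ i)\<bar> \<le> 1/2" "\<bar>m $ i - real_of_int (w $ i)\<bar> \<le> 1/2" for i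
    using h[of i] unfolding m_def emb_def by (auto simp: field_simps abs_le_iff)
  then have m: "m \<in> cube z (1/2)" "m \<in> cube w (1/2)"
    unfolding cube_def by auto
  have "emb z \<in> cube z (1/2)" "emb w \<in> cube w (1/2)" unfolding cube_def emb_def by auto
  then show ?thesis
    using rdist_triangle[OF g, of "emb z" "emb w" m] rdist_le_wt[OF g _ m(1)] rdist_le_wt[OF g m(2)]
    by (meson add_mono order_trans)
qed

text \<open>The extra summand with \<open>wt z g\<close> is a reserve that strengthens the
  induction: it pays for the half edge that enters \<open>z\<close> when the path is prolonged, so
  each cell pays at most twice. That \<open>S\<close> stays within \<open>kd\<close> distance
  \<open>m\<close> of \<open>w\<close> ensures that a farther starting cell is new and its weight is
  really added.\<close>

lemma king_path:
  fixes z w :: "int^'n::finite"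
  shows "kd z w \<le> m \<Longrightarrow> \<exists>S. finite S \<and> card S \<le> Suc m \<and> z \<in> S \<and> w \<in> S \<and> (\<forall>s\<in>S. kd s w \<le> m) \<and>
    (\<forall>g\<in>Metrics. rdist g (emb z) (emb w) + real CARD('n) * wt z g \<le> 2 * real CARD('n) * (\<Sum>s\<in>S. wt s g))"
proof (induction m arbitrary: z)
  case 0
  then have "\<forall>i. z $ i = w $ i" unfolding kd_le_iff by simp
  then have "z = w" by (simp add: vec_eq_iff)
  then show ?case using 0 wt_ge_1
    by (intro exI[of _ "{w}"]) (auto simp: order_trans[OF zero_le_one wt_ge_1])
next
  case (Suc m)
  show ?case
  proof (cases "kd z w \<le> m")
    case True
    from Suc.IH[OF True] obtain S where "finite S" "card S \<le> Suc m" "z \<in> S" "w \<in> S" "\<forall>s\<in>S. kd s w \<le> m"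
      "\<forall>g\<in>Metrics. rdist g (emb z) (emb w) + real CARD('n) * wt z g \<le> 2 * real CARD('n) * (\<Sum>s\<in>S. wt s g)" by blast
    then show ?thesis by (intro exI[of _ S]) auto
  next
    case False
    define z' where "z' = king_step w z"
    from Suc.IH[OF kd_king_step[OF Suc.prems], folded z'_def] obtain S where S: "finite S" "card S \<le> Suc m"
      "z' \<in> S" "w \<in> S" "\<forall>s\<in>S. kd s w \<le> m"
      "\<forall>g\<in>Metrics. rdist g (emb z') (emb w) + real CARD('n) * wt z' g \<le> 2 * real CARD('n) * (\<Sum>s\<in>S. wt s g)" by blast
    have "z \<notin> S" using S False by auto
    have "rdist g (emb z) (emb w) + real CARD('n) * wt z g \<le> 2 * real CARD('n) * (\<Sum>s\<in>insert z S. wt s g)"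
      if g: "g \<in> Metrics" for g
    proof -
      have "rdist g (emb z) (emb w) \<le> real CARD('n) * wt z g + real CARD('n) * wt z' g + rdist g (emb z') (emb w)"
        using rdist_triangle[OF g, of "emb z" "emb w" "emb z'"]
          rdist_neighbours[OF g king_step_kd[of z w], folded z'_def] by linarith
      then show ?thesis using S(6)[rule_format, OF g] S(1) \<open>z \<notin> S\<close> by (simp add: algebra_simps)
    qed
    then show ?thesis using S Suc.prems \<open>z \<notin> S\<close> by (intro exI[of _ "insert z S"]) auto
  qed
qed

text \<open>One set of cells serves all metrics and all points of the two cubes. Being
  deterministic, its weight sum is open to a Chernoff bound. The constant 3 consists of the 2 of
  \<open>king_path\<close>, whose reserve covers the first leg, and of 1 for the last leg inside the
  cube of \<open>w\<close>.\<close>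

definition kpath :: "int^'n \<Rightarrow> int^'n \<Rightarrow> (int^'n::finite) set" where
  "kpath z w = (SOME S. finite S \<and> card S \<le> Suc (kd z w) \<and>
    (\<forall>g\<in>Metrics. \<forall>x\<in>cube z (1/2). \<forall>y\<in>cube w (1/2). rdist g x y \<le> 3 * real CARD('n) * (\<Sum>s\<in>S. wt s g)))"

lemma kpath:
  fixes z w :: "int^'n::finite"
  shows "finite (kpath z w)" "card (kpath z w) \<le> Suc (kd z w)"
    "g \<in> Metrics \<Longrightarrow> x \<in> cube z (1/2) \<Longrightarrow> y \<in> cube w (1/2) \<Longrightarrow>
      rdist g x y \<le> 3 * real CARD('n) * (\<Sum>s\<in>kpath z w. wt s g)"
proof -
  obtain S where S: "finite S" "card S \<le> Suc (kd z w)" "z \<in> S" "w \<in> S"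
    "\<forall>g\<in>Metrics. rdist g (emb z) (emb w) + real CARD('n) * wt z g \<le> 2 * real CARD('n) * (\<Sum>s\<in>S. wt s g)"
    using king_path[OF order_refl, of z w] by blast
  have "rdist g x y \<le> 3 * real CARD('n) * (\<Sum>s\<in>S. wt s g)"
    if g: "g \<in> Metrics" and xy: "x \<in> cube z (1/2)" "y \<in> cube w (1/2)" for g x y
  proof -
    have e: "emb z \<in> cube z (1/2)" "emb w \<in> cube w (1/2)" unfolding cube_def emb_def by auto
    have "rdist g x y \<le> rdist g x (emb z) + (rdist g (emb z) (emb w) + rdist g (emb w) y)"
      using rdist_triangle[OF g, of x y "emb z"] rdist_triangle[OF g, of "emb z" y "emb w"] by linarith
    also have "\<dots> \<le> real CARD('n) * wt z g + (rdist g (emb z) (emb w) + real CARD('n) * wt w g)"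
      using rdist_le_wt[OF g xy(1) e(1)] rdist_le_wt[OF g e(2) xy(2)] by simp
    also have "\<dots> \<le> 2 * real CARD('n) * (\<Sum>s\<in>S. wt s g) + real CARD('n) * wt w g"
      using S(5)[rule_format, OF g] by linarith
    also have "real CARD('n) * wt w g \<le> real CARD('n) * (\<Sum>s\<in>S. wt s g)"
      using S wt_ge_1[OF g] by (intro mult_left_mono member_le_sum) (auto intro: order_trans[OF zero_le_one])
    finally show ?thesis by (simp add: algebra_simps)
  qed
  then have "\<exists>S. finite S \<and> card S \<le> Suc (kd z w) \<and>
    (\<forall>g\<in>Metrics. \<forall>x\<in>cube z (1/2). \<forall>y\<in>cube w (1/2). rdist g x y \<le> 3 * real CARD('n) * (\<Sum>s\<in>S. wt s g))"
    using S by (intro exI[of _ S]) auto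
  from someI_ex[OF this, folded kpath_def]
  show "finite (kpath z w)" "card (kpath z w) \<le> Suc (kd z w)"
    "g \<in> Metrics \<Longrightarrow> x \<in> cube z (1/2) \<Longrightarrow> y \<in> cube w (1/2) \<Longrightarrow>
      rdist g x y \<le> 3 * real CARD('n) * (\<Sum>s\<in>kpath z w. wt s g)" by blast+
qed

definition near :: "real^'n \<Rightarrow> int^'n::finite" where
  "near x = (\<chi> i. round (x $ i))"

lemma near_cube: "x \<in> cube (near x) (1/2)"
proof -
  have "\<bar>x $ i - real_of_int (round (x $ i))\<bar> \<le> 1/2" for i
    using of_int_round_abs_le[of "x $ i"] by (simp add: abs_minus_commute)
  then show ?thesis unfolding cube_def near_def by simp
qed

lemma near_diff:
  fixes x y :: "real^'n::finite"
  shows "\<bar>real_of_int (near x $ i) - real_of_int (near y $ i)\<bar> \<le> norm (x - y) + 1"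
proof -
  have "\<bar>x $ i - real_of_int (near x $ i)\<bar> \<le> 1/2" "\<bar>y $ i - real_of_int (near y $ i)\<bar> \<le> 1/2"
    using near_cube[of x] near_cube[of y] unfolding cube_def by auto
  moreover have "\<bar>x $ i - y $ i\<bar> \<le> norm (x - y)" using component_le_norm_cart[of "x - y" i] by simp
  ultimately show ?thesis by linarith
qed

lemma kd_near: "kd (near x) (near y) \<le> nat \<lfloor>norm (x - y) + 1\<rfloor>"
  unfolding kd_le_iff
proof
  fix i
  have "real_of_int \<bar>near x $ i - near y $ i\<bar> \<le> norm (x - y) + 1"
    using near_diff[of x i y] by simp
  then show "\<bar>near x $ i - near y $ i\<bar> \<le> int (nat \<lfloor>norm (x - y) + 1\<rfloor>)"
    using le_floor_iff[of "\<bar>near x $ i - near y $ i\<bar>" "norm (x - y) + 1"] by linarith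
qed

lemma power_le_exp:
  fixes c :: real
  assumes "c > 0"
  obtains C where "\<And>n::nat. (2 * real n + 3) ^ k \<le> C * exp (c * real n)"
proof -
  have "((\<lambda>x::real. x ^ k / exp x) \<longlongrightarrow> 0) at_top" by (rule tendsto_power_div_exp_0)
  \<comment> \<open>Since \<open>(c/2) * (2 * n + 3) = c * n + 3 * c / 2\<close>, this argument
    produces the desired exponential up to a constant factor.\<close>
  moreover have "filterlim (\<lambda>n::nat. (c/2) * (2 * real n + 3)) at_top sequentially"
    using assms by real_asymp
  ultimately have "(\<lambda>n::nat. ((c/2) * (2 * real n + 3)) ^ k / exp ((c/2) * (2 * real n + 3))) \<longlonglongrightarrow> 0"
    by (rule filterlim_compose)
  then have "Bseq (\<lambda>n::nat. ((c/2) * (2 * real n + 3)) ^ k / exp ((c/2) * (2 * real n + 3)))"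
    using convergent_imp_Bseq convergent_def by blast
  then obtain B where B: "\<And>n::nat. norm (((c/2) * (2 * real n + 3)) ^ k / exp ((c/2) * (2 * real n + 3))) \<le> B"
    unfolding Bseq_def by blast
  have "(2 * real n + 3) ^ k \<le> (B * exp (3 * c / 2) / (c/2) ^ k) * exp (c * real n)" for n :: nat
  proof -
    have "((c/2) * (2 * real n + 3)) ^ k / exp ((c/2) * (2 * real n + 3)) \<le> B"
      by (rule order_trans[OF abs_ge_self B[of n, unfolded real_norm_def]])
    then have "((c/2) * (2 * real n + 3)) ^ k \<le> B * exp ((c/2) * (2 * real n + 3))"
      by (simp add: pos_divide_le_eq)
    also have "exp ((c/2) * (2 * real n + 3)) = exp (3 * c / 2) * exp (c * real n)"
      by (simp add: exp_add[symmetric] algebra_simps)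
    finally have "(c/2) ^ k * (2 * real n + 3) ^ k \<le> B * (exp (3 * c / 2) * exp (c * real n))"
      by (simp only: power_mult_distrib)
    then have "(2 * real n + 3) ^ k \<le> (B * (exp (3 * c / 2) * exp (c * real n))) / (c/2) ^ k"
      using assms by (subst pos_le_divide_eq) (auto simp: mult.commute)
    then show ?thesis by (simp add: algebra_simps)
  qed
  then show ?thesis using that by blast
qed

section \<open>Moments of the weights and a uniform upper bound at large scales\<close>

context random_metric
begin

lemma wt_moments:
  obtains m where "m \<ge> 1" "\<And>z. integrable P (\<lambda>g. exp (wt z g))" "\<And>z. expectation (\<lambda>g. exp (wt z g)) \<le> m"
proof -
  have L: "integrable P (\<lambda>g. exp (Lambda0 g))"
    using exp_moments[unfolded exponential_moments_def, rule_format, of 1] by simp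
  \<comment> \<open>The final 1 only secures \<open>m \<ge> 1\<close>, which the Chernoff bounds ask
    for.\<close>
  define m where "m = exp 1 * expectation (\<lambda>g. exp (Lambda0 g)) + 1"
  have int: "integrable P (\<lambda>g. exp 1 * exp (Lambda0 (transl (emb z) g)))" for z
    using integrable_transl[OF L] by simp
  have le: "exp (wt z g) \<le> exp 1 * exp (Lambda0 (transl (emb z) g))" if "g \<in> space P" for z g
    using rayleigh_le_transl_Lambda0[of g z] that unfolding wt_def space_P by (simp add: exp_add[symmetric])
  have meas: "(\<lambda>g. exp (wt z g)) \<in> borel_measurable P" for z
    using loc_measurable[OF wt_loc] by measurable
  have int': "integrable P (\<lambda>g. exp (wt z g))" for z
    by (rule Bochner_Integration.integrable_bound[OF int[of z] meas]) (use le in auto)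
  have "expectation (\<lambda>g. exp (wt z g)) \<le> m" for z
  proof -
    have "expectation (\<lambda>g. exp (wt z g)) \<le> expectation (\<lambda>g. exp 1 * exp (Lambda0 (transl (emb z) g)))"
      by (intro integral_mono int int' le)
    also have "\<dots> = exp 1 * expectation (\<lambda>g. exp (Lambda0 g))"
      using expectation_transl[OF borel_measurable_integrable[OF L], of "emb z"] by simp
    finally show ?thesis unfolding m_def by simp
  qed
  moreover have "m \<ge> 1" unfolding m_def by simp
  ultimately show ?thesis using that int' by blast
qed

text \<open>Squares are dominated by exponentials, as \<open>x^2 / 2 \<le> exp x\<close> for
  nonnegative \<open>x\<close>. Second moments are what the law of large numbers along a ray will
  use.\<close>

lemma sum_wt_square_integrable: "integrable P (\<lambda>g. (\<Sum>s\<in>S. wt s g) ^ 2)"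
proof (cases "finite S")
  case True
  obtain m where m: "m \<ge> 1" "\<And>z. integrable P (\<lambda>g. exp (wt z g))" "\<And>z. expectation (\<lambda>g. exp (wt z g)) \<le> m"
    using wt_moments by blast
  have mw: "wt z \<in> borel_measurable P" for z using loc_measurable[OF wt_loc] .
  have sq: "integrable P (\<lambda>g. (wt z g)\<^sup>2)" for z
  proof (rule Bochner_Integration.integrable_bound)
    show "integrable P (\<lambda>g. 2 * exp (wt z g))" using m by simp
    show "(\<lambda>g. (wt z g)\<^sup>2) \<in> borel_measurable P" using mw[of z] by measurable
    show "AE g in P. norm ((wt z g)\<^sup>2) \<le> norm (2 * exp (wt z g))"
    proof (rule AE_I2)
      fix g assume "g \<in> space P"
      then have "wt z g \<ge> 0" using wt_ge_1[of g z] by (simp add: space_P)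
      then show "norm ((wt z g)\<^sup>2) \<le> norm (2 * exp (wt z g))"
        using exp_lower_Taylor_quadratic[of "wt z g"] by simp
    qed
  qed
  have "integrable P (\<lambda>g. real (card S) * (\<Sum>s\<in>S. (wt s g)\<^sup>2))"
    by (intro integrable_mult_right Bochner_Integration.integrable_sum sq)
  then show ?thesis
  proof (rule Bochner_Integration.integrable_bound)
    show "(\<lambda>g. (\<Sum>s\<in>S. wt s g)\<^sup>2) \<in> borel_measurable P" using mw by measurable
    show "AE g in P. norm ((\<Sum>s\<in>S. wt s g)\<^sup>2) \<le> norm (real (card S) * (\<Sum>s\<in>S. (wt s g)\<^sup>2))"
    proof (rule AE_I2)
      fix g
      have "(\<Sum>s\<in>S. 1 * wt s g)\<^sup>2 \<le> (\<Sum>s\<in>S. 1\<^sup>2) * (\<Sum>s\<in>S. (wt s g)\<^sup>2)"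
        by (rule Cauchy_Schwarz_ineq_sum)
      then show "norm ((\<Sum>s\<in>S. wt s g)\<^sup>2) \<le> norm (real (card S) * (\<Sum>s\<in>S. (wt s g)\<^sup>2))"
        by (simp add: sum_nonneg)
    qed
  qed
qed simp

text \<open>Only polynomially many pairs of cells meet the ball of radius \<open>n\<close>, while
  the path joining a pair is too heavy with probability exponentially small in
  \<open>\<delta> * n\<close>. It matters that \<open>a\<close> is the same for all
  \<open>\<delta>\<close>: shrinking \<open>\<delta>\<close> then makes \<open>a * \<delta>\<close>
  as small as desired.\<close>

lemma local_bound:
  obtains a where "a > 0" "\<And>\<delta>. \<delta> > 0 \<Longrightarrow> AE g in P. \<exists>N::nat. \<forall>n\<ge>N. \<forall>x y.
      norm x \<le> real n \<longrightarrow> norm y \<le> real n \<longrightarrow> norm (x - y) \<le> \<delta> * real n \<longrightarrow> rdist g x y \<le> a * \<delta> * real n"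
proof -
  obtain K :: nat where K: "K > 0"
    "\<And>(X :: int^'n \<Rightarrow> 'n metric_field \<Rightarrow> real) m S N s. finite S \<Longrightarrow> card S \<le> N \<Longrightarrow> m \<ge> 1 \<Longrightarrow>
      (\<And>z. z \<in> S \<Longrightarrow> X z \<in> borel_measurable (loc (cube z (1/2)))) \<Longrightarrow>
      (\<And>z. z \<in> S \<Longrightarrow> integrable P (\<lambda>g. exp (X z g))) \<Longrightarrow>
      (\<And>z. z \<in> S \<Longrightarrow> expectation (\<lambda>g. exp (X z g)) \<le> m) \<Longrightarrow>
      prob {g \<in> space P. (\<Sum>z\<in>S. X z g) \<ge> s} \<le> real K * m ^ N * exp (- s / real K)"
    by (rule chernoff_lattice[of "1/2"]) blast
  obtain m where m: "m \<ge> 1" "\<And>z. integrable P (\<lambda>g. exp (wt z g))" "\<And>z. expectation (\<lambda>g. exp (wt z g)) \<le> m"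
    using wt_moments by blast
  \<comment> \<open>With threshold \<open>b * (L + 1)\<close> the Chernoff factor
    \<open>exp (- s / K)\<close> cancels \<open>m ^ (L + 1)\<close> and leaves
    \<open>exp (- (L + 1))\<close>.\<close>
  define b where "b = real K * (ln m + 1)"
  have "b > 0" unfolding b_def using K m by (intro mult_pos_pos add_nonneg_pos) auto
  \<comment> \<open>6 is the 3 of \<open>kpath\<close> times a factor 2, since
    \<open>L n + 1 \<le> 2 * \<delta> * n\<close> as soon as
    \<open>n \<ge> 2 / \<delta>\<close>.\<close>
  define a where "a = 6 * real CARD('n) * b"
  have "a > 0" unfolding a_def using \<open>b > 0\<close> by simp
  moreover have "AE g in P. \<exists>N::nat. \<forall>n\<ge>N. \<forall>x y.
      norm x \<le> real n \<longrightarrow> norm y \<le> real n \<longrightarrow> norm (x - y) \<le> \<delta> * real n \<longrightarrow> rdist g x y \<le> a * \<delta> * real n"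
    if "\<delta> > 0" for \<delta>
  proof -
    \<comment> \<open>Bounds the \<open>kd\<close> distance of the cells of two points at distance
      at most \<open>\<delta> * n\<close>; each point contributes a rounding error of 1/2.\<close>
    define L where "L n = nat \<lfloor>\<delta> * real n + 1\<rfloor>" for n :: nat
    have L: "\<delta> * real n \<le> real (L n)" "real (L n) \<le> \<delta> * real n + 1" for n
    proof -
      have "0 \<le> \<lfloor>\<delta> * real n + 1\<rfloor>" using \<open>\<delta> > 0\<close> by simp
      then have "real (L n) = of_int \<lfloor>\<delta> * real n + 1\<rfloor>" unfolding L_def by simp
      then show "\<delta> * real n \<le> real (L n)" "real (L n) \<le> \<delta> * real n + 1" by linarith+
    qed
    define V where "V n = {z::int^'n. \<forall>i. z $ i \<in> {- int (Suc n)..int (Suc n)}}" for n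
    have finV: "finite (V n)" and cardV: "card (V n) \<le> (2 * n + 3) ^ CARD('n)" for n
    proof -
      have "nat (int (Suc n) + int (Suc n) + 1) = 2 * n + 3" by simp
      then have "card {- int (Suc n)..int (Suc n)} = 2 * n + 3" by (simp del: of_nat_Suc)
      moreover have "finite (V n)" "card (V n) \<le> card {- int (Suc n)..int (Suc n)} ^ CARD('n)"
        unfolding V_def by (rule finite_vecs[OF finite_atLeastAtMost_int])+
      ultimately show "finite (V n)" "card (V n) \<le> (2 * n + 3) ^ CARD('n)"
        by simp_all
    qed
    define Pr where "Pr n = {p \<in> V n \<times> V n. kd (fst p) (snd p) \<le> L n}" for n
    have finPr: "finite (Pr n)" for n unfolding Pr_def using finV by auto
    have cardPr: "real (card (Pr n)) \<le> (2 * real n + 3) ^ (2 * CARD('n))" for n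
    proof -
      have "card (Pr n) \<le> card (V n \<times> V n)" unfolding Pr_def using finV by (intro card_mono) auto
      also have "\<dots> \<le> (2 * n + 3) ^ CARD('n) * (2 * n + 3) ^ CARD('n)"
        unfolding card_cartesian_product using cardV by (intro mult_mono) auto
      finally have "real (card (Pr n)) \<le> real ((2 * n + 3) ^ CARD('n) * (2 * n + 3) ^ CARD('n))"
        by (rule of_nat_mono)
      moreover have "(2 * real n + 3) ^ (2 * CARD('n)) = (2 * real n + 3) ^ CARD('n) * (2 * real n + 3) ^ CARD('n)"
        by (metis mult_2 power_add)
      moreover have "real ((2 * n + 3) ^ CARD('n) * (2 * n + 3) ^ CARD('n))
          = (2 * real n + 3) ^ CARD('n) * (2 * real n + 3) ^ CARD('n)" by simp
      ultimately show ?thesis by simp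
    qed
    define s where "s n = b * (real (L n) + 1)" for n
    define A where "A n = (\<Union>p\<in>Pr n. {g \<in> space P. (\<Sum>z\<in>kpath (fst p) (snd p). wt z g) \<ge> s n})" for n
    have mw: "wt z \<in> borel_measurable P" for z using loc_measurable[OF wt_loc] .
    have E: "{g \<in> space P. (\<Sum>z\<in>kpath (fst p) (snd p). wt z g) \<ge> s n} \<in> sets P" for p n
      using mw by measurable
    then have A: "A n \<in> sets P" for n unfolding A_def using finPr by (intro sets.finite_UN) auto
    \<comment> \<open>Half of the decay rate is given up to pay for the number of pairs.\<close>
    obtain C where C: "\<And>n::nat. (2 * real n + 3) ^ (2 * CARD('n)) \<le> C * exp ((\<delta>/2) * real n)"
      using power_le_exp[of "\<delta>/2"] \<open>\<delta> > 0\<close> by (metis half_gt_zero)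
    have PA: "prob (A n) \<le> real K * C * (exp (- \<delta> / 2)) ^ n" for n
    proof -
      have "prob (A n) \<le> (\<Sum>p\<in>Pr n. prob {g \<in> space P. (\<Sum>z\<in>kpath (fst p) (snd p). wt z g) \<ge> s n})"
        unfolding A_def using finPr E by (intro finite_measure_subadditive_finite) auto
      also have "\<dots> \<le> (\<Sum>p\<in>Pr n. real K * exp (- \<delta> * real n))"
      proof (rule sum_mono)
        fix p assume p: "p \<in> Pr n"
        have "prob {g \<in> space P. (\<Sum>z\<in>kpath (fst p) (snd p). wt z g) \<ge> s n}
            \<le> real K * m ^ (Suc (L n)) * exp (- s n / real K)"
          using p by (intro K(2) kpath m wt_loc order_trans[OF kpath(2)]) (auto simp: Pr_def)
        also have "m ^ (Suc (L n)) = exp (ln m * real (Suc (L n)))"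
          using m(1) exp_of_nat_mult[of "Suc (L n)" "ln m"] by (simp only: mult.commute[of "ln m"]) simp
        also have "- s n / real K = - (ln m + 1) * (real (Suc (L n)))"
          unfolding s_def b_def using K(1) by (simp add: field_simps)
        also have "real K * exp (ln m * real (Suc (L n))) * exp (- (ln m + 1) * real (Suc (L n))) = real K * exp (- real (Suc (L n)))"
          by (simp add: exp_add[symmetric] algebra_simps)
        also have "\<dots> \<le> real K * exp (- \<delta> * real n)" using L[of n] by (intro mult_left_mono) auto
        finally show "prob {g \<in> space P. (\<Sum>z\<in>kpath (fst p) (snd p). wt z g) \<ge> s n} \<le> real K * exp (- \<delta> * real n)" .
      qed
      also have "\<dots> = real (card (Pr n)) * (real K * exp (- \<delta> * real n))" by simp
      also have "\<dots> \<le> (C * exp ((\<delta>/2) * real n)) * (real K * exp (- \<delta> * real n))"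
        using order_trans[OF cardPr C] by (intro mult_right_mono) auto
      also have "\<dots> = real K * C * (exp ((\<delta>/2) * real n) * exp (- \<delta> * real n))" by (simp add: algebra_simps)
      also have "exp ((\<delta>/2) * real n) * exp (- \<delta> * real n) = exp (real n * (- \<delta> / 2))"
        by (simp add: exp_add[symmetric] algebra_simps)
      also have "\<dots> = exp (- \<delta> / 2) ^ n" by (rule exp_of_nat_mult)
      finally show ?thesis .
    qed
    have "summable (\<lambda>n. real K * C * (exp (- \<delta> / 2)) ^ n)"
      using \<open>\<delta> > 0\<close> by (intro summable_mult summable_geometric) auto
    then have "summable (\<lambda>n. prob (A n))"
      by (rule summable_comparison_test'[where N = 0]) (use PA in auto)
    then have "AE g in P. eventually (\<lambda>n. g \<in> space P - A n) sequentially"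
      by (intro borel_cantelli_AE1 A) (auto simp: emeasure_eq_measure)
    then show ?thesis
    proof eventually_elim
      case (elim g)
      then obtain N1 where N1: "\<And>n. n \<ge> N1 \<Longrightarrow> g \<in> space P - A n" unfolding eventually_sequentially by blast
      obtain N2 :: nat where N2: "2 / \<delta> \<le> real N2" using real_arch_simple by blast
      show ?case
      proof (intro exI[of _ "max N1 N2"] allI impI)
        fix n and x y :: "real^'n" assume n: "max N1 N2 \<le> n" and xy: "norm x \<le> real n" "norm y \<le> real n" "norm (x - y) \<le> \<delta> * real n"
        have g: "g \<in> Metrics" using N1[of n] n by (simp add: space_P)
        have V: "near x \<in> V n" if "norm x \<le> real n" for x :: "real^'n"
        proof -
          have "\<bar>near x $ i\<bar> \<le> int (Suc n)" for i
          proof -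
            have "\<bar>real_of_int (near x $ i)\<bar> \<le> norm x + 1"
              using near_diff[of x i 0] by (simp add: near_def)
            then have "\<bar>real_of_int (near x $ i)\<bar> \<le> real (Suc n)" using that by simp
            then show ?thesis by linarith
          qed
          then show ?thesis unfolding V_def mem_Collect_eq atLeastAtMost_iff
            by (metis abs_le_iff minus_le_iff)
        qed
        have "kd (near x) (near y) \<le> nat \<lfloor>norm (x - y) + 1\<rfloor>" by (rule kd_near)
        also have "\<dots> \<le> L n" unfolding L_def using xy by (intro nat_mono floor_mono) simp
        finally have p: "(near x, near y) \<in> Pr n" unfolding Pr_def using V xy by auto
        then have "(\<Sum>z\<in>kpath (near x) (near y). wt z g) < s n"
          using N1[of n] n unfolding A_def by force
        then have "3 * real CARD('n) * (\<Sum>z\<in>kpath (near x) (near y). wt z g) \<le> 3 * real CARD('n) * s n"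
          by (intro mult_left_mono) auto
        moreover have "s n \<le> b * (2 * (\<delta> * real n))"
        proof -
          have "2 / \<delta> \<le> real n" using N2 n by linarith
          then have "2 \<le> \<delta> * real n" using \<open>\<delta> > 0\<close> by (simp add: pos_divide_le_eq mult.commute)
          then have "real (L n) + 1 \<le> 2 * (\<delta> * real n)" using L(2)[of n] by linarith
          then show ?thesis unfolding s_def using \<open>b > 0\<close> by (intro mult_left_mono) auto
        qed
        then have "3 * real CARD('n) * s n \<le> 3 * real CARD('n) * (b * (2 * (\<delta> * real n)))"
          by (intro mult_left_mono) auto
        ultimately have "rdist g x y \<le> 3 * real CARD('n) * (b * (2 * (\<delta> * real n)))"
          using kpath(3)[OF g near_cube near_cube, of x y] by linarith
        also have "\<dots> = a * \<delta> * real n" unfolding a_def by simp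
        finally show "rdist g x y \<le> a * \<delta> * real n" .
      qed
    qed
  qed
  ultimately show ?thesis using that by blast
qed

end

section \<open>Linear growth of the distance\<close>

lemma dense_cube_closed:
  fixes z :: "int^'n::finite"
  assumes "closed F" "r > 0" "\<And>x v. x \<in> dense_pts \<Longrightarrow> x \<in> icube z r \<Longrightarrow> v \<in> dense_pts \<Longrightarrow> (x, v :: real^'n) \<in> F"
    and x: "x \<in> cube z r"
  shows "(x, v) \<in> F"
proof -
  have "(dense_pts \<inter> icube z r) \<times> dense_pts \<subseteq> F" using assms(3) by auto
  then have "closure ((dense_pts \<inter> icube z r) \<times> dense_pts) \<subseteq> F" using assms(1) by (intro closure_minimal)
  moreover have "closure (icube z r) \<subseteq> closure (dense_pts \<inter> icube z r)"
    using closure_dense_pts[OF open_icube] by (intro closure_minimal) auto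
  then have "x \<in> closure (dense_pts \<inter> icube z r)" using x cube_subset_closure_icube[OF assms(2), of z] by auto
  moreover have "v \<in> closure dense_pts" using closure_dense_pts[of UNIV] by auto
  ultimately show ?thesis unfolding closure_Times by auto
qed

text \<open>Testing countably many points and vectors makes the event measurable; as the inequality
  is strict and its sides are continuous, it is the same as testing the whole cube. The radius 2
  leaves room for a cell within 5/4 of a point \<open>p\<close> to control a segment of length 1/4
  that starts at \<open>p\<close>.\<close>

definition bad :: "real \<Rightarrow> int^'n \<Rightarrow> 'n::finite metric_field \<Rightarrow> bool" where
  "bad \<delta> z g \<longleftrightarrow> (\<exists>x\<in>dense_pts \<inter> icube z 2. \<exists>v\<in>dense_pts. v \<bullet> (g x *v v) < \<delta> * (norm v)\<^sup>2)"

lemma bad_iff: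
  fixes g :: "'n::finite metric_field"
  assumes g: "g \<in> Metrics"
  shows "bad \<delta> z g \<longleftrightarrow> (\<exists>x\<in>cube z 2. \<exists>v. v \<bullet> (g x *v v) < \<delta> * (norm v)\<^sup>2)"
proof
  show "bad \<delta> z g \<Longrightarrow> \<exists>x\<in>cube z 2. \<exists>v. v \<bullet> (g x *v v) < \<delta> * (norm v)\<^sup>2"
    unfolding bad_def using icube_subset_cube[of z 2] by blast
  assume *: "\<exists>x\<in>cube z 2. \<exists>v. v \<bullet> (g x *v v) < \<delta> * (norm v)\<^sup>2"
  show "bad \<delta> z g"
  proof (rule ccontr)
    assume nb: "\<not> bad \<delta> z g"
    let ?F = "\<lambda>p :: (real^'n) \<times> (real^'n). snd p \<bullet> (g (fst p) *v snd p) - \<delta> * (norm (snd p))\<^sup>2"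
    have cont: "continuous_on UNIV ?F"
      by (intro continuous_on_diff continuous_on_quadratic_form continuous_on_compose2[OF Metrics_continuous[OF g, of UNIV]] continuous_intros) auto
    have cl: "closed (?F -` {0..})"
      using continuous_on_closed_vimage[of UNIV ?F] cont by auto
    have "(x, v) \<in> ?F -` {0..}" if "x \<in> cube z 2" for x v
      by (rule dense_cube_closed[OF cl _ _ that]) (use nb in \<open>auto simp: bad_def not_less\<close>)
    then show False using * by (auto simp: not_less[symmetric])
  qed
qed

lemma not_badD:
  "g \<in> Metrics \<Longrightarrow> \<not> bad \<delta> z g \<Longrightarrow> x \<in> cube z 2 \<Longrightarrow> v \<bullet> (g x *v v) \<ge> \<delta> * (norm v)\<^sup>2"
  using bad_iff not_less by blast

lemma bad_loc: "{g \<in> Metrics. bad \<delta> z g} \<in> sets (loc (cube z 2))"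
proof -
  have *: "{g \<in> space (loc (cube z 2)). v \<bullet> (g x *v v) < \<delta> * (norm v)\<^sup>2} \<in> sets (loc (cube z 2))"
    if "x \<in> icube z 2" for x v :: "real^'a"
  proof -
    have "x \<in> cube z 2" using that icube_subset_cube by blast
    then have "(\<lambda>g. v \<bullet> (g x *v v)) \<in> borel_measurable (loc (cube z 2))" by (rule quadratic_form_loc)
    then show ?thesis by (intro borel_measurable_less borel_measurable_const)
  qed
  have "{g \<in> space (loc (cube z 2)). \<exists>x\<in>dense_pts \<inter> icube z 2. \<exists>v\<in>dense_pts. v \<bullet> (g x *v v) < \<delta> * (norm v)\<^sup>2}
      \<in> sets (loc (cube z 2))"
    using * by (intro sets.sets_Collect_countable_Ex' countable_Int1 dense_pts(1)) auto
  then show ?thesis unfolding bad_def by simp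
qed

lemma bad_transl:
  assumes g: "g \<in> Metrics"
  shows "bad \<delta> z g \<longleftrightarrow> bad \<delta> 0 (transl (emb z) g)"
proof -
  have e: "x - emb z \<in> cube 0 2 \<longleftrightarrow> x \<in> cube z 2" for x
    unfolding cube_def emb_def by simp
  show ?thesis
    unfolding bad_iff[OF g] bad_iff[OF transl_Metrics[OF g]]
  proof
    assume "\<exists>x\<in>cube z 2. \<exists>v. v \<bullet> (g x *v v) < \<delta> * (norm v)\<^sup>2"
    then obtain x v where "x \<in> cube z 2" "v \<bullet> (g x *v v) < \<delta> * (norm v)\<^sup>2" by blast
    then show "\<exists>x\<in>cube 0 2. \<exists>v. v \<bullet> (transl (emb z) g x *v v) < \<delta> * (norm v)\<^sup>2"
      using e[of x] by (intro bexI[of _ "x - emb z"] exI[of _ v]) (auto simp: transl_def)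
  next
    assume "\<exists>x\<in>cube 0 2. \<exists>v. v \<bullet> (transl (emb z) g x *v v) < \<delta> * (norm v)\<^sup>2"
    then obtain x v where "x \<in> cube 0 2" "v \<bullet> (g (x + emb z) *v v) < \<delta> * (norm v)\<^sup>2"
      unfolding transl_def by blast
    then show "\<exists>x\<in>cube z 2. \<exists>v. v \<bullet> (g x *v v) < \<delta> * (norm v)\<^sup>2"
      using e[of "x + emb z"] by (intro bexI[of _ "x + emb z"] exI[of _ v]) auto
  qed
qed

text \<open>Positive definiteness and compactness: over the cube and the unit sphere the quadratic
  form attains a minimum, which is positive.\<close>

lemma eventually_not_bad:
  fixes g :: "'n::finite metric_field"
  assumes g: "g \<in> Metrics"
  shows "\<exists>k::nat. \<not> bad (1 / real (Suc k)) z g"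
proof -
  have "\<exists>p\<in>cube z 2 \<times> sphere 0 1. \<forall>q\<in>cube z 2 \<times> sphere 0 1.
      snd p \<bullet> (g (fst p) *v snd p) \<le> snd q \<bullet> (g (fst q) *v snd q)"
  proof (rule continuous_attains_inf)
    show "compact (cube z 2 \<times> sphere (0::real^'n) 1)" by (intro compact_Times compact_cube compact_sphere)
    have "emb z \<in> cube z 2" unfolding emb_def cube_def by simp
    moreover have "axis undefined 1 \<in> sphere (0::real^'n) 1" by (simp add: norm_axis_1)
    ultimately show "cube z 2 \<times> sphere (0::real^'n) 1 \<noteq> {}" by blast
    show "continuous_on (cube z 2 \<times> sphere 0 1) (\<lambda>p. snd p \<bullet> (g (fst p) *v snd p))"
      by (intro continuous_on_quadratic_form continuous_on_compose2[OF Metrics_continuous[OF g, of UNIV]] continuous_intros) auto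
  qed
  then obtain x0 v0 where 0: "x0 \<in> cube z 2" "norm v0 = 1"
    "\<And>x v. x \<in> cube z 2 \<Longrightarrow> norm v = 1 \<Longrightarrow> v0 \<bullet> (g x0 *v v0) \<le> v \<bullet> (g x *v v)" by fastforce
  have "v0 \<bullet> (g x0 *v v0) > 0" using 0 by (intro Metrics_pos g) auto
  then obtain k where k: "1 / real (Suc k) < v0 \<bullet> (g x0 *v v0)" using nat_approx_posE by blast
  have "v \<bullet> (g x *v v) \<ge> 1 / real (Suc k) * (norm v)\<^sup>2" if x: "x \<in> cube z 2" for x v
  proof (cases "v = 0")
    case False
    have "1 / real (Suc k) \<le> (v /\<^sub>R norm v) \<bullet> (g x *v (v /\<^sub>R norm v))"
      using 0(3)[OF x, of "v /\<^sub>R norm v"] k False by simp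
    also have "\<dots> = (v \<bullet> (g x *v v)) / (norm v)\<^sup>2"
      by (simp add: matrix_vector_mult_scaleR power2_eq_square divide_inverse)
    finally show ?thesis using False by (simp add: pos_le_divide_eq)
  qed simp
  then show ?thesis unfolding bad_iff[OF g] by (metis not_less)
qed

section \<open>Lattice walks and loop erasure\<close>

fun walks :: "nat \<Rightarrow> int^'n \<Rightarrow> (int^'n::finite) list set" where
  "walks 0 a = {[a]}"
| "walks (Suc n) a = (\<Union>b\<in>{b. kd a b \<le> 1}. (#) a ` walks n b)"

lemma walks_basic: "xs \<in> walks n a \<Longrightarrow> length xs = Suc n \<and> hd xs = a \<and> xs \<noteq> []"
  by (induction n arbitrary: a xs) auto

text \<open>A site counts as its own neighbour, so standing still is a legal step. The bound on the
  choices per step gives the entropy against which the Peierls estimate has to win.\<close>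

lemma neighbours_finite: "finite {b::int^'n::finite. kd a b \<le> 1}" "card {b::int^'n::finite. kd a b \<le> 1} \<le> 3 ^ CARD('n)"
proof -
  let ?V = "{v::int^'n. \<forall>i. v $ i \<in> {-1..1}}"
  have V: "finite ?V" "card ?V \<le> card {-1..1::int} ^ CARD('n)" by (rule finite_vecs[OF finite_atLeastAtMost_int])+
  have sub: "{b. kd a b \<le> 1} \<subseteq> (\<lambda>v. a + v) ` ?V"
  proof
    fix b assume "b \<in> {b. kd a b \<le> 1}"
    then have "\<bar>a $ i - b $ i\<bar> \<le> 1" for i unfolding mem_Collect_eq kd_le_iff by (metis of_nat_1)
    then have "b - a \<in> ?V" by (auto simp: abs_le_iff algebra_simps)
    then show "b \<in> (\<lambda>v. a + v) ` ?V" by (intro image_eqI[of _ _ "b - a"]) auto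
  qed
  show "finite {b::int^'n. kd a b \<le> 1}" using finite_subset[OF sub] V by auto
  have "card {b. kd a b \<le> 1} \<le> card ?V"
    using surj_card_le[OF V(1) sub] .
  then show "card {b::int^'n. kd a b \<le> 1} \<le> 3 ^ CARD('n)" using V(2) by simp
qed

lemma walks_finite: "finite (walks n (a::int^'n::finite))" "card (walks n (a::int^'n::finite)) \<le> (3 ^ CARD('n)) ^ n"
proof -
  show fin: "finite (walks n a)" for n and a :: "int^'n"
  proof (induction n arbitrary: a)
    case (Suc n)
    show ?case unfolding walks.simps by (intro finite_UN_I neighbours_finite(1) finite_imageI Suc)
  qed simp
  show "card (walks n a) \<le> (3 ^ CARD('n)) ^ n"
  proof (induction n arbitrary: a)
    case (Suc n)
    have "card (walks (Suc n) a) \<le> (\<Sum>b\<in>{b. kd a b \<le> 1}. card ((#) a ` walks n b))"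
      unfolding walks.simps by (rule card_UN_le[OF neighbours_finite(1)])
    also have "\<dots> \<le> (\<Sum>b\<in>{b. kd a b \<le> 1}. (3 ^ CARD('n)) ^ n)"
      using Suc fin by (intro sum_mono order_trans[OF card_image_le]) auto
    also have "\<dots> \<le> 3 ^ CARD('n) * (3 ^ CARD('n)) ^ n"
      using neighbours_finite(2)[of a] by simp
    finally show ?case by simp
  qed simp
qed

lemma walks_append: "xs \<in> walks n a \<Longrightarrow> kd (last xs) b \<le> 1 \<Longrightarrow> xs @ [b] \<in> walks (Suc n) a"
proof (induction n arbitrary: a xs)
  case 0
  then show ?case by auto
next
  case (Suc n)
  then obtain c ys where c: "kd a c \<le> 1" "xs = a # ys" "ys \<in> walks n c" by auto
  then have "ys \<noteq> []" using walks_basic by blast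
  then have "ys @ [b] \<in> walks (Suc n) c" using Suc c by auto
  then show ?case unfolding walks.simps(2)[of "Suc n"] using c by auto
qed

lemma walks_suffix: "us @ a # vs \<in> walks n c \<Longrightarrow> \<exists>m. a # vs \<in> walks m a"
proof (induction us arbitrary: n c)
  case Nil
  then show ?case using walks_basic[OF Nil[simplified]] by auto
next
  case (Cons u us)
  then show ?case by (cases n) auto
qed

text \<open>Loop erasure: if the new starting site occurs in the erased remainder of the walk,
  everything before that occurrence is dropped.\<close>

lemma walks_distinct:
  "xs \<in> walks n a \<Longrightarrow> \<exists>m ys. ys \<in> walks m a \<and> distinct ys \<and> last ys = last xs \<and> set ys \<subseteq> set xs"
proof (induction n arbitrary: a xs)
  case 0
  then show ?case by (intro exI[of _ 0] exI[of _ xs]) auto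
next
  case (Suc n)
  then obtain b xs' where b: "kd a b \<le> 1" "xs = a # xs'" "xs' \<in> walks n b" by auto
  from Suc.IH[OF b(3)] obtain m ys where ys: "ys \<in> walks m b" "distinct ys" "last ys = last xs'" "set ys \<subseteq> set xs'" by blast
  have ne: "xs' \<noteq> []" "ys \<noteq> []" using walks_basic b ys by blast+
  show ?case
  proof (cases "a \<in> set ys")
    case True
    then obtain us vs where uv: "ys = us @ a # vs" by (meson split_list)
    then obtain m' where "a # vs \<in> walks m' a" using walks_suffix ys(1) by blast
    then show ?thesis using uv ys ne b by (intro exI[of _ m'] exI[of _ "a # vs"]) auto
  next
    case False
    have "a # ys \<in> walks (Suc m) a" using b(1) ys(1) by auto
    then show ?thesis using False ys ne b by (intro exI[of _ "Suc m"] exI[of _ "a # ys"]) auto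
  qed
qed

lemma kd_triangle: "kd a c \<le> kd a b + kd b (c :: int^'n::finite)"
  unfolding kd_le_iff
proof
  fix i
  have "\<bar>a $ i - b $ i\<bar> \<le> int (kd a b)" "\<bar>b $ i - c $ i\<bar> \<le> int (kd b c)"
    using kd_le_iff[of a b "kd a b"] kd_le_iff[of b c "kd b c"] by auto
  then show "\<bar>a $ i - c $ i\<bar> \<le> int (kd a b + kd b c)" by simp
qed

lemma kd_attained: "\<exists>i. int (kd z w) = \<bar>z $ i - w $ (i::'n::finite)\<bar>"
proof -
  have "kd z w \<in> range (\<lambda>i. nat \<bar>z $ i - w $ i\<bar>)" unfolding kd_def by (rule Max_in) auto
  then show ?thesis by auto
qed

lemma kd_self [simp]: "kd z z = 0" using kd_le_iff[of z z 0] by simp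

lemma walks_length: "xs \<in> walks n a \<Longrightarrow> kd a (last xs) \<le> n"
proof (induction n arbitrary: a xs)
  case (Suc n)
  then obtain b xs' where b: "kd a b \<le> 1" "xs = a # xs'" "xs' \<in> walks n b" by auto
  then have "xs' \<noteq> []" using walks_basic by blast
  then show ?case using Suc.IH[OF b(3)] kd_triangle[of a "last xs" b] b by auto
qed auto

lemma walk_exists: "kd z w \<le> m \<Longrightarrow> \<exists>n xs. xs \<in> walks n z \<and> last xs = w"
proof (induction m arbitrary: z)
  case 0
  then have "\<forall>i. z $ i = w $ i" unfolding kd_le_iff by simp
  then have "z = w" by (simp add: vec_eq_iff)
  then show ?case by (intro exI[of _ 0] exI[of _ "[w]"]) auto
next
  case (Suc m)
  from Suc.IH[OF kd_king_step[OF Suc.prems]] obtain n xs where xs: "xs \<in> walks n (king_step w z)" "last xs = w" by blast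
  then have "xs \<noteq> []" using walks_basic by blast
  then show ?case using xs king_step_kd[of z w]
    by (intro exI[of _ "Suc n"] exI[of _ "z # xs"]) auto
qed

section \<open>Lattice passage times and a potential below the distance\<close>

definition gcount :: "(int^'n \<Rightarrow> bool) \<Rightarrow> (int^'n::finite) list \<Rightarrow> nat" where
  "gcount G xs = card {s \<in> set xs. G s}"

text \<open>First-passage percolation in which a site with \<open>G\<close> costs 1 and any other
  site is free. A site is charged once however often it is visited, so erasing loops never raises
  the cost.\<close>

definition ptime :: "(int^'n \<Rightarrow> bool) \<Rightarrow> int^'n::finite \<Rightarrow> nat" where
  "ptime G z = (LEAST m. \<exists>n xs. xs \<in> walks n 0 \<and> last xs = z \<and> gcount G xs = m)"

lemma ptime_attained: "\<exists>n xs. xs \<in> walks n 0 \<and> last xs = z \<and> gcount G xs = ptime G z"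
  unfolding ptime_def by (rule LeastI_ex) (use walk_exists[OF order_refl, of 0 z] in blast)

lemma ptime_le: "xs \<in> walks n 0 \<Longrightarrow> last xs = z \<Longrightarrow> ptime G z \<le> gcount G xs"
  unfolding ptime_def by (rule Least_le) blast

lemma ptime_step:
  assumes "kd z z' \<le> 1"
  shows "ptime G z' \<le> ptime G z + (if G z' then 1 else 0)"
proof -
  obtain n xs where xs: "xs \<in> walks n 0" "last xs = z" "gcount G xs = ptime G z" using ptime_attained by blast
  have "ptime G z' \<le> gcount G (xs @ [z'])"
    using xs assms by (intro ptime_le[OF walks_append[OF xs(1)]]) auto
  also have "\<dots> \<le> card ({s \<in> set xs. G s} \<union> (if G z' then {z'} else {}))"
    unfolding gcount_def by (intro card_mono) auto
  also have "\<dots> \<le> ptime G z + (if G z' then 1 else 0)"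
    using card_Un_le[of "{s \<in> set xs. G s}" "if G z' then {z'} else {}"] xs(3)
    unfolding gcount_def by (auto split: if_splits)
  finally show ?thesis .
qed

lemma kd_commute: "kd z w = kd w z"
  unfolding kd_def by (simp add: abs_minus_commute)

lemma ptime_kd: "kd z w \<le> m \<Longrightarrow> ptime G w \<le> ptime G z + m"
proof (induction m arbitrary: z)
  case 0
  then have "\<forall>i. z $ i = w $ i" unfolding kd_le_iff by simp
  then have "z = w" by (simp add: vec_eq_iff)
  then show ?case by simp
next
  case (Suc m)
  have "ptime G w \<le> ptime G (king_step w z) + m" by (rule Suc.IH[OF kd_king_step[OF Suc.prems]])
  also have "ptime G (king_step w z) \<le> ptime G z + 1"
    using ptime_step[OF king_step_kd[of z w], of G] by (auto split: if_splits)
  finally show ?case by simp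
qed

lemma ptime_0: "ptime G 0 \<le> 1"
proof -
  have "ptime G 0 \<le> gcount G [0]" by (rule ptime_le[of _ 0]) auto
  also have "\<dots> \<le> card {0::int^'a}" unfolding gcount_def by (intro card_mono) auto
  finally show ?thesis by simp
qed

definition dinf :: "real^'n \<Rightarrow> int^'n::finite \<Rightarrow> real" where
  "dinf p z = infnorm (p - emb z)"

lemma infnorm_le_iff: "infnorm (x :: real^'n::finite) \<le> r \<longleftrightarrow> (\<forall>i. \<bar>x $ i\<bar> \<le> r)"
proof
  assume "infnorm x \<le> r"
  then show "\<forall>i. \<bar>x $ i\<bar> \<le> r" using component_le_infnorm_cart order_trans by blast
next
  assume "\<forall>i. \<bar>x $ i\<bar> \<le> r"
  then show "infnorm x \<le> r" unfolding infnorm_cart by (intro cSup_least) auto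
qed

lemma dinf_le_iff: "dinf p z \<le> r \<longleftrightarrow> p \<in> cube z r"
  unfolding dinf_def infnorm_le_iff cube_def emb_def by simp

lemma dinf_le: "dinf p z \<le> dinf q z + norm (p - q)"
proof -
  have "infnorm ((p - q) + (q - emb z)) \<le> infnorm (p - q) + infnorm (q - emb z)" by (rule infnorm_triangle)
  then show ?thesis using infnorm_le_norm[of "p - q"] unfolding dinf_def by simp
qed

lemma kd_le_dinf: "real (kd z w) \<le> dinf p z + dinf p w"
proof -
  obtain i where "int (kd z w) = \<bar>z $ i - w $ i\<bar>" using kd_attained by blast
  then have "real (kd z w) = \<bar>real_of_int (z $ i) - real_of_int (w $ i)\<bar>"
    by (metis of_int_abs of_int_diff of_int_of_nat_eq)
  moreover have "\<bar>(p - emb z) $ i\<bar> \<le> dinf p z" "\<bar>(p - emb w) $ i\<bar> \<le> dinf p w"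
    unfolding dinf_def by (rule component_le_infnorm_cart)+
  ultimately show ?thesis unfolding emb_def by simp
qed

text \<open>Every coordinate of a king step lies between those of \<open>z\<close> and
  \<open>w\<close>, so the steps stay in the cube around \<open>p\<close>. All sites there are free,
  and a step between free sites changes the passage time in neither direction.\<close>

lemma ptime_constant:
  assumes "\<And>z. dinf p z \<le> r \<Longrightarrow> \<not> G z"
  shows "kd z w \<le> m \<Longrightarrow> dinf p z \<le> r \<Longrightarrow> dinf p w \<le> r \<Longrightarrow> ptime G z = ptime G w"
proof (induction m arbitrary: z)
  case 0
  then have "\<forall>i. z $ i = w $ i" unfolding kd_le_iff by simp
  then have "z = w" by (simp add: vec_eq_iff)
  then show ?case by simp
next
  case (Suc m)
  let ?z = "king_step w z"
  have d: "dinf p ?z \<le> r"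
    unfolding dinf_le_iff cube_def
  proof (intro CollectI allI)
    fix i
    have zi: "\<bar>p $ i - of_int (z $ i)\<bar> \<le> r" and wi: "\<bar>p $ i - of_int (w $ i)\<bar> \<le> r"
      using Suc.prems unfolding dinf_le_iff cube_def by auto
    consider "?z $ i = z $ i" | "?z $ i = z $ i + 1" "z $ i + 1 \<le> w $ i" | "?z $ i = z $ i - 1" "w $ i \<le> z $ i - 1"
    proof -
      have "?z $ i = z $ i + sgn (w $ i - z $ i)" unfolding king_step_def by simp
      then show ?thesis using that by (cases "w $ i" "z $ i" rule: linorder_cases) (auto simp: sgn_if)
    qed
    then show "\<bar>p $ i - of_int (?z $ i)\<bar> \<le> r"
    proof cases
      case 2
      then have "real_of_int (z $ i) + 1 \<le> of_int (w $ i)" by linarith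
      then show ?thesis using 2(1) zi wi by auto
    next
      case 3
      then have "real_of_int (w $ i) \<le> of_int (z $ i) - 1" by linarith
      then show ?thesis using 3(1) zi wi by auto
    qed (use zi in simp)
  qed
  have k: "kd z ?z \<le> 1" by (rule king_step_kd)
  have "ptime G z = ptime G ?z"
    using ptime_step[OF k, of G] ptime_step[OF k[unfolded kd_commute[of z]], of G] assms[OF d] assms[OF Suc.prems(2)]
    by simp
  then show ?case using Suc.IH[OF kd_king_step[OF Suc.prems(1)] d Suc.prems(3)] by simp
qed

text \<open>The lattice passage time, smoothed into a Lipschitz function that is constant wherever all
  cells nearby are bad; so it grows along a curve only where the metric is bounded below.\<close>

definition pot :: "(int^'n \<Rightarrow> bool) \<Rightarrow> real^'n::finite \<Rightarrow> real" where
  "pot G p = (INF z. real (ptime G z) + 3 * max 0 (dinf p z - 1/2))"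

lemma pot_le: "pot G p \<le> real (ptime G z) + 3 * max 0 (dinf p z - 1/2)"
  unfolding pot_def by (intro cINF_lower bdd_belowI2[of _ 0]) auto

lemma pot_ge: "(\<And>z. c \<le> real (ptime G z) + 3 * max 0 (dinf p z - 1/2)) \<Longrightarrow> c \<le> pot G p"
  unfolding pot_def by (intro cINF_greatest) auto

lemma pot_lipschitz: "pot G p \<le> pot G q + 3 * norm (p - q)"
proof -
  have "pot G p - 3 * norm (p - q) \<le> pot G q"
  proof (rule pot_ge)
    fix z
    show "pot G p - 3 * norm (p - q) \<le> real (ptime G z) + 3 * max 0 (dinf q z - 1/2)"
    proof -
      have "max 0 (dinf p z - 1/2) \<le> max 0 (dinf q z - 1/2) + norm (p - q)"
        using dinf_le[of p z q] norm_ge_zero[of "p - q"] unfolding max_def by (smt (verit))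
      moreover have "a - 3 * n \<le> t + 3 * c" if "b \<le> c + n" "a \<le> t + 3 * b" for a b c n t :: real
        using that by simp
      ultimately show ?thesis using pot_le[of G p z] by blast
    qed
  qed
  then show ?thesis by simp
qed

lemma dinf_near: "dinf p (near p) \<le> 1/2"
  unfolding dinf_le_iff by (rule near_cube)

text \<open>This explains the slope 3 and the offset 1/2 in \<open>pot\<close>. A site within
  distance 1 of \<open>p\<close> has the same passage time as \<open>near p\<close>. A site at
  distance \<open>t > 1\<close> is at most \<open>t + 1/2\<close> king steps from
  \<open>near p\<close>, and its penalty \<open>3 * (t - 1/2)\<close> exceeds that number.\<close>

lemma pot_eq_ptime:
  assumes "\<And>z. dinf p z \<le> 1 \<Longrightarrow> \<not> G z"
  shows "pot G p = ptime G (near p)"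
proof (rule antisym)
  show "pot G p \<le> ptime G (near p)"
    using pot_le[of G p "near p"] dinf_near[of p] by simp
  show "ptime G (near p) \<le> pot G p"
  proof (rule pot_ge)
    fix z
    show "real (ptime G (near p)) \<le> real (ptime G z) + 3 * max 0 (dinf p z - 1/2)"
    proof (cases "dinf p z \<le> 1")
      case True
      then have "ptime G (near p) = ptime G z"
        using dinf_near[of p] by (intro ptime_constant[OF assms order_refl]) auto
      then show ?thesis by simp
    next
      case False
      have "real (ptime G (near p)) \<le> real (ptime G z) + real (kd z (near p))"
        using ptime_kd[OF order_refl, of G "near p" z] by linarith
      also have "real (kd z (near p)) \<le> dinf p z + 1/2"
        using kd_le_dinf[of z "near p" p] dinf_near[of p] by linarith
      finally show ?thesis using False by (simp add: max_def)
    qed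
  qed
qed

text \<open>Either some good cell lies within 5/4 of \<open>p\<close>: then the metric is at least
  \<open>\<delta>\<close> along the whole segment and the Lipschitz bound of \<open>pot\<close> is
  paid by the length. Or all those cells are bad: they include all cells within 1 of
  \<open>p\<close> or of \<open>q\<close>, and \<open>pot\<close> has the same value at both
  ends.\<close>

lemma pot_le_seg:
  fixes g :: "'n::finite metric_field"
  assumes g: "g \<in> Metrics" and "\<delta> > 0" and pq: "norm (q - p) < 1/4"
  shows "pot (\<lambda>z. \<not> bad \<delta> z g) q - pot (\<lambda>z. \<not> bad \<delta> z g) p \<le> 3 / sqrt \<delta> * seg g p q"
proof (cases "\<exists>z. dinf p z \<le> 5/4 \<and> \<not> bad \<delta> z g")
  case True
  then obtain z where z: "dinf p z \<le> 5/4" "\<not> bad \<delta> z g" by blast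
  have "seg g p q \<ge> norm (q - p) * sqrt \<delta>"
  proof (rule seg_ge[OF g])
    fix s :: real assume s: "0 \<le> s" "s \<le> 1"
    have "norm (s *\<^sub>R (q - p)) \<le> 1/4" using s pq mult_le_one[of s "norm (q - p)"]
      by (smt (verit) mult_left_le_one_le norm_ge_zero norm_scaleR)
    then have "dinf (p + s *\<^sub>R (q - p)) z \<le> 2" using dinf_le[of "p + s *\<^sub>R (q - p)" z p] z by simp
    then show "\<delta> * (norm (q - p))\<^sup>2 \<le> (q - p) \<bullet> (g (p + s *\<^sub>R (q - p)) *v (q - p))"
      unfolding dinf_le_iff by (rule not_badD[OF g z(2)])
  qed (use \<open>\<delta> > 0\<close> in simp)
  then have "norm (q - p) \<le> seg g p q / sqrt \<delta>" using \<open>\<delta> > 0\<close> by (simp add: pos_le_divide_eq)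
  moreover have "pot (\<lambda>z. \<not> bad \<delta> z g) q - pot (\<lambda>z. \<not> bad \<delta> z g) p \<le> 3 * norm (q - p)"
    using pot_lipschitz[of "\<lambda>z. \<not> bad \<delta> z g" q p] by simp
  ultimately show ?thesis by simp
next
  case False
  let ?G = "\<lambda>z. \<not> bad \<delta> z g"
  have b: "\<not> ?G z" if "dinf p z \<le> 5/4" for z using False that by blast
  have "pot ?G p = ptime ?G (near p)" by (rule pot_eq_ptime) (use b in force)
  moreover have "pot ?G q = ptime ?G (near q)"
  proof (rule pot_eq_ptime)
    fix z assume "dinf q z \<le> 1"
    then have "dinf p z \<le> 5/4" using dinf_le[of p z q] pq by (simp add: norm_minus_commute)
    then show "\<not> ?G z" by (rule b)
  qed
  moreover have "ptime ?G (near p) = ptime ?G (near q)"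
  proof (rule ptime_constant[OF b order_refl])
    show "dinf p (near p) \<le> 5/4" using dinf_near[of p] by simp
    show "dinf p (near q) \<le> 5/4" using dinf_le[of p "near q" q] dinf_near[of q] pq by (simp add: norm_minus_commute)
  qed
  ultimately show ?thesis using seg_nonneg[OF g, of p q] \<open>\<delta> > 0\<close> by simp
qed

text \<open>The increments of the potential telescope along a polygon whose edges are shorter than
  1/4.\<close>

lemma pot_le_rdist:
  fixes g :: "'n::finite metric_field"
  assumes g: "g \<in> Metrics" and "\<delta> > 0"
  shows "pot (\<lambda>z. \<not> bad \<delta> z g) x - pot (\<lambda>z. \<not> bad \<delta> z g) 0 \<le> 3 / sqrt \<delta> * rdist g 0 x"
proof -
  let ?u = "pot (\<lambda>z. \<not> bad \<delta> z g)"
  have "(?u x - ?u 0) * sqrt \<delta> / 3 \<le> rdist g 0 x"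
  proof (rule dense_ge)
    fix c assume "rdist g 0 x < c"
    then obtain f N where f: "f 0 = 0" "f N = x" "\<And>i. i < N \<Longrightarrow> norm (f (Suc i) - f i) < 1/4"
      "(\<Sum>i<N. seg g (f i) (f (Suc i))) < c"
      by (rule rdist_polygon[OF g, where r = "1/4"]) auto
    have "?u x - ?u 0 = (\<Sum>i<N. ?u (f (Suc i)) - ?u (f i))"
      using sum_lessThan_telescope[of "\<lambda>i. ?u (f i)" N] f by simp
    also have "\<dots> \<le> (\<Sum>i<N. 3 / sqrt \<delta> * seg g (f i) (f (Suc i)))"
      using f(3) by (intro sum_mono pot_le_seg assms) auto
    also have "\<dots> = 3 / sqrt \<delta> * (\<Sum>i<N. seg g (f i) (f (Suc i)))" by (simp add: sum_distrib_left)
    also have "\<dots> \<le> 3 / sqrt \<delta> * c" using f(4) \<open>\<delta> > 0\<close> by (intro mult_left_mono) auto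
    finally show "(?u x - ?u 0) * sqrt \<delta> / 3 \<le> c" using \<open>\<delta> > 0\<close> by (simp add: field_simps)
  qed
  then show ?thesis using \<open>\<delta> > 0\<close> by (simp add: field_simps)
qed

section \<open>Good cells along all long walks, and linear growth\<close>

context random_metric
begin

lemma bad_measurable: "{g \<in> space P. bad \<delta> z g} \<in> sets P"
  using measurable_sets[OF id_measurable_loc bad_loc[of \<delta> z]]
  by (simp add: space_P vimage_def Int_def conj_commute conj_left_commute cong: conj_cong)

lemma prob_bad_transl: "prob {g \<in> space P. bad \<delta> z g} = prob {g \<in> space P. bad \<delta> 0 g}"
proof -
  have "prob {g \<in> space P. bad \<delta> 0 g} = measure (distr P P (transl (emb z))) {g \<in> space P. bad \<delta> 0 g}"
    by (simp add: distr_transl)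
  also have "\<dots> = prob (transl (emb z) -` {g \<in> space P. bad \<delta> 0 g} \<inter> space P)"
    by (rule measure_distr[OF transl_measurable bad_measurable])
  also have "transl (emb z) -` {g \<in> space P. bad \<delta> 0 g} \<inter> space P = {g \<in> space P. bad \<delta> z g}"
    using bad_transl[of _ \<delta> z] transl_Metrics by (auto simp: space_P)
  finally show ?thesis by simp
qed

text \<open>As \<open>\<delta>\<close> decreases to 0 the bad events for the cell at the origin
  decrease to the empty set, so their probabilities tend to 0; stationarity makes the bound uniform
  in \<open>z\<close>.\<close>

lemma prob_bad_small:
  assumes "\<eta> > 0"
  obtains \<delta> where "\<delta> > 0" "\<And>z. prob {g \<in> space P. bad \<delta> z g} \<le> \<eta>"
proof -
  define B where "B k = {g \<in> space P. bad (1 / real (Suc k)) 0 g}" for k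
  have "decseq B"
    unfolding decseq_Suc_iff
  proof (intro allI subsetI)
    fix k g assume "g \<in> B (Suc k)"
    then obtain x v where g: "g \<in> space P" "x \<in> dense_pts \<inter> icube 0 2" "v \<in> dense_pts"
      "v \<bullet> (g x *v v) < 1 / real (Suc (Suc k)) * (norm v)\<^sup>2" unfolding B_def bad_def by blast
    have "1 / real (Suc (Suc k)) * (norm v)\<^sup>2 \<le> 1 / real (Suc k) * (norm v)\<^sup>2"
      by (intro mult_right_mono divide_left_mono) auto
    then have "v \<bullet> (g x *v v) < 1 / real (Suc k) * (norm v)\<^sup>2" using g by linarith
    then show "g \<in> B k" unfolding B_def bad_def using g by blast
  qed
  then have "(\<lambda>k. prob (B k)) \<longlonglongrightarrow> prob (\<Inter>k. B k)"
    using bad_measurable by (intro finite_Lim_measure_decseq) (unfold B_def, auto simp del: of_nat_Suc)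
  moreover have "(\<Inter>k. B k) = {}" unfolding B_def using eventually_not_bad by (fastforce simp: space_P)
  ultimately have "(\<lambda>k. prob (B k)) \<longlonglongrightarrow> 0" by simp
  then have "eventually (\<lambda>k. prob (B k) < \<eta>) sequentially" using assms by (rule order_tendstoD)
  then obtain k where "prob (B k) < \<eta>" by (auto simp: eventually_sequentially)
  then have "prob {g \<in> space P. bad (1 / real (Suc k)) z g} \<le> \<eta>" for z
    unfolding prob_bad_transl[of _ z] B_def by (rule less_imp_le)
  then show ?thesis by (intro that[of "1 / real (Suc k)"]) auto
qed

text \<open>Peierls argument: the probability that at least half of the cells of a fixed distinct walk are
  bad decays exponentially fast enough to beat the number of walks of the same length.\<close>

lemma distinct_walks_mostly_good:
  obtains \<delta> where "\<delta> > 0" "AE g in P. \<exists>N. \<forall>n\<ge>N. \<forall>xs\<in>walks n 0. distinct xs \<longrightarrow>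
      real (n + 1) / 2 \<le> real (gcount (\<lambda>z. \<not> bad \<delta> z g) xs)"
proof -
  obtain K :: nat where K: "K > 0"
    "\<And>(X :: int^'n \<Rightarrow> 'n metric_field \<Rightarrow> real) m S N s. finite S \<Longrightarrow> card S \<le> N \<Longrightarrow> m \<ge> 1 \<Longrightarrow>
      (\<And>z. z \<in> S \<Longrightarrow> X z \<in> borel_measurable (loc (cube z 2))) \<Longrightarrow>
      (\<And>z. z \<in> S \<Longrightarrow> integrable P (\<lambda>g. exp (X z g))) \<Longrightarrow>
      (\<And>z. z \<in> S \<Longrightarrow> expectation (\<lambda>g. exp (X z g)) \<le> m) \<Longrightarrow>
      prob {g \<in> space P. (\<Sum>z\<in>S. X z g) \<ge> s} \<le> real K * m ^ N * exp (- s / real K)"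
    by (rule chernoff_lattice[of 2]) blast
  define c where "c = (3::real) ^ CARD('n)"
  have "c \<ge> 1" unfolding c_def by simp
  \<comment> \<open>With this choice the Chernoff factor at level \<open>lam * (n + 1) / 2\<close>
    is \<open>(4 * c) ^ (- (n + 1))\<close>. It beats the exponential moments, which give
    \<open>2 ^ (n + 1)\<close>, and the at most \<open>c ^ n\<close> walks, and still leaves
    \<open>(1/2) ^ (n + 1)\<close>.\<close>
  define lam where "lam = 2 * real K * ln (4 * c)"
  have "lam > 0" unfolding lam_def using K(1) \<open>c \<ge> 1\<close> by simp
  obtain \<delta> where \<delta>: "\<delta> > 0" "\<And>z. prob {g \<in> space P. bad \<delta> z g} \<le> exp (- lam)"
    using prob_bad_small[of "exp (- lam)"] by auto
  \<comment> \<open>Bad cells are rewarded with the large weight \<open>lam\<close>; being bad has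
    probability at most \<open>exp (- lam)\<close>, so the exponential moment of \<open>X z\<close>
    is nevertheless at most 2.\<close>
  define X where "X z g = lam * indicator {g \<in> Metrics. bad \<delta> z g} g" for z and g :: "'n metric_field"
  have Xm: "X z \<in> borel_measurable (loc (cube z 2))" for z
    unfolding X_def[abs_def] using bad_loc[of \<delta> z] by (intro borel_measurable_times borel_measurable_const borel_measurable_indicator)
  have Xm': "X z \<in> borel_measurable P" for z by (rule loc_measurable[OF Xm])
  have bd: "exp (X z g) \<le> 1 + exp lam * indicator {g \<in> space P. bad \<delta> z g} g" for z g
    unfolding X_def space_P by (auto simp: indicator_def)
  have int1: "integrable P (\<lambda>g. 1 + exp lam * indicator {g \<in> space P. bad \<delta> z g} g)" for z
    using bad_measurable[of \<delta> z] by (auto intro!: integrable_real_indicator simp: emeasure_eq_measure)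
  have int: "integrable P (\<lambda>g. exp (X z g))" for z
    by (rule Bochner_Integration.integrable_bound[OF int1[of z]])
       (use Xm'[of z] bd[of z] in \<open>auto intro!: AE_I2 order_trans[OF _ abs_ge_self]\<close>)
  have E: "expectation (\<lambda>g. exp (X z g)) \<le> 2" for z
  proof -
    have "expectation (\<lambda>g. exp (X z g)) \<le> expectation (\<lambda>g. 1 + exp lam * indicator {g \<in> space P. bad \<delta> z g} g)"
      by (intro integral_mono int int1 bd)
    also have "\<dots> = 1 + exp lam * prob {g \<in> space P. bad \<delta> z g}"
      using bad_measurable[of \<delta> z] prob_space
      by (subst Bochner_Integration.integral_add) (auto intro!: integrable_real_indicator simp: emeasure_eq_measure)
    also have "\<dots> \<le> 1 + exp lam * exp (- lam)" by (intro add_mono mult_left_mono \<delta>) auto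
    finally show ?thesis by (simp add: exp_minus)
  qed
  define W where "W n = {xs \<in> walks n (0::int^'n). distinct xs}" for n
  have W: "finite (W n)" "real (card (W n)) \<le> c ^ n" for n
  proof -
    show "finite (W n)" unfolding W_def by (rule finite_subset[OF _ walks_finite(1)[of n 0]]) auto
    have "card (W n) \<le> card (walks n (0::int^'n))" unfolding W_def by (intro card_mono walks_finite) auto
    also have "\<dots> \<le> (3 ^ CARD('n)) ^ n" by (rule walks_finite)
    finally show "real (card (W n)) \<le> c ^ n" unfolding c_def by (metis of_nat_le_iff of_nat_numeral of_nat_power)
  qed
  define A where "A n = (\<Union>xs\<in>W n. {g \<in> space P. (\<Sum>z\<in>set xs. X z g) \<ge> lam * real (n + 1) / 2})" for n
  have Em: "{g \<in> space P. (\<Sum>z\<in>set xs. X z g) \<ge> lam * real (n + 1) / 2} \<in> sets P" for xs n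
    using Xm' by measurable
  then have Am: "A n \<in> sets P" for n unfolding A_def using W by (intro sets.finite_UN) auto
  have PA: "prob (A n) \<le> real K * (1/2) ^ (n + 1)" for n
  proof -
    have "prob (A n) \<le> (\<Sum>xs\<in>W n. prob {g \<in> space P. (\<Sum>z\<in>set xs. X z g) \<ge> lam * real (n + 1) / 2})"
      unfolding A_def using W Em by (intro finite_measure_subadditive_finite) auto
    also have "\<dots> \<le> (\<Sum>xs\<in>W n. real K * (1 / (2 * c)) ^ (n + 1))"
    proof (rule sum_mono)
      fix xs assume xs: "xs \<in> W n"
      have "card (set xs) \<le> n + 1"
        using xs card_length[of xs] walks_basic[of xs n 0] unfolding W_def by auto
      then have "prob {g \<in> space P. (\<Sum>z\<in>set xs. X z g) \<ge> lam * real (n + 1) / 2}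
          \<le> real K * 2 ^ (n + 1) * exp (- (lam * real (n + 1) / 2) / real K)"
        by (intro K(2) Xm int E) auto
      also have "- (lam * real (n + 1) / 2) / real K = real (n + 1) * (- ln (4 * c))"
        unfolding lam_def using K(1) by (simp add: field_simps)
      also have "exp (real (n + 1) * (- ln (4 * c))) = (1 / (4 * c)) ^ (n + 1)"
        unfolding exp_of_nat_mult using \<open>c \<ge> 1\<close> by (simp add: exp_minus inverse_eq_divide)
      also have "real K * 2 ^ (n + 1) * (1 / (4 * c)) ^ (n + 1) = real K * (1 / (2 * c)) ^ (n + 1)"
        unfolding mult.assoc power_mult_distrib[symmetric] by simp
      finally show "prob {g \<in> space P. (\<Sum>z\<in>set xs. X z g) \<ge> lam * real (n + 1) / 2} \<le> real K * (1 / (2 * c)) ^ (n + 1)" .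
    qed
    also have "\<dots> = real (card (W n)) * (real K * (1 / (2 * c)) ^ (n + 1))" by simp
    also have "\<dots> \<le> c ^ (n + 1) * (real K * (1 / (2 * c)) ^ (n + 1))"
      using W(2)[of n] \<open>c \<ge> 1\<close> by (intro mult_right_mono order_trans[OF W(2)] power_increasing) auto
    also have "\<dots> = real K * (c * (1 / (2 * c))) ^ (n + 1)"
      unfolding power_mult_distrib by (simp only: mult.left_commute)
    also have "c * (1 / (2 * c)) = 1/2" using \<open>c \<ge> 1\<close> by simp
    finally show ?thesis .
  qed
  have "summable (\<lambda>n. real K * (1/2) ^ (n + 1))"
    by (simp add: summable_geometric summable_mult)
  then have "summable (\<lambda>n. prob (A n))"
    by (rule summable_comparison_test'[where N = 0]) (use PA in auto)
  then have "AE g in P. eventually (\<lambda>n. g \<in> space P - A n) sequentially"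
    by (intro borel_cantelli_AE1 Am) (auto simp: emeasure_eq_measure)
  then have "AE g in P. \<exists>N. \<forall>n\<ge>N. \<forall>xs\<in>walks n 0. distinct xs \<longrightarrow>
      real (n + 1) / 2 \<le> real (gcount (\<lambda>z. \<not> bad \<delta> z g) xs)"
  proof eventually_elim
    case (elim g)
    then obtain N where N: "\<And>n. n \<ge> N \<Longrightarrow> g \<in> space P - A n" unfolding eventually_sequentially by blast
    show ?case
    proof (intro exI[of _ N] allI impI ballI)
      fix n and xs :: "(int^'n) list" assume n: "N \<le> n" and xs: "xs \<in> walks n 0" "distinct xs"
      have g: "g \<in> Metrics" using N[OF n] by (simp add: space_P)
      have "xs \<in> W n" unfolding W_def using xs by simp
      then have lt: "(\<Sum>z\<in>set xs. X z g) < lam * real (n + 1) / 2"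
        using N[OF n] unfolding A_def by force
      have "(\<Sum>z\<in>set xs. X z g) = lam * (\<Sum>z\<in>set xs. indicator {z. bad \<delta> z g} z)"
        unfolding X_def sum_distrib_left using g by (intro sum.cong) (auto simp: indicator_def)
      also have "(\<Sum>z\<in>set xs. indicator {z. bad \<delta> z g} z) = real (card {z \<in> set xs. bad \<delta> z g})"
        by (simp add: indicator_def Int_def sum.If_cases)
      finally have "lam * real (card {z \<in> set xs. bad \<delta> z g}) < lam * (real (n + 1) / 2)"
        using lt by simp
      then have "real (card {z \<in> set xs. bad \<delta> z g}) < real (n + 1) / 2"
        using \<open>lam > 0\<close> by (simp only: mult_less_cancel_left_pos)
      moreover have half: "n / 2 \<le> b" if "a < n / 2" "a + b = n" for a b n :: real
        using that by simp
      have "card {z \<in> set xs. bad \<delta> z g} + card {z \<in> set xs. \<not> bad \<delta> z g} = n + 1"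
      proof -
        have "card ({z \<in> set xs. bad \<delta> z g} \<union> {z \<in> set xs. \<not> bad \<delta> z g})
            = card {z \<in> set xs. bad \<delta> z g} + card {z \<in> set xs. \<not> bad \<delta> z g}"
          by (intro card_Un_disjoint) auto
        moreover have "{z \<in> set xs. bad \<delta> z g} \<union> {z \<in> set xs. \<not> bad \<delta> z g} = set xs" by auto
        ultimately show ?thesis using distinct_card[OF xs(2)] walks_basic[OF xs(1)] by simp
      qed
      then have "real (card {z \<in> set xs. bad \<delta> z g}) + real (card {z \<in> set xs. \<not> bad \<delta> z g}) = real (n + 1)"
        by (simp only: of_nat_add[symmetric])
      ultimately show "real (n + 1) / 2 \<le> real (gcount (\<lambda>z. \<not> bad \<delta> z g) xs)"
        unfolding gcount_def by (rule half)
    qed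
  qed
  then show ?thesis using that \<delta>(1) by blast
qed

text \<open>A walk that realizes \<open>ptime\<close> remains, after loop erasure, a walk to the
  same site, and at least half of it is good once it is long. So \<open>ptime\<close>, and with it
  \<open>pot\<close>, grows linearly, and \<open>pot_le_rdist\<close> carries the growth over to the
  distance.\<close>

lemma linear_lower_bound:
  obtains c where "c > 0" "AE g in P. \<exists>N. \<forall>x. norm x \<ge> N \<longrightarrow> rdist g 0 x \<ge> c * norm x"
proof -
  obtain \<delta> where \<delta>: "\<delta> > 0" "AE g in P. \<exists>N. \<forall>n\<ge>N. \<forall>xs\<in>walks n 0. distinct xs \<longrightarrow>
      real (n + 1) / 2 \<le> real (gcount (\<lambda>z. \<not> bad \<delta> z g) xs)"
    using distinct_walks_mostly_good by blast
  \<comment> \<open>12 is 3 from the slope of \<open>pot\<close> times 4 from its growth by at least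
    a quarter of the sup norm; the dimension compares the sup norm with the Euclidean norm.\<close>
  define c where "c = sqrt \<delta> / (12 * real CARD('n))"
  have "c > 0" unfolding c_def using \<delta>(1) by simp
  have "AE g in P. g \<in> space P" by (rule AE_space)
  with \<delta>(2) have "AE g in P. \<exists>N. \<forall>x. norm x \<ge> N \<longrightarrow> rdist g 0 x \<ge> c * norm x"
  proof eventually_elim
    case (elim g)
    then have g: "g \<in> Metrics" by (simp add: space_P)
    let ?G = "\<lambda>z. \<not> bad \<delta> z g"
    obtain N where N: "\<And>n xs. n \<ge> N \<Longrightarrow> xs \<in> walks n 0 \<Longrightarrow> distinct xs \<Longrightarrow> real (n + 1) / 2 \<le> real (gcount ?G xs)"
      using elim by blast
    \<comment> \<open>Subtracting \<open>N\<close> covers the erased walks with fewer than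
      \<open>N\<close> steps: for those the left-hand bound is negative.\<close>
    have T: "real (ptime ?G z) \<ge> real (kd 0 z) / 2 - real N" for z
    proof -
      obtain n xs where xs: "xs \<in> walks n 0" "last xs = z" "gcount ?G xs = ptime ?G z" using ptime_attained by blast
      obtain m ys where ys: "ys \<in> walks m 0" "distinct ys" "last ys = last xs" "set ys \<subseteq> set xs"
        using walks_distinct[OF xs(1)] by blast
      have le: "gcount ?G ys \<le> gcount ?G xs" unfolding gcount_def using ys by (intro card_mono) auto
      have kd: "kd 0 z \<le> m" using walks_length[OF ys(1)] ys xs by simp
      show ?thesis
      proof (cases "m \<ge> N")
        case True
        show ?thesis using N[OF True ys(1,2)] le kd xs(3) by simp
      next
        case False
        then show ?thesis using kd by simp
      qed
    qed
    have u: "pot ?G x \<ge> infnorm x / 2 - real N - 3/2" for x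
    proof (rule pot_ge)
      fix z
      have "infnorm x \<le> dinf x z + real (kd 0 z)"
        unfolding infnorm_le_iff
      proof
        fix i
        have "\<bar>x $ i - of_int (z $ i)\<bar> \<le> dinf x z"
          using component_le_infnorm_cart[of "x - emb z" i] unfolding dinf_def emb_def by simp
        moreover have "\<bar>z $ i\<bar> \<le> int (kd 0 z)" using kd_le_iff[of 0 z "kd 0 z"] by simp
        then have "\<bar>real_of_int (z $ i)\<bar> \<le> real (kd 0 z)" by linarith
        ultimately show "\<bar>x $ i\<bar> \<le> dinf x z + real (kd 0 z)" by linarith
      qed
      moreover have "dinf x z \<ge> 0" unfolding dinf_def by (rule infnorm_pos_le)
      ultimately show "infnorm x / 2 - real N - 3/2 \<le> real (ptime ?G z) + 3 * max 0 (dinf x z - 1/2)"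
        using T[of z] by (auto simp: max_def)
    qed
    have u0: "pot ?G 0 \<le> 1"
    proof -
      have "dinf (0::real^'n) 0 = 0" unfolding dinf_def emb_def by (simp add: infnorm_eq_0 vec_eq_iff)
      then have "pot ?G 0 \<le> real (ptime ?G 0)" using pot_le[of ?G 0 0] by simp
      also have "\<dots> \<le> 1" using ptime_0[of ?G] by (simp only: of_nat_le_1_iff)
      finally show ?thesis .
    qed
    have nrm: "norm x \<le> real CARD('n) * infnorm x" for x :: "real^'n"
    proof -
      have "norm x \<le> (\<Sum>i\<in>UNIV. \<bar>x $ i\<bar>)" by (rule norm_le_l1_cart)
      also have "\<dots> \<le> (\<Sum>i\<in>(UNIV::'n set). infnorm x)" by (intro sum_mono component_le_infnorm_cart)
      finally show ?thesis by simp
    qed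
    \<comment> \<open>The threshold comes from \<open>y / 2 - N - 3/2 - 1 \<ge> y / 4\<close>, which
      means \<open>y \<ge> 4 * N + 10\<close>.\<close>
    show ?case
    proof (intro exI[of _ "real CARD('n) * (4 * real N + 10)"] allI impI)
      fix x :: "real^'n" assume x: "real CARD('n) * (4 * real N + 10) \<le> norm x"
      define y where "y = norm x / real CARD('n)"
      have y: "4 * real N + 10 \<le> y" "y \<le> infnorm x"
        unfolding y_def using x nrm[of x] by (simp_all add: field_simps)
      have "y / 4 \<le> pot ?G x - pot ?G 0" using u[of x] u0 y by linarith
      also have "\<dots> \<le> 3 / sqrt \<delta> * rdist g 0 x" by (rule pot_le_rdist[OF g \<delta>(1)])
      finally have "y / 4 \<le> 3 / sqrt \<delta> * rdist g 0 x" .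
      then have "(sqrt \<delta> / 3) * (y / 4) \<le> rdist g 0 x" using \<delta>(1) by (simp add: field_simps)
      then show "c * norm x \<le> rdist g 0 x" unfolding c_def y_def by (simp add: field_simps)
    qed
  qed
  then show ?thesis using that \<open>c > 0\<close> by blast
qed

end

section \<open>Directional limits\<close>

lemma le_of_linear_bound:
  fixes a b C :: real
  assumes "\<And>T::nat. T \<ge> 1 \<Longrightarrow> a * real T \<le> b * real T + C"
  shows "a \<le> b"
proof (rule ccontr)
  assume "\<not> a \<le> b"
  then have pos: "a - b > 0" by simp
  obtain T :: nat where T: "C / (a - b) < real T" using reals_Archimedean2 by blast
  have "C < (a - b) * real (Suc T)" using T pos by (simp add: pos_divide_less_eq algebra_simps)
  then show False using assms[of "Suc T"] by (simp add: algebra_simps)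
qed

text \<open>Deterministic core of the Katznelson-Weiss proof of the ergodic theorem: where a short
  jump at cost at most \<open>f\<close> per step exists, take it; elsewhere make a single step.\<close>

lemma jump_decomposition:
  fixes D :: "nat \<Rightarrow> nat \<Rightarrow> real" and w e :: "nat \<Rightarrow> real"
  assumes D0: "\<And>x. D x x = 0" and tri: "\<And>x y z. D x z \<le> D x y + D y z"
    and e: "\<And>x. D x (Suc x) \<le> e x" "\<And>x. e x \<ge> 0" and w: "\<And>x. w x \<ge> 0" and "f \<ge> 0"
    and jump: "\<And>x. x < T \<Longrightarrow> w x < 1 \<Longrightarrow> \<exists>n\<ge>1. x + n \<le> T \<and> D x (x + n) \<le> real n * f"
  shows "x \<le> T \<Longrightarrow> D x T \<le> real (T - x) * f + (\<Sum>y\<in>{x..<T}. w y * e y)"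
proof (induction "T - x" arbitrary: x rule: less_induct)
  case less
  have nn: "w y * e y \<ge> 0" for y using e(2) w by simp
  show ?case
  proof (cases "x = T")
    case True
    then show ?thesis using D0 by simp
  next
    case False
    then have x: "x < T" using less.prems by simp
    show ?thesis
    proof (cases "w x < 1")
      case True
      then obtain n where n: "n \<ge> 1" "x + n \<le> T" "D x (x + n) \<le> real n * f" using jump[OF x] by blast
      have "D (x + n) T \<le> real (T - (x + n)) * f + (\<Sum>y\<in>{x + n..<T}. w y * e y)"
        using n x by (intro less.hyps) auto
      moreover have "(\<Sum>y\<in>{x + n..<T}. w y * e y) \<le> (\<Sum>y\<in>{x..<T}. w y * e y)"
        using nn by (intro sum_mono2) auto
      moreover have "real n * f + real (T - (x + n)) * f = real (T - x) * f"
        using n by (simp add: of_nat_diff algebra_simps)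
      ultimately show ?thesis using tri[of x T "x + n"] n(3) by linarith
    next
      case False
      \<comment> \<open>No jump is available here, so \<open>w x \<ge> 1\<close>, and the term
        \<open>w x * e x\<close> of the sum pays for a single step.\<close>
      have "D (Suc x) T \<le> real (T - Suc x) * f + (\<Sum>y\<in>{Suc x..<T}. w y * e y)"
        using x by (intro less.hyps) auto
      moreover have "1 * e x \<le> w x * e x" using False e(2) by (intro mult_right_mono) auto
      moreover have "(\<Sum>y\<in>{x..<T}. w y * e y) = w x * e x + (\<Sum>y\<in>{Suc x..<T}. w y * e y)"
        using x by (rule sum.atLeast_Suc_lessThan)
      moreover have "real (T - Suc x) * f \<le> real (T - x) * f"
        using \<open>f \<ge> 0\<close> by (intro mult_right_mono) auto
      ultimately show ?thesis using tri[of x T "Suc x"] e(1)[of x] by linarith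
    qed
  qed
qed

context random_metric
begin

section \<open>Expected distances and a law of large numbers\<close>

lemma wt_integrable: "integrable P (wt z)" "expectation (wt z) \<ge> 0"
  and expectation_wt_bounded: "\<exists>m\<ge>1. \<forall>z. expectation (wt z) \<le> m"
proof -
  obtain m where m: "m \<ge> 1" "\<And>z. integrable P (\<lambda>g. exp (wt z g))" "\<And>z. expectation (\<lambda>g. exp (wt z g)) \<le> m"
    using wt_moments by blast
  have mw: "wt z \<in> borel_measurable P" for z by (rule loc_measurable[OF wt_loc])
  have le: "0 \<le> wt z g \<and> wt z g \<le> exp (wt z g)" if "g \<in> space P" for z g
  proof -
    have "1 \<le> wt z g" using wt_ge_1[of g z] that by (simp add: space_P)
    moreover have "1 + wt z g \<le> exp (wt z g)" by (rule exp_ge_add_one_self)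
    ultimately show ?thesis by linarith
  qed
  have int: "integrable P (wt z)" for z
    by (rule Bochner_Integration.integrable_bound[OF m(2)[of z] mw]) (use le in auto)
  show "integrable P (wt z)" by (rule int)
  show "expectation (wt z) \<ge> 0" using le by (intro integral_nonneg_AE) auto
  have "expectation (wt z) \<le> m" for z
    using integral_mono[OF int m(2)[of z]] le m(3)[of z] by fastforce
  then show "\<exists>m\<ge>1. \<forall>z. expectation (wt z) \<le> m" using m(1) by blast
qed

lemma rdist_integrable: "integrable P (\<lambda>g. rdist g x y)"
proof (rule Bochner_Integration.integrable_bound)
  show "integrable P (\<lambda>g. 3 * real CARD('n) * (\<Sum>s\<in>kpath (near x) (near y). wt s g))"
    by (intro integrable_mult_right Bochner_Integration.integrable_sum wt_integrable)
  show "AE g in P. norm (rdist g x y) \<le> norm (3 * real CARD('n) * (\<Sum>s\<in>kpath (near x) (near y). wt s g))"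
    using kpath(3)[OF _ near_cube near_cube, of _ x y] rdist_nonneg
    by (intro AE_I2) (force simp: space_P)
qed simp

definition mean :: "real^'n \<Rightarrow> real" where
  "mean x = expectation (\<lambda>g. rdist g 0 x)"

lemma mean_nonneg: "mean x \<ge> 0"
  unfolding mean_def by (intro integral_nonneg_AE AE_I2) (auto simp: space_P rdist_nonneg)

lemma expectation_rdist: "expectation (\<lambda>g. rdist g x (x + y)) = mean y"
proof -
  have "mean y = expectation (\<lambda>g. rdist (transl x g) 0 y)"
    unfolding mean_def by (rule expectation_transl[symmetric]) simp
  also have "\<dots> = expectation (\<lambda>g. rdist g x (x + y))"
    by (intro Bochner_Integration.integral_cong) (auto simp: space_P rdist_transl add.commute)
  finally show ?thesis by simp
qed

lemma mean_triangle: "mean (x + y) \<le> mean x + mean y"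
proof -
  have "mean (x + y) \<le> expectation (\<lambda>g. rdist g 0 x + rdist g x (x + y))"
    unfolding mean_def
    by (intro integral_mono rdist_integrable Bochner_Integration.integrable_add)
       (auto simp: space_P intro: rdist_triangle)
  also have "\<dots> = mean x + mean y"
    by (subst Bochner_Integration.integral_add) (auto simp: rdist_integrable expectation_rdist mean_def)
  finally show ?thesis .
qed

lemma mean_multiple: "mean (real k *\<^sub>R x) \<le> real k * mean x"
proof (induction k)
  case 0
  have "mean 0 = expectation (\<lambda>g. 0)"
    unfolding mean_def by (intro Bochner_Integration.integral_cong) (auto simp: space_P)
  then show ?case by simp
next
  case (Suc k)
  have "real (Suc k) *\<^sub>R x = real k *\<^sub>R x + x" by (simp add: algebra_simps)
  then show ?case using mean_triangle[of "real k *\<^sub>R x" x] Suc by (simp add: algebra_simps)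
qed

lemma mean_bounded: "\<exists>C. \<forall>x. mean x \<le> C * (norm x + 2)"
proof -
  obtain m where m: "m \<ge> 1" "\<And>z. expectation (wt z) \<le> m" using expectation_wt_bounded by blast
  have "mean x \<le> (3 * real CARD('n) * m) * (norm x + 2)" for x
  proof -
    let ?S = "kpath (near 0) (near x)"
    have "mean x \<le> expectation (\<lambda>g. 3 * real CARD('n) * (\<Sum>s\<in>?S. wt s g))"
      unfolding mean_def
      by (intro integral_mono rdist_integrable integrable_mult_right Bochner_Integration.integrable_sum wt_integrable)
         (auto simp: space_P intro: kpath(3)[OF _ near_cube near_cube])
    also have "\<dots> = 3 * real CARD('n) * (\<Sum>s\<in>?S. expectation (wt s))"
      by (simp add: wt_integrable)
    also have "\<dots> \<le> 3 * real CARD('n) * (real (card ?S) * m)"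
      using sum_bounded_above[of ?S "\<lambda>s. expectation (wt s)" m] m by (intro mult_left_mono) auto
    also have "real (card ?S) * m \<le> (norm x + 2) * m"
    proof (rule mult_right_mono)
      have "card ?S \<le> Suc (nat \<lfloor>norm (0 - x) + 1\<rfloor>)"
        using kpath(2)[of "near 0" "near x"] kd_near[of 0 x] by simp
      then have "real (card ?S) \<le> real (Suc (nat \<lfloor>norm x + 1\<rfloor>))" by (simp only: of_nat_le_iff diff_0 norm_minus_cancel)
      then have "real (card ?S) \<le> 1 + real (nat \<lfloor>norm x + 1\<rfloor>)" by (simp only: of_nat_Suc)
      also have "real (nat \<lfloor>norm x + 1\<rfloor>) = of_int \<lfloor>norm x + 1\<rfloor>"
        by (intro of_nat_nat) simp
      also have "1 + of_int \<lfloor>norm x + 1\<rfloor> \<le> norm x + 2" by linarith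
      finally show "real (card ?S) \<le> norm x + 2" .
    qed (use m in simp)
    finally show ?thesis by (simp add: mult_left_mono algebra_simps)
  qed
  then show ?thesis by blast
qed

text \<open>Stationary variables depending on a bounded window only have short-range correlations, so
  Chebyshev's inequality along the squares is summable.\<close>

lemma lln_along_squares:
  fixes f :: "'n metric_field \<Rightarrow> real"
  assumes f: "f \<in> borel_measurable (loc (cball 0 \<rho>))" and sq: "integrable P (\<lambda>g. (f g)\<^sup>2)"
    and "w \<noteq> 0" "\<epsilon> > 0"
  shows "AE g in P. \<exists>N. \<forall>k\<ge>N. (\<Sum>i<k\<^sup>2. f (transl (real i *\<^sub>R w) g)) \<le> real (k\<^sup>2) * (expectation f + \<epsilon>)"
proof -
  have fm: "f \<in> borel_measurable P" by (rule loc_measurable[OF f])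
  have fi: "integrable P f" using square_integrable_imp_integrable[OF fm sq] .
  define a where "a = expectation f"
  define h where "h g = f g - a" for g
  have hl: "h \<in> borel_measurable (loc (cball 0 \<rho>))" unfolding h_def[abs_def] using f by measurable
  have hm: "h \<in> borel_measurable P" by (rule loc_measurable[OF hl])
  have hi: "integrable P h" unfolding h_def[abs_def] using fi by auto
  have Eh: "expectation h = 0" unfolding h_def a_def using fi prob_space by simp
  have hsq: "integrable P (\<lambda>g. (h g)\<^sup>2)"
    unfolding h_def power2_diff using fi sq by auto
  define \<sigma> where "\<sigma> = expectation (\<lambda>g. (h g)\<^sup>2)"
  have "\<sigma> \<ge> 0" unfolding \<sigma>_def by simp
  define Y where "Y i g = h (transl (real i *\<^sub>R w) g)" for i g
  have Yloc: "Y i \<in> borel_measurable (loc (cball (real i *\<^sub>R w) \<rho>))" for i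
    unfolding Y_def[abs_def] by (rule loc_transl[OF hl]) (auto simp: dist_norm)
  have Ym: "Y i \<in> borel_measurable P" for i by (rule loc_measurable[OF Yloc])
  have Yi: "integrable P (Y i)" for i unfolding Y_def[abs_def] by (rule integrable_transl[OF hi])
  have EY: "expectation (Y i) = 0" for i unfolding Y_def[abs_def] using expectation_transl[OF hm] Eh by simp
  have Ysq: "integrable P (\<lambda>g. (Y i g)\<^sup>2)" for i unfolding Y_def using integrable_transl[OF hsq] .
  have EYsq: "expectation (\<lambda>g. (Y i g)\<^sup>2) = \<sigma>" for i
    unfolding Y_def \<sigma>_def using expectation_transl[of "\<lambda>g. (h g)\<^sup>2"] hm by simp
  have YY: "integrable P (\<lambda>g. Y i g * Y j g)" for i j
  proof (rule Bochner_Integration.integrable_bound)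
    show "integrable P (\<lambda>g. (Y i g)\<^sup>2 + (Y j g)\<^sup>2)" using Ysq by auto
    show "(\<lambda>g. Y i g * Y j g) \<in> borel_measurable P" using Ym by measurable
    have "\<bar>Y i g * Y j g\<bar> \<le> (Y i g)\<^sup>2 + (Y j g)\<^sup>2" for g
      using sum_squares_bound[of "\<bar>Y i g\<bar>" "\<bar>Y j g\<bar>"] abs_ge_zero[of "Y i g * Y j g"]
      unfolding abs_mult power2_abs by linarith
    then show "AE g in P. norm (Y i g * Y j g) \<le> norm ((Y i g)\<^sup>2 + (Y j g)\<^sup>2)" by simp
  qed
  have EYY: "expectation (\<lambda>g. Y i g * Y j g) \<le> \<sigma>" for i j
  proof -
    have "expectation (\<lambda>g. Y i g * Y j g) \<le> expectation (\<lambda>g. ((Y i g)\<^sup>2 + (Y j g)\<^sup>2) / 2)"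
    proof (intro integral_mono YY)
      show "integrable P (\<lambda>g. ((Y i g)\<^sup>2 + (Y j g)\<^sup>2) / 2)" using Ysq by auto
      fix g
      show "Y i g * Y j g \<le> ((Y i g)\<^sup>2 + (Y j g)\<^sup>2) / 2"
        using sum_squares_bound[of "Y i g" "Y j g"] by (simp add: mult.assoc)
    qed
    also have "\<dots> = \<sigma>" using Ysq EYsq by simp
    finally show ?thesis .
  qed
  \<comment> \<open>From \<open>q\<close> steps on, the windows of radius \<open>\<rho>\<close>
    around two points of the orbit are at least \<open>R0\<close> apart, so each row of the
    covariance matrix has at most \<open>2 * q\<close> nonzero entries.\<close>
  obtain q :: nat where q: "(R0 + 2 * \<rho>) / norm w \<le> real q" using real_arch_simple by blast
  have far: "expectation (\<lambda>g. Y i g * Y j g) = 0" if "i + q \<le> j \<or> j + q \<le> i" for i j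
  proof -
    have "indep_var borel (Y i) borel (Y j)"
    proof (rule loc_indep[OF _ Yloc Yloc])
      fix x y assume x: "x \<in> cball (real i *\<^sub>R w) \<rho>" and y: "y \<in> cball (real j *\<^sub>R w) \<rho>"
      have "R0 + 2 * \<rho> \<le> real q * norm w" using q \<open>w \<noteq> 0\<close> by (simp add: pos_divide_le_eq)
      also have "\<dots> \<le> \<bar>real i - real j\<bar> * norm w" using that by (intro mult_right_mono) auto
      also have "\<dots> = norm (real i *\<^sub>R w - real j *\<^sub>R w)" by (simp add: scaleR_diff_left[symmetric])
      also have "\<dots> = norm ((real i *\<^sub>R w - x) + (x - y) + (y - real j *\<^sub>R w))" by simp
      also have "\<dots> \<le> norm (real i *\<^sub>R w - x) + norm (x - y) + norm (y - real j *\<^sub>R w)"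
        by (intro norm_triangle_le add_mono norm_triangle_ineq order_refl)
      also have "\<dots> \<le> \<rho> + norm (x - y) + \<rho>"
        using x y by (simp add: dist_norm norm_minus_commute)
      finally show "R0 \<le> norm (x - y)" by simp
    qed
    then show ?thesis using indep_var_lebesgue_integral[OF _ Yi Yi, of i j] EY by simp
  qed
  define S where "S n g = (\<Sum>i<n. Y i g)" for n :: nat and g
  have Sm: "S n \<in> borel_measurable P" for n unfolding S_def[abs_def] using Ym by measurable
  have Ssq_eq: "(S n g)\<^sup>2 = (\<Sum>i<n. \<Sum>j<n. Y i g * Y j g)" for n g
    unfolding S_def power2_eq_square by (simp add: sum_product)
  have Ssq: "integrable P (\<lambda>g. (S n g)\<^sup>2)" for n
    unfolding Ssq_eq by (intro Bochner_Integration.integrable_sum YY)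
  have ESsq: "expectation (\<lambda>g. (S n g)\<^sup>2) \<le> real n * (2 * real q * \<sigma>)" for n
  proof -
    have "expectation (\<lambda>g. (S n g)\<^sup>2) = (\<Sum>i<n. \<Sum>j<n. expectation (\<lambda>g. Y i g * Y j g))"
      unfolding Ssq_eq using YY by (simp add: Bochner_Integration.integral_sum)
    also have "\<dots> \<le> (\<Sum>i<n. 2 * real q * \<sigma>)"
    proof (rule sum_mono)
      fix i
      have "(\<Sum>j<n. expectation (\<lambda>g. Y i g * Y j g)) \<le> (\<Sum>j<n. if j \<in> {i - q..<i + q} then \<sigma> else 0)"
      proof (rule sum_mono)
        fix j
        show "expectation (\<lambda>g. Y i g * Y j g) \<le> (if j \<in> {i - q..<i + q} then \<sigma> else 0)"
          using EYY[of i j] far[of i j] \<open>\<sigma> \<ge> 0\<close> by (cases "i + q \<le> j \<or> j + q \<le> i") auto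
      qed
      also have "\<dots> = (\<Sum>j\<in>{..<n} \<inter> {i - q..<i + q}. \<sigma>)"
        by (rule sum.inter_restrict[symmetric]) simp
      also have "\<dots> = real (card ({..<n} \<inter> {i - q..<i + q})) * \<sigma>" by simp
      also have "\<dots> \<le> (2 * real q) * \<sigma>"
      proof (rule mult_right_mono[OF _ \<open>\<sigma> \<ge> 0\<close>])
        have "card ({..<n} \<inter> {i - q..<i + q}) \<le> card {i - q..<i + q}" by (intro card_mono) auto
        also have "\<dots> \<le> 2 * q" by simp
        finally show "real (card ({..<n} \<inter> {i - q..<i + q})) \<le> 2 * real q" by linarith
      qed
      finally show "(\<Sum>j<n. expectation (\<lambda>g. Y i g * Y j g)) \<le> 2 * real q * \<sigma>" .
    qed
    finally show ?thesis by simp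
  qed
  \<comment> \<open>For k^2 summands Chebyshev's bound is of order 1 / k^2 and hence summable; along
    all n it would only be of order 1 / n.\<close>
  define A where "A k = {g \<in> space P. (S (k\<^sup>2) g)\<^sup>2 \<ge> (real (k\<^sup>2) * \<epsilon>)\<^sup>2}" for k :: nat
  have Am: "A k \<in> sets P" for k unfolding A_def using Sm[of "k\<^sup>2"] by measurable
  have PA: "prob (A k) \<le> (2 * real q * \<sigma> / \<epsilon>\<^sup>2) * (1 / real k ^ 2)" if "k \<ge> 1" for k
  proof -
    have pos: "(real (k\<^sup>2) * \<epsilon>)\<^sup>2 > 0" using that \<open>\<epsilon> > 0\<close> by simp
    have "prob (A k) \<le> (1 / (real (k\<^sup>2) * \<epsilon>)\<^sup>2) * expectation (\<lambda>g. (S (k\<^sup>2) g)\<^sup>2)"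
      using integral_Markov_inequality_measure[OF Ssq[of "k\<^sup>2"], of "space P" "(real (k\<^sup>2) * \<epsilon>)\<^sup>2"] pos
      unfolding A_def by simp
    also have "\<dots> \<le> (1 / (real (k\<^sup>2) * \<epsilon>)\<^sup>2) * (real (k\<^sup>2) * (2 * real q * \<sigma>))"
      by (intro mult_left_mono ESsq) auto
    also have "\<dots> = (2 * real q * \<sigma> / \<epsilon>\<^sup>2) * (1 / real k ^ 2)"
      using that \<open>\<epsilon> > 0\<close> by (simp add: power2_eq_square field_simps)
    finally show ?thesis .
  qed
  have "summable (\<lambda>k. (2 * real q * \<sigma> / \<epsilon>\<^sup>2) * (1 / real k ^ 2))"
    using inverse_power_summable[of 2, where 'a = real] by (intro summable_mult) (simp add: inverse_eq_divide)
  then have "summable (\<lambda>k. prob (A k))"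
    by (rule summable_comparison_test'[where N = 1]) (use PA in auto)
  then have "AE g in P. eventually (\<lambda>k. g \<in> space P - A k) sequentially"
    by (intro borel_cantelli_AE1 Am) (auto simp: emeasure_eq_measure)
  then show ?thesis
  proof eventually_elim
    case (elim g)
    then obtain N where N: "\<And>k. k \<ge> N \<Longrightarrow> g \<in> space P - A k" unfolding eventually_sequentially by blast
    show ?case
    proof (intro exI[of _ N] allI impI)
      fix k assume "N \<le> k"
      then have "(S (k\<^sup>2) g)\<^sup>2 < (real (k\<^sup>2) * \<epsilon>)\<^sup>2" using N[of k] unfolding A_def by auto
      then have "S (k\<^sup>2) g < real (k\<^sup>2) * \<epsilon>"
        using \<open>\<epsilon> > 0\<close> power2_less_imp_less[of "S (k\<^sup>2) g" "real (k\<^sup>2) * \<epsilon>"] by simp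
      moreover have "S (k\<^sup>2) g = (\<Sum>i<k\<^sup>2. f (transl (real i *\<^sub>R w) g)) - real (k\<^sup>2) * a"
        unfolding S_def Y_def h_def by (simp add: sum_subtractf)
      ultimately show "(\<Sum>i<k\<^sup>2. f (transl (real i *\<^sub>R w) g)) \<le> real (k\<^sup>2) * (expectation f + \<epsilon>)"
        unfolding a_def by (simp add: algebra_simps)
    qed
  qed
qed

lemma local_bound_real:
  obtains a where "a > 0" "\<And>\<delta>. \<delta> > 0 \<Longrightarrow> AE g in P. \<exists>N. \<forall>r\<ge>N. \<forall>x y.
      norm x \<le> r \<longrightarrow> norm y \<le> r \<longrightarrow> norm (x - y) \<le> \<delta> * r \<longrightarrow> rdist g x y \<le> a * \<delta> * r"
proof -
  obtain a where a: "a > 0" "\<And>\<delta>. \<delta> > 0 \<Longrightarrow> AE g in P. \<exists>N::nat. \<forall>n\<ge>N. \<forall>x y.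
      norm x \<le> real n \<longrightarrow> norm y \<le> real n \<longrightarrow> norm (x - y) \<le> \<delta> * real n \<longrightarrow> rdist g x y \<le> a * \<delta> * real n"
    using local_bound by blast
  have "AE g in P. \<exists>N. \<forall>r\<ge>N. \<forall>x y.
      norm x \<le> r \<longrightarrow> norm y \<le> r \<longrightarrow> norm (x - y) \<le> \<delta> * r \<longrightarrow> rdist g x y \<le> (2 * a) * \<delta> * r"
    if "\<delta> > 0" for \<delta>
    using a(2)[OF that]
  proof eventually_elim
    case (elim g)
    then obtain N where N: "\<And>n x y. n \<ge> N \<Longrightarrow> norm x \<le> real n \<Longrightarrow> norm y \<le> real n \<Longrightarrow>
        norm (x - y) \<le> \<delta> * real n \<Longrightarrow> rdist g x y \<le> a * \<delta> * real n" by blast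
    show ?case
    proof (intro exI[of _ "max 1 (real N)"] allI impI)
      fix r and x y :: "real^'n"
      assume r: "max 1 (real N) \<le> r" "norm x \<le> r" "norm y \<le> r" "norm (x - y) \<le> \<delta> * r"
      \<comment> \<open>Rounding up costs at most 1, which is at most \<open>r\<close>; this is the
        factor 2 in the constant.\<close>
      define n where "n = nat \<lceil>r\<rceil>"
      have n: "r \<le> real n" "real n \<le> r + 1" unfolding n_def using r(1) by linarith+
      have "\<delta> * r \<le> \<delta> * real n" using n that by (intro mult_left_mono) auto
      then have "rdist g x y \<le> a * \<delta> * real n" using r n by (intro N) auto
      also have "\<dots> \<le> a * \<delta> * (2 * r)" using n r that a(1) by (intro mult_left_mono) auto
      finally show "rdist g x y \<le> (2 * a) * \<delta> * r" by simp
    qed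
  qed
  then show ?thesis using a(1) that[of "2 * a"] by simp
qed

text \<open>As a minimum over finitely many polygonal paths, \<open>trunc y j\<close> depends on a bounded window only.\<close>

primrec trunc :: "real^'n \<Rightarrow> nat \<Rightarrow> 'n metric_field \<Rightarrow> real" where
  "trunc y 0 g = 3 * real CARD('n) * (\<Sum>s\<in>kpath (near 0) (near y). wt s g)"
| "trunc y (Suc j) g = min (trunc y j g) (clen g (0 # from_nat_into (lists dense_pts) j @ [y]))"

lemma trunc_loc: "\<exists>\<rho>. trunc y j \<in> borel_measurable (loc (cball 0 \<rho>))"
proof (induction j)
  case 0
  have "bounded (\<Union>s\<in>kpath (near 0) (near y). cube s (1/2))"
    by (intro bounded_UN kpath(1) ballI compact_imp_bounded compact_cube)
  then obtain \<rho> where \<rho>: "(\<Union>s\<in>kpath (near 0) (near y). cube s (1/2)) \<subseteq> cball 0 \<rho>"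
    using bounded_subset_ballD[of _ 0] ball_subset_cball by (metis order_trans)
  have "(\<lambda>g. 3 * real CARD('n) * (\<Sum>s\<in>kpath (near 0) (near y). wt s g)) \<in> borel_measurable (loc (cball 0 \<rho>))"
    using \<rho> by (intro borel_measurable_times borel_measurable_const borel_measurable_sum loc_mono[OF wt_loc]) blast
  then show ?case by auto
next
  case (Suc j)
  then obtain \<rho> where \<rho>: "trunc y j \<in> borel_measurable (loc (cball 0 \<rho>))" by blast
  let ?c = "0 # from_nat_into (lists dense_pts) j @ [y]"
  have "bounded (set ?c)" by (intro finite_imp_bounded) simp
  then obtain \<rho>' where \<rho>': "set ?c \<subseteq> cball 0 \<rho>'" using bounded_subset_ballD[of _ 0] ball_subset_cball by (metis order_trans)
  have "(\<lambda>g. min (trunc y j g) (clen g ?c)) \<in> borel_measurable (loc (cball 0 (max \<rho> \<rho>')))"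
  proof (rule borel_measurable_min)
    show "trunc y j \<in> borel_measurable (loc (cball 0 (max \<rho> \<rho>')))"
      by (rule loc_mono[OF \<rho>]) auto
    have "set ?c \<subseteq> cball 0 (max \<rho> \<rho>')" by (rule order_trans[OF \<rho>']) auto
    then show "(\<lambda>g. clen g ?c) \<in> borel_measurable (loc (cball 0 (max \<rho> \<rho>')))"
      by (intro clen_loc convex_cball)
  qed
  then show ?case by auto
qed

lemma trunc_ge_rdist: "g \<in> Metrics \<Longrightarrow> rdist g 0 y \<le> trunc y j g"
proof (induction j)
  case 0
  then show ?case using kpath(3)[OF _ near_cube near_cube, of g 0 y] by simp
next
  case (Suc j)
  then show ?case using rdist_le_clen[of g 0 y] by simp
qed

lemma trunc_antimono: "j \<le> k \<Longrightarrow> trunc y k g \<le> trunc y j g"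
  by (induction k rule: dec_induct) auto

text \<open>Every list of dense points has an index, so from some \<open>j\<close> on each competing
  chain takes part in the minimum.\<close>

lemma trunc_tendsto:
  assumes g: "g \<in> Metrics"
  shows "(\<lambda>j. trunc y j g) \<longlonglongrightarrow> rdist g 0 y"
proof (rule decreasing_tendsto)
  show "eventually (\<lambda>j. rdist g 0 y \<le> trunc y j g) sequentially" using trunc_ge_rdist[OF g] by simp
  fix c assume "rdist g 0 y < c"
  then obtain xs where xs: "xs \<in> lists dense_pts" "clen g (0 # xs @ [y]) < c"
    using rdist_dense_chain[OF g dense_pts(2)] by blast
  have "countable (lists (dense_pts :: (real^'n) set))" by (intro countable_lists dense_pts(1))
  then obtain j where j: "from_nat_into (lists dense_pts) j = xs"
    using from_nat_into_surj[OF _ xs(1)] by blast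
  have "trunc y k g < c" if "Suc j \<le> k" for k
    using trunc_antimono[OF that, of y g] j xs(2) by simp
  then show "eventually (\<lambda>j. trunc y j g < c) sequentially" unfolding eventually_sequentially by blast
qed

lemma trunc_measurable: "trunc y j \<in> borel_measurable P"
  using trunc_loc loc_measurable by blast

lemma trunc_bounds:
  assumes "g \<in> space P"
  shows "0 \<le> trunc y j g" "trunc y j g \<le> trunc y 0 g"
  using trunc_ge_rdist[of g y j] rdist_nonneg[of g 0 y] trunc_antimono[of 0 j y g] assms by (auto simp: space_P)

text \<open>\<open>trunc y 0\<close> is a sum of cell weights and dominates all later
  approximations. It supplies the second moments here, and the majorant for dominated convergence in
  \<open>expectation_trunc\<close>.\<close>

lemma trunc_square_integrable: "integrable P (\<lambda>g. (trunc y j g)\<^sup>2)"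
proof (rule Bochner_Integration.integrable_bound)
  show "integrable P (\<lambda>g. (trunc y 0 g)\<^sup>2)"
    using sum_wt_square_integrable by (simp add: power_mult_distrib)
  show "(\<lambda>g. (trunc y j g)\<^sup>2) \<in> borel_measurable P" using trunc_measurable by measurable
  show "AE g in P. norm ((trunc y j g)\<^sup>2) \<le> norm ((trunc y 0 g)\<^sup>2)"
    using trunc_bounds by (intro AE_I2) (auto intro!: power_mono simp del: trunc.simps)
qed

lemma trunc_integrable: "integrable P (trunc y j)"
  by (rule square_integrable_imp_integrable[OF trunc_measurable trunc_square_integrable])

lemma expectation_trunc: "(\<lambda>j. expectation (trunc y j)) \<longlonglongrightarrow> mean y"
  unfolding mean_def
proof (rule integral_dominated_convergence[where w = "trunc y 0"])
  show "AE g in P. (\<lambda>j. trunc y j g) \<longlonglongrightarrow> rdist g 0 y"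
    by (intro AE_I2 trunc_tendsto) (simp add: space_P)
  show "AE g in P. norm (trunc y j g) \<le> trunc y 0 g" for j
    using trunc_bounds by (intro AE_I2) (auto simp del: trunc.simps)
qed (auto intro: trunc_measurable trunc_integrable simp del: trunc.simps)

text \<open>The Fekete constant of the subadditive sequence of means. As an infimum it bounds every
  single mean from below, which is what the argument for the lower limit exploits.\<close>

definition tconst :: "real^'n \<Rightarrow> real" where
  "tconst v = (INF n\<in>{1::nat..}. mean (real n *\<^sub>R v) / real n)"

lemma tconst_le: "n \<ge> 1 \<Longrightarrow> tconst v \<le> mean (real n *\<^sub>R v) / real n"
  unfolding tconst_def by (intro cINF_lower bdd_belowI2[of _ 0]) (auto simp: mean_nonneg)

lemma tconst_nonneg: "tconst v \<ge> 0"
  unfolding tconst_def by (intro cINF_greatest) (auto simp: mean_nonneg)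

lemma tconst_approx:
  assumes "\<epsilon> > 0"
  obtains m :: nat where "m \<ge> 1" "mean (real m *\<^sub>R v) < real m * (tconst v + \<epsilon>)"
proof -
  have "\<exists>m\<in>{1::nat..}. mean (real m *\<^sub>R v) / real m < tconst v + \<epsilon>"
  proof (rule ccontr)
    assume "\<not> ?thesis"
    then have "tconst v + \<epsilon> \<le> tconst v"
      unfolding tconst_def[of v] by (intro cINF_greatest) (auto simp: not_less)
    then show False using assms by simp
  qed
  then obtain m :: nat where "m \<ge> 1" "mean (real m *\<^sub>R v) / real m < tconst v + \<epsilon>" by auto
  then show ?thesis by (intro that[of m]) (auto simp: pos_divide_less_eq mult.commute)
qed

lemma rdist_transl_multiple:
  assumes "g \<in> Metrics"
  shows "rdist (transl (real i *\<^sub>R w) g) 0 w = rdist g (real i *\<^sub>R w) (real (Suc i) *\<^sub>R w)"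
  using rdist_transl[OF assms, of "real i *\<^sub>R w" 0 w] by (simp add: algebra_simps)

text \<open>The ray is cut into blocks \<open>w\<close> whose mean is nearly optimal, and the
  distance over each block is replaced by a local approximation from above that obeys the law of
  large numbers. What remains beyond the last square number of blocks is bridged by
  \<open>local_bound_real\<close>.\<close>

lemma upper_limit:
  assumes v: "norm v = 1" and "\<epsilon> > 0"
  shows "AE g in P. \<exists>N. \<forall>t\<ge>N. rdist g 0 (t *\<^sub>R v) \<le> t * (tconst v + \<epsilon>)"
proof -
  obtain m :: nat where m: "m \<ge> 1" "mean (real m *\<^sub>R v) < real m * (tconst v + \<epsilon>/4)"
    using tconst_approx[of "\<epsilon>/4" v] \<open>\<epsilon> > 0\<close> by auto
  define w where "w = real m *\<^sub>R v"
  have w0: "w \<noteq> 0" unfolding w_def using m v by auto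
  have "eventually (\<lambda>j. expectation (trunc w j) < real m * (tconst v + \<epsilon>/4)) sequentially"
    using order_tendstoD(2)[OF expectation_trunc[of w] m(2)[folded w_def]] .
  then obtain j where j: "expectation (trunc w j) < real m * (tconst v + \<epsilon>/4)"
    by (auto simp: eventually_sequentially)
  obtain \<rho> where \<rho>: "trunc w j \<in> borel_measurable (loc (cball 0 \<rho>))" using trunc_loc by blast
  have L: "AE g in P. \<exists>N. \<forall>k\<ge>N. (\<Sum>i<k\<^sup>2. trunc w j (transl (real i *\<^sub>R w) g)) \<le> real (k\<^sup>2) * (expectation (trunc w j) + real m * \<epsilon> / 4)"
    by (rule lln_along_squares[OF \<rho> trunc_square_integrable w0]) (use m \<open>\<epsilon> > 0\<close> in simp)
  obtain a where a: "a > 0" "\<And>\<delta>. \<delta> > 0 \<Longrightarrow> AE g in P. \<exists>N. \<forall>r\<ge>N. \<forall>x y.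
      norm x \<le> r \<longrightarrow> norm y \<le> r \<longrightarrow> norm (x - y) \<le> \<delta> * r \<longrightarrow> rdist g x y \<le> a * \<delta> * r"
    using local_bound_real by blast
  \<comment> \<open>Makes the bridge cost at most \<open>t * (\<epsilon> / 4)\<close>.\<close>
  define \<delta> where "\<delta> = \<epsilon> / (4 * a)"
  have "\<delta> > 0" unfolding \<delta>_def using a \<open>\<epsilon> > 0\<close> by simp
  have "AE g in P. g \<in> space P" by (rule AE_space)
  with L a(2)[OF \<open>\<delta> > 0\<close>] show ?thesis
  proof eventually_elim
    case (elim g)
    then have g: "g \<in> Metrics" by (simp add: space_P)
    obtain K where K: "\<And>k. k \<ge> K \<Longrightarrow> (\<Sum>i<k\<^sup>2. trunc w j (transl (real i *\<^sub>R w) g)) \<le> real (k\<^sup>2) * (expectation (trunc w j) + real m * \<epsilon> / 4)"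
      using elim by blast
    obtain N where N: "\<And>r x y. r \<ge> N \<Longrightarrow> norm x \<le> r \<Longrightarrow> norm y \<le> r \<Longrightarrow> norm (x - y) \<le> \<delta> * r \<Longrightarrow> rdist g x y \<le> a * \<delta> * r"
      using elim by blast
    \<comment> \<open>Between consecutive squares there are \<open>2 * k + 1\<close> blocks, a gap
      of order \<open>sqrt t\<close>, which is eventually smaller than
      \<open>\<delta> * t\<close>.\<close>
    have "eventually (\<lambda>t::real. real m * (2 * sqrt (t / real m) + 1) \<le> \<delta> * t) at_top"
      using m(1) \<open>\<delta> > 0\<close> by real_asymp
    then obtain T where T: "\<And>t. t \<ge> T \<Longrightarrow> real m * (2 * sqrt (t / real m) + 1) \<le> \<delta> * t"
      unfolding eventually_at_top_linorder by blast
    show ?case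
    proof (intro exI[of _ "Max {N, T, 1, real m * (real K + 1)\<^sup>2}"] allI impI)
      fix t assume "Max {N, T, 1, real m * (real K + 1)\<^sup>2} \<le> t"
      then have t: "N \<le> t" "T \<le> t" "1 \<le> t" "real m * (real K + 1)\<^sup>2 \<le> t" by auto
      define k where "k = nat \<lfloor>sqrt (t / real m)\<rfloor>"
      have sq: "sqrt (t / real m) \<ge> real K + 1"
        using t m by (intro real_le_rsqrt) (simp add: pos_le_divide_eq mult.commute)
      then have k: "real k \<le> sqrt (t / real m)" "sqrt (t / real m) < real k + 1" "k \<ge> K"
        unfolding k_def by linarith+
      have "(real k)\<^sup>2 \<le> (sqrt (t / real m))\<^sup>2" using k by (intro power_mono) auto
      then have k1: "real (k\<^sup>2) * real m \<le> t" using t m by (simp add: pos_le_divide_eq)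
      have "(sqrt (t / real m))\<^sup>2 \<le> (real k + 1)\<^sup>2" using k t by (intro power_mono) auto
      then have "t \<le> (real k + 1)\<^sup>2 * real m" using t m by (simp add: pos_divide_le_eq)
      then have "t - real (k\<^sup>2) * real m \<le> real m * (2 * real k + 1)"
        by (simp add: power2_eq_square algebra_simps)
      also have "\<dots> \<le> real m * (2 * sqrt (t / real m) + 1)" using k by (intro mult_left_mono) auto
      also have "\<dots> \<le> \<delta> * t" by (rule T[OF t(2)])
      finally have gap: "t - real (k\<^sup>2) * real m \<le> \<delta> * t" .
      define p where "p = real (k\<^sup>2) *\<^sub>R w"
      have p: "p = (real (k\<^sup>2) * real m) *\<^sub>R v" unfolding p_def w_def by simp
      have "rdist g p (t *\<^sub>R v) \<le> a * \<delta> * t"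
      proof (rule N[OF t(1)])
        show "norm p \<le> t" unfolding p using k1 v by simp
        show "norm (t *\<^sub>R v) \<le> t" using v t by simp
        have "norm (p - t *\<^sub>R v) = \<bar>real (k\<^sup>2) * real m - t\<bar>"
          unfolding p scaleR_diff_left[symmetric] using v by simp
        then show "norm (p - t *\<^sub>R v) \<le> \<delta> * t" using gap k1 by simp
      qed
      also have "a * \<delta> * t = t * (\<epsilon> / 4)" unfolding \<delta>_def using a(1) by simp
      finally have 1: "rdist g p (t *\<^sub>R v) \<le> t * (\<epsilon> / 4)" .
      have "rdist g 0 p \<le> (\<Sum>i<k\<^sup>2. rdist g (real i *\<^sub>R w) (real (Suc i) *\<^sub>R w))"
        using rdist_le_sum[OF g, of "\<lambda>i. real i *\<^sub>R w" "k\<^sup>2"] unfolding p_def by simp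
      also have "\<dots> \<le> (\<Sum>i<k\<^sup>2. trunc w j (transl (real i *\<^sub>R w) g))"
        unfolding rdist_transl_multiple[OF g, symmetric]
        by (intro sum_mono trunc_ge_rdist transl_Metrics g)
      also have "\<dots> \<le> real (k\<^sup>2) * (expectation (trunc w j) + real m * \<epsilon> / 4)" by (rule K[OF k(3)])
      also have "\<dots> \<le> real (k\<^sup>2) * (real m * (tconst v + \<epsilon>/2))"
        using j by (intro mult_left_mono) (auto simp: algebra_simps)
      also have "\<dots> = (real (k\<^sup>2) * real m) * (tconst v + \<epsilon>/2)" by simp
      also have "\<dots> \<le> t * (tconst v + \<epsilon>/2)"
        using k1 tconst_nonneg[of v] \<open>\<epsilon> > 0\<close> by (intro mult_right_mono) auto
      finally have "rdist g 0 p \<le> t * (tconst v + \<epsilon>/2)" .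
      moreover have "t * (tconst v + \<epsilon>/2) + t * (\<epsilon> / 4) \<le> t * (tconst v + \<epsilon>)"
        using t \<open>\<epsilon> > 0\<close> by (simp add: algebra_simps)
      ultimately show "rdist g 0 (t *\<^sub>R v) \<le> t * (tconst v + \<epsilon>)"
        using rdist_triangle[OF g, of 0 "t *\<^sub>R v" p] 1 by linarith
    qed
  qed
qed

text \<open>A version of the event that the lower limit of \<open>d(0, n v) / n\<close> is at most
  \<open>c\<close>. The free additive constant \<open>C\<close> makes it stable under shifts along
  \<open>v\<close>, which change distances from the origin by a bounded amount; taking it in
  \<open>nat\<close> leaves only countable quantifiers.\<close>

definition slow :: "real^'n \<Rightarrow> real \<Rightarrow> 'n metric_field \<Rightarrow> bool" where
  "slow v c g \<longleftrightarrow> (\<exists>C::nat. \<forall>m::nat. \<exists>n\<ge>m. rdist g 0 (real n *\<^sub>R v) \<le> c * real n + real C)"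

lemma slow_measurable: "{g \<in> space P. slow v c g} \<in> sets P"
  unfolding slow_def by measurable

lemma slow_transl:
  assumes g: "g \<in> Metrics" and "c \<ge> 0" and "slow v c g"
  shows "slow v c (transl v g)"
proof -
  obtain C :: nat where C: "\<And>m::nat. \<exists>n\<ge>m. rdist g 0 (real n *\<^sub>R v) \<le> c * real n + real C"
    using assms(3) unfolding slow_def by blast
  obtain C' :: nat where C': "c + real C + rdist g 0 v \<le> real C'" using real_arch_simple by blast
  have "\<exists>n\<ge>m. rdist (transl v g) 0 (real n *\<^sub>R v) \<le> c * real n + real C'" for m
  proof -
    obtain n where n: "n \<ge> Suc m" "rdist g 0 (real n *\<^sub>R v) \<le> c * real n + real C" using C by blast
    then obtain k where k: "n = Suc k" by (cases n) auto
    have "rdist (transl v g) 0 (real k *\<^sub>R v) = rdist g v (real n *\<^sub>R v)"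
      using rdist_transl[OF g, of v 0 "real k *\<^sub>R v"] k by (simp add: algebra_simps)
    also have "\<dots> \<le> rdist g 0 v + rdist g 0 (real n *\<^sub>R v)"
      using rdist_triangle[OF g, of v "real n *\<^sub>R v" 0] rdist_commute[OF g, of v 0] by simp
    also have "\<dots> \<le> c * real k + real C'" using n(2) C' k by (simp add: algebra_simps)
    finally show ?thesis using n k by (intro exI[of _ k]) auto
  qed
  then show ?thesis unfolding slow_def by blast
qed

lemma transl_transl: "transl v (transl w g) = transl (w + v) g"
  unfolding transl_def by (simp add: algebra_simps)

lemma slow_transl_multiple:
  assumes g: "g \<in> Metrics" and "c \<ge> 0" and "slow v c g"
  shows "slow v c (transl (real i *\<^sub>R v) g)"
proof (induction i)
  case 0
  have "transl (real 0 *\<^sub>R v) g = g" unfolding transl_def by simp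
  then show ?case using assms by simp
next
  case (Suc i)
  have "transl (real (Suc i) *\<^sub>R v) g = transl v (transl (real i *\<^sub>R v) g)"
    unfolding transl_transl by (simp add: algebra_simps)
  then show ?case using slow_transl[OF transl_Metrics[OF g] assms(2) Suc] by simp
qed

text \<open>The right-hand side is the expectation of the slope \<open>\<phi>\<close>, which is
  \<open>c + \<epsilon>\<close> on slow metrics and \<open>tconst v + \<epsilon>\<close> on all
  others. Almost surely some jump along the ray costs at most \<open>\<phi>\<close> per step, so the
  mean distance to \<open>real T *\<^sub>R v\<close> is at most \<open>T\<close> times the mean of
  \<open>\<phi>\<close>, up to lower order; yet it is never below
  \<open>T * tconst v\<close>.\<close>

lemma slow_prob_bound:
  assumes v: "norm v = 1" and "c \<ge> 0" and "\<epsilon> > 0"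
  shows "tconst v \<le> (tconst v + \<epsilon>) + (c - tconst v) * prob {g \<in> space P. slow v c g}"
proof -
  define B where "B = {g \<in> space P. slow v c g}"
  have Bm: "B \<in> sets P" unfolding B_def by (rule slow_measurable)
  define \<phi> where "\<phi> g = (tconst v + \<epsilon>) + (c - tconst v) * indicator B g" for g
  have \<phi>m: "\<phi> \<in> borel_measurable P" unfolding \<phi>_def[abs_def] using Bm by measurable
  have \<phi>i: "integrable P \<phi>"
    unfolding \<phi>_def[abs_def] using Bm by (auto intro!: integrable_real_indicator simp: emeasure_eq_measure)
  have E\<phi>: "expectation \<phi> = (tconst v + \<epsilon>) + (c - tconst v) * prob B"
    unfolding \<phi>_def[abs_def] using Bm prob_space
    by (subst Bochner_Integration.integral_add) (auto intro!: integrable_real_indicator simp: emeasure_eq_measure)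
  have \<phi>0: "\<phi> g \<ge> 0" for g
    unfolding \<phi>_def using tconst_nonneg[of v] assms by (auto simp: indicator_def)
  show ?thesis
  proof (cases "c \<le> tconst v")
    case False
    then show ?thesis using \<open>\<epsilon> > 0\<close> by (simp add: add_nonneg_nonneg)
  next
    case True
    \<comment> \<open>Shifts preserve slowness and \<open>c \<le> tconst v\<close>, so the slope
      does not increase along the orbit: jumps found from shifted origins are cheap enough for the
      slope at the start.\<close>
    have \<phi>transl: "\<phi> (transl (real i *\<^sub>R v) g) \<le> \<phi> g" if "g \<in> space P" for g i
    proof (cases "g \<in> B")
      case True
      then have "transl (real i *\<^sub>R v) g \<in> B"
        using slow_transl_multiple[of g c v i] \<open>c \<ge> 0\<close> transl_Metrics[of g] unfolding B_def by (auto simp: space_P)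
      then show ?thesis using True unfolding \<phi>_def by simp
    next
      case False
      then show ?thesis unfolding \<phi>_def using True \<open>c \<le> tconst v\<close> by (auto simp: indicator_def)
    qed
    \<comment> \<open>The metrics with a cheap jump of length at most \<open>N\<close>. Almost every
      metric lies in some \<open>G N\<close>: a slow one because \<open>\<epsilon>\<close> absorbs
      the constant \<open>C\<close> for large \<open>n\<close>, any other one by
      \<open>upper_limit\<close>.\<close>
    define G where "G N = {g \<in> space P. \<exists>n\<in>{1..N}. rdist g 0 (real n *\<^sub>R v) \<le> real n * \<phi> g}" for N :: nat
    have Gm: "G N \<in> sets P" for N
    proof -
      have "G N = (\<Union>n\<in>{1..N}. {g \<in> space P. rdist g 0 (real n *\<^sub>R v) \<le> real n * \<phi> g})"
        unfolding G_def by auto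
      then show ?thesis
        using \<phi>m by (auto intro!: sets.finite_UN borel_measurable_le borel_measurable_times)
    qed
    have G_AE: "AE g in P. \<exists>N. g \<in> G N"
    proof -
      have "AE g in P. g \<in> space P" by (rule AE_space)
      with upper_limit[OF v \<open>\<epsilon> > 0\<close>] show ?thesis
      proof eventually_elim
        case (elim g)
        have "\<exists>n\<ge>1::nat. rdist g 0 (real n *\<^sub>R v) \<le> real n * \<phi> g"
        proof (cases "slow v c g")
          case True
          then obtain C :: nat where C: "\<And>m::nat. \<exists>n\<ge>m. rdist g 0 (real n *\<^sub>R v) \<le> c * real n + real C"
            unfolding slow_def by blast
          obtain m :: nat where m: "real C / \<epsilon> \<le> real m" using real_arch_simple by blast
          obtain n where n: "n \<ge> max 1 m" "rdist g 0 (real n *\<^sub>R v) \<le> c * real n + real C" using C by blast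
          have "real C / \<epsilon> \<le> real n" using m n by simp
          then have "real C \<le> real n * \<epsilon>" using \<open>\<epsilon> > 0\<close> by (simp add: pos_divide_le_eq)
          moreover have "\<phi> g = c + \<epsilon>" unfolding \<phi>_def B_def using True elim by simp
          ultimately have "rdist g 0 (real n *\<^sub>R v) \<le> real n * \<phi> g" using n by (simp add: algebra_simps)
          then show ?thesis using n by auto
        next
          case False
          then have \<phi>: "\<phi> g = tconst v + \<epsilon>" unfolding \<phi>_def B_def by simp
          obtain N where N: "\<And>t. t \<ge> N \<Longrightarrow> rdist g 0 (t *\<^sub>R v) \<le> t * (tconst v + \<epsilon>)" using elim by blast
          obtain m :: nat where m: "N \<le> real m" using real_arch_simple by blast
          show ?thesis using N[of "real (max 1 m)"] m unfolding \<phi> by (intro exI[of _ "max 1 m"]) auto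
        qed
        then obtain n where "n \<ge> 1" "rdist g 0 (real n *\<^sub>R v) \<le> real n * \<phi> g" by blast
        then show ?case using elim unfolding G_def by (intro exI[of _ n]) auto
      qed
    qed
    \<comment> \<open>The cost of a unit step that has to be made for want of a jump of length at
      most \<open>N\<close>; its mean tends to 0 as \<open>N\<close> grows.\<close>
    define h where "h N g = indicator (space P - G N) g * rdist g 0 v" for N g
    have hm: "h N \<in> borel_measurable P" for N unfolding h_def[abs_def] using Gm[of N] by measurable
    have hi: "integrable P (h N)" for N
      by (rule Bochner_Integration.integrable_bound[OF rdist_integrable[of 0 v] hm])
         (auto intro!: AE_I2 simp: h_def indicator_def)
    define \<beta> where "\<beta> N = expectation (h N)" for N
    have \<beta>0: "\<beta> \<longlonglongrightarrow> 0"
    proof -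
      have "(\<lambda>N. expectation (h N)) \<longlonglongrightarrow> expectation (\<lambda>g. 0)"
      proof (rule integral_dominated_convergence[where w = "\<lambda>g. rdist g 0 v"])
        show "AE g in P. (\<lambda>N. h N g) \<longlonglongrightarrow> 0"
          using G_AE
        proof eventually_elim
          case (elim g)
          then obtain N where N: "g \<in> G N" by blast
          have "h M g = 0" if "M \<ge> N" for M
          proof -
            have "g \<in> G M" using N that unfolding G_def by force
            then show ?thesis unfolding h_def by simp
          qed
          then show ?case by (intro tendsto_eventually) (auto simp: eventually_sequentially)
        qed
        show "AE g in P. norm (h N g) \<le> rdist g 0 v" for N
          by (intro AE_I2) (auto simp: h_def indicator_def space_P rdist_nonneg)
      qed (use hm rdist_integrable in auto)
      then show ?thesis unfolding \<beta>_def by simp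
    qed
    have main: "tconst v * real T \<le> (expectation \<phi> + \<beta> N) * real T + real N * mean v" if "T \<ge> 1" for T N :: nat
    proof -
      define e where "e i g = rdist (transl (real i *\<^sub>R v) g) 0 v" for i g
      \<comment> \<open>\<open>w\<close> reaches 1 where no jump is guaranteed: the shifted metric
        is outside \<open>G N\<close>, or fewer than \<open>N\<close> steps remain before
        \<open>T\<close>.\<close>
      define w where "w i g = indicator (space P - G N) (transl (real i *\<^sub>R v) g) + (if T < i + N then 1 else 0 :: real)"
        for i and g :: "'n metric_field"
      have pw: "rdist g 0 (real T *\<^sub>R v) \<le> real T * \<phi> g + (\<Sum>i<T. w i g * e i g)" if gP: "g \<in> space P" for g
      proof -
        have g: "g \<in> Metrics" using gP by (simp add: space_P)
        have sh: "rdist (transl (real i *\<^sub>R v) g) 0 (real n *\<^sub>R v) = rdist g (real i *\<^sub>R v) (real (i + n) *\<^sub>R v)" for i n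
          using rdist_transl[OF g, of "real i *\<^sub>R v" 0 "real n *\<^sub>R v"] by (simp add: algebra_simps)
        have "rdist g (real 0 *\<^sub>R v) (real T *\<^sub>R v) \<le> real (T - 0) * \<phi> g + (\<Sum>i\<in>{0..<T}. w i g * e i g)"
        proof (rule jump_decomposition[where D = "\<lambda>x y. rdist g (real x *\<^sub>R v) (real y *\<^sub>R v)" and f = "\<phi> g"])
          show "rdist g (real x *\<^sub>R v) (real x *\<^sub>R v) = 0" for x by (rule rdist_self[OF g])
          show "rdist g (real x *\<^sub>R v) (real z *\<^sub>R v) \<le> rdist g (real x *\<^sub>R v) (real y *\<^sub>R v) + rdist g (real y *\<^sub>R v) (real z *\<^sub>R v)" for x y z
            by (rule rdist_triangle[OF g])
          show "rdist g (real x *\<^sub>R v) (real (Suc x) *\<^sub>R v) \<le> e x g" for x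
            using sh[of x 1] unfolding e_def by simp
          show "e x g \<ge> 0" for x unfolding e_def by (intro rdist_nonneg transl_Metrics g)
          show "w x g \<ge> 0" for x unfolding w_def by simp
          show "\<phi> g \<ge> 0" by (rule \<phi>0)
          fix x assume x: "x < T" "w x g < 1"
          have sP: "transl (real x *\<^sub>R v) g \<in> space P" using transl_Metrics[OF g] by (simp add: space_P)
          have "transl (real x *\<^sub>R v) g \<in> G N" "x + N \<le> T"
            using x(2) sP unfolding w_def
            by (cases "transl (real x *\<^sub>R v) g \<in> G N"; auto simp: indicator_def split: if_splits)+
          then obtain n where n: "n \<in> {1..N}"
            "rdist (transl (real x *\<^sub>R v) g) 0 (real n *\<^sub>R v) \<le> real n * \<phi> (transl (real x *\<^sub>R v) g)"
            unfolding G_def by blast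
          have "real n * \<phi> (transl (real x *\<^sub>R v) g) \<le> real n * \<phi> g"
            by (intro mult_left_mono \<phi>transl gP) auto
          then have "rdist g (real x *\<^sub>R v) (real (x + n) *\<^sub>R v) \<le> real n * \<phi> g"
            using n(2) unfolding sh by linarith
          then show "\<exists>n\<ge>1. x + n \<le> T \<and> rdist g (real x *\<^sub>R v) (real (x + n) *\<^sub>R v) \<le> real n * \<phi> g"
            using n(1) \<open>x + N \<le> T\<close> by (intro exI[of _ n]) auto
        qed simp
        then show ?thesis by (simp add: atLeast0LessThan)
      qed
      have we: "w i g * e i g = h N (transl (real i *\<^sub>R v) g) + (if T < i + N then e i g else 0)" for i g
        unfolding w_def e_def h_def by (simp add: algebra_simps)
      have ei: "integrable P (e i)" for i unfolding e_def[abs_def] by (rule integrable_transl[OF rdist_integrable])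
      have Ee: "expectation (e i) = mean v" for i
        unfolding e_def[abs_def] mean_def by (rule expectation_transl) simp
      have wei: "integrable P (\<lambda>g. w i g * e i g)" for i
        unfolding we using integrable_transl[OF hi[of N], of "real i *\<^sub>R v"] ei[of i]
        by (cases "T < i + N") simp_all
      have Ewe: "expectation (\<lambda>g. w i g * e i g) = \<beta> N + (if T < i + N then mean v else 0)" for i
        unfolding we using integrable_transl[OF hi[of N], of "real i *\<^sub>R v"] ei[of i] expectation_transl[OF hm[of N]] Ee[of i]
        by (cases "T < i + N") (simp_all add: \<beta>_def)
      \<comment> \<open>The decisive lower bound: the mean distance to any multiple of
        \<open>v\<close> respects the infimum \<open>tconst\<close>.\<close>
      have "tconst v * real T \<le> mean (real T *\<^sub>R v)"
        using tconst_le[OF that, of v] that by (simp add: pos_le_divide_eq)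
      also have "\<dots> \<le> expectation (\<lambda>g. real T * \<phi> g + (\<Sum>i<T. w i g * e i g))"
        unfolding mean_def
        by (intro integral_mono rdist_integrable pw Bochner_Integration.integrable_add integrable_mult_right
            Bochner_Integration.integrable_sum wei \<phi>i)
      also have "\<dots> = real T * expectation \<phi> + (\<Sum>i<T. \<beta> N + (if T < i + N then mean v else 0))"
        using \<phi>i wei by (simp add: Bochner_Integration.integral_add Ewe)
      also have "(\<Sum>i<T. \<beta> N + (if T < i + N then mean v else 0))
          = real T * \<beta> N + real (card {i \<in> {..<T}. T < i + N}) * mean v"
        by (simp add: sum.distrib sum.If_cases Int_def)
      also have "\<dots> \<le> real T * \<beta> N + real N * mean v"
      proof -
        \<comment> \<open>Only the last few positions lack room for a jump. Their contribution does
          not grow with \<open>T\<close> and vanishes after division by \<open>T\<close>.\<close>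
        have "{i \<in> {..<T}. T < i + N} \<subseteq> {T - N..<T}" by auto
        then have "card {i \<in> {..<T}. T < i + N} \<le> card {T - N..<T}" by (intro card_mono) auto
        also have "\<dots> \<le> N" by simp
        finally show ?thesis by (intro add_left_mono mult_right_mono mean_nonneg) simp
      qed
      finally show ?thesis by (simp add: algebra_simps)
    qed
    have "tconst v \<le> expectation \<phi> + \<beta> N" for N
      by (rule le_of_linear_bound[where C = "real N * mean v"]) (rule main)
    then have "tconst v \<le> expectation \<phi> + 0"
      by (intro LIMSEQ_le_const[OF tendsto_add[OF tendsto_const \<beta>0]]) auto
    then show ?thesis unfolding E\<phi> B_def by simp
  qed
qed

text \<open>Letting \<open>\<epsilon>\<close> tend to 0 in \<open>slow_prob_bound\<close> yields
  \<open>(tconst v - c) * prob slow \<le> 0\<close>, so slowness has probability 0. For negative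
  \<open>c\<close> the claim is just nonnegativity of the distance.\<close>

lemma lower_limit_nat:
  assumes v: "norm v = 1" and c: "c < tconst v"
  shows "AE g in P. \<exists>N. \<forall>n\<ge>N. rdist g 0 (real n *\<^sub>R v) \<ge> c * real n"
proof (cases "c \<ge> 0")
  case False
  have "AE g in P. g \<in> space P" by (rule AE_space)
  then show ?thesis
  proof eventually_elim
    case (elim g)
    have "c * real n \<le> rdist g 0 (real n *\<^sub>R v)" for n
    proof -
      have "c * real n \<le> 0" using False by (simp add: mult_nonpos_nonneg)
      also have "0 \<le> rdist g 0 (real n *\<^sub>R v)" using elim by (intro rdist_nonneg) (simp add: space_P)
      finally show ?thesis .
    qed
    then show ?case by blast
  qed
next
  case True
  have "(tconst v - c) * prob {g \<in> space P. slow v c g} \<le> 0"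
  proof (rule field_le_epsilon)
    fix \<epsilon> :: real assume "\<epsilon> > 0"
    from slow_prob_bound[OF v True this]
    show "(tconst v - c) * prob {g \<in> space P. slow v c g} \<le> 0 + \<epsilon>" by (simp add: algebra_simps)
  qed
  then have "prob {g \<in> space P. slow v c g} \<le> 0" using c by (simp add: mult_le_0_iff)
  then have "prob {g \<in> space P. slow v c g} = 0" by (simp add: measure_le_0_iff)
  then have "AE g in P. \<not> slow v c g"
    using slow_measurable[of v c] by (intro AE_I[of _ _ "{g \<in> space P. slow v c g}"]) (auto simp: emeasure_eq_measure)
  then show ?thesis
  proof eventually_elim
    case (elim g)
    \<comment> \<open>The negation of \<open>slow\<close> is used at the additive constant
      0.\<close>
    then obtain m :: nat where "\<And>n. n \<ge> m \<Longrightarrow> \<not> rdist g 0 (real n *\<^sub>R v) \<le> c * real n + real 0"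
      unfolding slow_def by blast
    then have "rdist g 0 (real n *\<^sub>R v) \<ge> c * real n" if "n \<ge> m" for n
      using that by (metis add.right_neutral linear of_nat_0)
    then show ?case by blast
  qed
qed

text \<open>Passes from integers to real times: \<open>t\<close> and its integer part are at most 1
  apart, which is below \<open>\<delta> * t\<close> for large \<open>t\<close>.\<close>

lemma lower_limit:
  assumes v: "norm v = 1" and "\<epsilon> > 0"
  shows "AE g in P. \<exists>N. \<forall>t\<ge>N. rdist g 0 (t *\<^sub>R v) \<ge> t * (tconst v - \<epsilon>)"
proof -
  obtain a where a: "a > 0" "\<And>\<delta>. \<delta> > 0 \<Longrightarrow> AE g in P. \<exists>N. \<forall>r\<ge>N. \<forall>x y.
      norm x \<le> r \<longrightarrow> norm y \<le> r \<longrightarrow> norm (x - y) \<le> \<delta> * r \<longrightarrow> rdist g x y \<le> a * \<delta> * r"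
    using local_bound_real by blast
  define \<delta> where "\<delta> = \<epsilon> / (4 * a)"
  have "\<delta> > 0" unfolding \<delta>_def using a \<open>\<epsilon> > 0\<close> by simp
  define c where "c = tconst v - \<epsilon>/2"
  have "AE g in P. \<exists>N. \<forall>n\<ge>N. rdist g 0 (real n *\<^sub>R v) \<ge> c * real n"
    by (rule lower_limit_nat[OF v]) (use \<open>\<epsilon> > 0\<close> in \<open>simp add: c_def\<close>)
  moreover have "AE g in P. g \<in> space P" by (rule AE_space)
  ultimately show ?thesis using a(2)[OF \<open>\<delta> > 0\<close>]
  proof eventually_elim
    case (elim g)
    then have g: "g \<in> Metrics" by (simp add: space_P)
    obtain M where M: "\<And>n. n \<ge> M \<Longrightarrow> rdist g 0 (real n *\<^sub>R v) \<ge> c * real n"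
      using elim by blast
    obtain N where N: "\<And>r x y. r \<ge> N \<Longrightarrow> norm x \<le> r \<Longrightarrow> norm y \<le> r \<Longrightarrow> norm (x - y) \<le> \<delta> * r \<Longrightarrow> rdist g x y \<le> a * \<delta> * r"
      using elim by blast
    show ?case
    proof (intro exI[of _ "Max {N, real M + 1, 1 / \<delta>, 4 * \<bar>c\<bar> / \<epsilon>, 0}"] allI impI)
      fix t assume "Max {N, real M + 1, 1 / \<delta>, 4 * \<bar>c\<bar> / \<epsilon>, 0} \<le> t"
      then have t: "N \<le> t" "real M + 1 \<le> t" "1 / \<delta> \<le> t" "4 * \<bar>c\<bar> / \<epsilon> \<le> t" "0 \<le> t" by auto
      define n where "n = nat \<lfloor>t\<rfloor>"
      have n: "real n \<le> t" "t < real n + 1" "n \<ge> M" unfolding n_def using t by linarith+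
      have "rdist g (real n *\<^sub>R v) (t *\<^sub>R v) \<le> a * \<delta> * t"
      proof (rule N[OF t(1)])
        show "norm (real n *\<^sub>R v) \<le> t" "norm (t *\<^sub>R v) \<le> t" using v n t by auto
        have "norm (real n *\<^sub>R v - t *\<^sub>R v) = \<bar>real n - t\<bar>"
          unfolding scaleR_diff_left[symmetric] using v by simp
        also have "\<dots> \<le> 1" using n by simp
        also have "1 \<le> \<delta> * t" using t(3) \<open>\<delta> > 0\<close> by (simp add: pos_divide_le_eq mult.commute)
        finally show "norm (real n *\<^sub>R v - t *\<^sub>R v) \<le> \<delta> * t" .
      qed
      also have "a * \<delta> * t = t * (\<epsilon> / 4)" unfolding \<delta>_def using a(1) by simp
      finally have 1: "rdist g (real n *\<^sub>R v) (t *\<^sub>R v) \<le> t * (\<epsilon> / 4)" .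
      have 2: "rdist g 0 (real n *\<^sub>R v) \<le> rdist g 0 (t *\<^sub>R v) + rdist g (real n *\<^sub>R v) (t *\<^sub>R v)"
        using rdist_triangle[OF g, of 0 "real n *\<^sub>R v" "t *\<^sub>R v"] rdist_commute[OF g] by simp
      have "\<bar>c * t - c * real n\<bar> \<le> \<bar>c\<bar> * 1"
        unfolding right_diff_distrib[symmetric] abs_mult using n by (intro mult_left_mono) auto
      moreover have "\<bar>c\<bar> \<le> t * (\<epsilon> / 4)" using t(4) \<open>\<epsilon> > 0\<close> by (simp add: pos_divide_le_eq)
      ultimately have "c * t - t * (\<epsilon> / 4) \<le> c * real n" by linarith
      moreover have "c * t = t * (tconst v - \<epsilon>) + t * (\<epsilon> / 2)" unfolding c_def by (simp add: algebra_simps)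
      ultimately show "t * (tconst v - \<epsilon>) \<le> rdist g 0 (t *\<^sub>R v)" using M[OF n(3)] 1 2 by linarith
    qed
  qed
qed

lemma directional_limit:
  assumes v: "norm v = 1"
  shows "AE g in P. ((\<lambda>t. rdist g 0 (t *\<^sub>R v) / t) \<longlongrightarrow> tconst v) at_top"
proof -
  have "AE g in P. \<forall>k::nat. (\<exists>N. \<forall>t\<ge>N. rdist g 0 (t *\<^sub>R v) \<le> t * (tconst v + 1 / real (Suc k)))
      \<and> (\<exists>N. \<forall>t\<ge>N. rdist g 0 (t *\<^sub>R v) \<ge> t * (tconst v - 1 / real (Suc k)))"
    unfolding AE_all_countable
    by (intro allI AE_conjI upper_limit lower_limit v) simp_all
  then show ?thesis
  proof eventually_elim
    case (elim g)
    show ?case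
    proof (rule tendstoI)
      fix e :: real assume "e > 0"
      then obtain k where k: "1 / real (Suc k) < e" using nat_approx_posE by blast
      obtain N M where N: "\<And>t. t \<ge> N \<Longrightarrow> rdist g 0 (t *\<^sub>R v) \<le> t * (tconst v + 1 / real (Suc k))"
        and M: "\<And>t. t \<ge> M \<Longrightarrow> rdist g 0 (t *\<^sub>R v) \<ge> t * (tconst v - 1 / real (Suc k))"
        using elim by blast
      have "dist (rdist g 0 (t *\<^sub>R v) / t) (tconst v) < e" if t: "t \<ge> Max {N, M, 1}" for t
      proof -
        have t: "t \<ge> N" "t \<ge> M" "t \<ge> 1" using t by auto
        have "rdist g 0 (t *\<^sub>R v) / t \<le> tconst v + 1 / real (Suc k)"
          using N[OF t(1)] t(3) by (simp add: pos_divide_le_eq mult.commute)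
        moreover have "tconst v - 1 / real (Suc k) \<le> rdist g 0 (t *\<^sub>R v) / t"
          using M[OF t(2)] t(3) by (simp add: pos_le_divide_eq mult.commute)
        ultimately show ?thesis unfolding dist_real_def abs_less_iff using k by linarith
      qed
      then show "eventually (\<lambda>t. dist (rdist g 0 (t *\<^sub>R v) / t) (tconst v) < e) at_top"
        unfolding eventually_at_top_linorder by blast
    qed
  qed
qed

text \<open>Fekete's argument for real times: write \<open>t\<close> as a multiple of a nearly
  optimal \<open>m\<close> plus a remainder below \<open>m\<close>, whose mean distance is bounded
  by \<open>C * (m + 2)\<close>.\<close>

lemma mean_limit:
  assumes v: "norm v = 1" and "\<epsilon> > 0"
  shows "eventually (\<lambda>t. mean (t *\<^sub>R v) / t \<le> tconst v + \<epsilon>) at_top"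
proof -
  obtain m :: nat where m: "m \<ge> 1" "mean (real m *\<^sub>R v) < real m * (tconst v + \<epsilon>/2)"
    using tconst_approx[of "\<epsilon>/2" v] \<open>\<epsilon> > 0\<close> by auto
  obtain C where C: "\<And>x. mean x \<le> C * (norm x + 2)" using mean_bounded by blast
  have "C * 2 \<ge> 0" using C[of 0] mean_nonneg[of 0] by simp
  then have "C \<ge> 0" by simp
  have "mean (t *\<^sub>R v) / t \<le> tconst v + \<epsilon>" if t: "t \<ge> max 1 (C * (real m + 2) / (\<epsilon> / 2))" for t
  proof -
    have t: "t \<ge> 1" "C * (real m + 2) / (\<epsilon> / 2) \<le> t" using t by auto
    define k where "k = nat \<lfloor>t / real m\<rfloor>"
    have "0 \<le> t / real m" using t by simp
    then have k: "real k \<le> t / real m" "t / real m < real k + 1" unfolding k_def by linarith+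
    have k1: "real k * real m \<le> t" "t < real k * real m + real m"
      using k m by (auto simp: pos_le_divide_eq pos_divide_less_eq algebra_simps)
    have "t *\<^sub>R v = real k *\<^sub>R (real m *\<^sub>R v) + (t - real k * real m) *\<^sub>R v" by (simp add: algebra_simps)
    then have "mean (t *\<^sub>R v) \<le> mean (real k *\<^sub>R (real m *\<^sub>R v)) + mean ((t - real k * real m) *\<^sub>R v)"
      using mean_triangle by metis
    also have "\<dots> \<le> real k * mean (real m *\<^sub>R v) + C * (real m + 2)"
    proof (rule add_mono[OF mean_multiple])
      have "norm ((t - real k * real m) *\<^sub>R v) \<le> real m" using k1 v by simp
      then show "mean ((t - real k * real m) *\<^sub>R v) \<le> C * (real m + 2)"
        using C[of "(t - real k * real m) *\<^sub>R v"] \<open>C \<ge> 0\<close> by (meson add_right_mono mult_left_mono order_trans)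
    qed
    also have "real k * mean (real m *\<^sub>R v) \<le> real k * (real m * (tconst v + \<epsilon>/2))"
      using m by (intro mult_left_mono) auto
    also have "\<dots> = (real k * real m) * (tconst v + \<epsilon>/2)" by simp
    also have "\<dots> \<le> t * (tconst v + \<epsilon>/2)"
      using k1 tconst_nonneg[of v] \<open>\<epsilon> > 0\<close> by (intro mult_right_mono) auto
    also have "C * (real m + 2) \<le> t * (\<epsilon> / 2)" using t(2) \<open>\<epsilon> > 0\<close> by (simp add: pos_divide_le_eq)
    finally have "mean (t *\<^sub>R v) \<le> t * (tconst v + \<epsilon>/2) + t * (\<epsilon> / 2)" by simp
    also have "\<dots> = (tconst v + \<epsilon>) * t" by (simp add: algebra_simps)
    finally show ?thesis using t by (simp add: pos_divide_le_eq)
  qed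
  then show ?thesis unfolding eventually_at_top_linorder by blast
qed

text \<open>Besides almost sure convergence, Scheffe's lemma asks that the upper limit of the L1
  norms not exceed the norm of the limit. As distances are nonnegative, these norms are normalized
  means, which \<open>mean_limit\<close> controls.\<close>

lemma L1_limit:
  assumes v: "norm v = 1"
  shows "((\<lambda>t. \<integral>\<^sup>+ g. ennreal \<bar>rdist g 0 (t *\<^sub>R v) / t - tconst v\<bar> \<partial>P) \<longlongrightarrow> 0) at_top"
proof (rule tendsto_at_topI_sequentially)
  fix X :: "nat \<Rightarrow> real" assume X: "filterlim X at_top sequentially"
  have "(\<lambda>n. \<integral>\<^sup>+ g. norm (rdist g 0 (X n *\<^sub>R v) / X n - tconst v) \<partial>P) \<longlonglongrightarrow> 0"
  proof (rule Scheffe_lemma1)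
    show "integrable P (\<lambda>g. rdist g 0 (X n *\<^sub>R v) / X n)" for n using rdist_integrable by simp
    show "AE g in P. (\<lambda>n. rdist g 0 (X n *\<^sub>R v) / X n) \<longlonglongrightarrow> tconst v"
      using directional_limit[OF v] by eventually_elim (rule filterlim_compose[OF _ X])
    have "(\<integral>\<^sup>+ g. norm (tconst v) \<partial>P) = ennreal (tconst v)"
      using emeasure_space_1 tconst_nonneg[of v] by simp
    moreover have "limsup (\<lambda>n. \<integral>\<^sup>+ g. norm (rdist g 0 (X n *\<^sub>R v) / X n) \<partial>P) \<le> ennreal (tconst v)"
    proof (rule ennreal_le_epsilon)
      fix e :: real assume "e > 0"
      have "eventually (\<lambda>n. mean (X n *\<^sub>R v) / X n \<le> tconst v + e) sequentially"
        using mean_limit[OF v \<open>e > 0\<close>] X unfolding filterlim_iff by blast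
      moreover have "eventually (\<lambda>n. X n > 0) sequentially"
        using X unfolding filterlim_at_top_dense by blast
      ultimately have "eventually (\<lambda>n. (\<integral>\<^sup>+ g. norm (rdist g 0 (X n *\<^sub>R v) / X n) \<partial>P) \<le> ennreal (tconst v) + ennreal e) sequentially"
      proof eventually_elim
        case (elim n)
        have "(\<integral>\<^sup>+ g. norm (rdist g 0 (X n *\<^sub>R v) / X n) \<partial>P) = (\<integral>\<^sup>+ g. ennreal (rdist g 0 (X n *\<^sub>R v) / X n) \<partial>P)"
          using elim by (intro nn_integral_cong) (simp add: space_P rdist_nonneg)
        also have "\<dots> = ennreal (expectation (\<lambda>g. rdist g 0 (X n *\<^sub>R v) / X n))"
          using elim rdist_integrable
          by (intro nn_integral_eq_integral) (auto intro!: AE_I2 simp: space_P rdist_nonneg)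
        also have "expectation (\<lambda>g. rdist g 0 (X n *\<^sub>R v) / X n) = mean (X n *\<^sub>R v) / X n"
          unfolding mean_def by simp
        also have "ennreal \<dots> \<le> ennreal (tconst v + e)" using elim by (intro ennreal_leI)
        also have "\<dots> = ennreal (tconst v) + ennreal e" using tconst_nonneg \<open>e > 0\<close> by simp
        finally show ?case .
      qed
      then show "limsup (\<lambda>n. \<integral>\<^sup>+ g. norm (rdist g 0 (X n *\<^sub>R v) / X n) \<partial>P) \<le> ennreal (tconst v) + ennreal e"
        by (rule Limsup_bounded)
    qed
    ultimately show "limsup (\<lambda>n. \<integral>\<^sup>+ g. norm (rdist g 0 (X n *\<^sub>R v) / X n) \<partial>P) \<le> (\<integral>\<^sup>+ g. norm (tconst v) \<partial>P)" by simp
  qed simp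
  then show "(\<lambda>n. \<integral>\<^sup>+ g. ennreal \<bar>rdist g 0 (X n *\<^sub>R v) / X n - tconst v\<bar> \<partial>P) \<longlonglongrightarrow> 0" by simp
qed

lemma time_constant_eq:
  assumes v: "norm v = 1"
  shows "time_constant P v = tconst v"
  unfolding time_constant_def
proof (rule the_equality)
  show "is_time_constant P v (tconst v)"
    unfolding is_time_constant_def using directional_limit[OF v] L1_limit[OF v] tconst_nonneg by blast
  fix c assume "is_time_constant P v c"
  then have "AE g in P. ((\<lambda>t. rdist g 0 (t *\<^sub>R v) / t) \<longlongrightarrow> c) at_top"
    unfolding is_time_constant_def by blast
  with directional_limit[OF v] have "AE g in P. c = tconst v"
    by eventually_elim (rule tendsto_unique[OF trivial_limit_at_top_linorder])
  then show "c = tconst v" by simp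
qed

text \<open>By stationarity the mean distance from 0 to \<open>- x\<close> is that from
  \<open>x\<close> to 0. The symmetry lets \<open>mu_scale\<close> cover negative factors, which
  occur as \<open>1 - \<epsilon>\<close> when \<open>\<epsilon> > 1\<close>.\<close>

lemma tconst_minus: "tconst (- v) = tconst v"
proof -
  have "mean (- x) = mean x" for x
  proof -
    have "mean (- x) = expectation (\<lambda>g. rdist g x (x + - x))" by (rule expectation_rdist[symmetric])
    also have "\<dots> = mean x" unfolding mean_def
      by (intro Bochner_Integration.integral_cong) (auto simp: space_P rdist_commute)
    finally show ?thesis .
  qed
  then show ?thesis unfolding tconst_def by simp
qed

end

section \<open>The limit shape\<close>

context random_metric
begin

lemma tconst_lower: "\<exists>c>0. \<forall>v. norm v = 1 \<longrightarrow> c \<le> tconst v"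
proof -
  obtain c where c: "c > 0" "AE g in P. \<exists>N. \<forall>x. norm x \<ge> N \<longrightarrow> rdist g 0 x \<ge> c * norm x"
    using linear_lower_bound by blast
  have "c \<le> tconst v" if v: "norm v = 1" for v
  proof -
    from c(2) directional_limit[OF v] have "AE g in P. c \<le> tconst v"
    proof eventually_elim
      case (elim g)
      then obtain N where N: "\<And>x. norm x \<ge> N \<Longrightarrow> rdist g 0 x \<ge> c * norm x" by blast
      have "c \<le> rdist g 0 (t *\<^sub>R v) / t" if "t \<ge> max N 1" for t
        using N[of "t *\<^sub>R v"] v that by (simp add: pos_le_divide_eq)
      then have "eventually (\<lambda>t. c \<le> rdist g 0 (t *\<^sub>R v) / t) at_top"
        unfolding eventually_at_top_linorder by blast
      then show ?case
        by (rule tendsto_lowerbound[OF elim(2)]) (rule trivial_limit_at_top_linorder)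
    qed
    then show ?thesis by simp
  qed
  then show ?thesis using c(1) by blast
qed

lemma tconst_upper: "\<exists>C>0. \<forall>v. norm v = 1 \<longrightarrow> tconst v \<le> C"
proof -
  obtain C where C: "\<And>x. mean x \<le> C * (norm x + 2)" using mean_bounded by blast
  have "tconst v \<le> max 1 (3 * C)" if "norm v = 1" for v
    using tconst_le[of 1 v] C[of v] that by simp
  then show ?thesis by (intro exI[of _ "max 1 (3 * C)"]) auto
qed

text \<open>A finite net of directions, fixed before the randomness, reduces uniformity to finitely
  many rays. Three errors of a quarter of \<open>\<epsilon>\<close> arise: moving \<open>x\<close>
  to the nearest ray of the net, convergence along that ray, and the change of \<open>tconst\<close>
  between the two directions.\<close>

lemma uniform_limit:
  assumes "\<epsilon> > 0"
  shows "AE g in P. \<exists>N. \<forall>x. norm x \<ge> N \<longrightarrow> \<bar>rdist g 0 x - tconst (x /\<^sub>R norm x) * norm x\<bar> \<le> \<epsilon> * norm x"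
proof -
  obtain a where a: "a > 0" "\<And>\<delta>. \<delta> > 0 \<Longrightarrow> AE g in P. \<exists>N. \<forall>r\<ge>N. \<forall>x y.
      norm x \<le> r \<longrightarrow> norm y \<le> r \<longrightarrow> norm (x - y) \<le> \<delta> * r \<longrightarrow> rdist g x y \<le> a * \<delta> * r"
    using local_bound_real by blast
  define \<delta> where "\<delta> = \<epsilon> / (4 * a)"
  have \<delta>: "\<delta> > 0" "a * \<delta> = \<epsilon> / 4" unfolding \<delta>_def using a(1) assms by auto
  have diff: "\<bar>rdist g 0 x - rdist g 0 y\<bar> \<le> rdist g x y" if g: "g \<in> Metrics" for g x y
    using rdist_triangle[OF g, of 0 x y] rdist_triangle[OF g, of 0 y x] rdist_commute[OF g, of x y] by linarith
  \<comment> \<open>Continuity of the deterministic function \<open>tconst\<close> is read off from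
    almost sure statements: both limits and the local bound hold for almost every
    \<open>g\<close>.\<close>
  have lip: "\<bar>tconst u - tconst v\<bar> \<le> \<epsilon> / 4" if u: "norm u = 1" and v: "norm v = 1" and uv: "norm (u - v) \<le> \<delta>" for u v
  proof -
    have "AE g in P. g \<in> space P" by (rule AE_space)
    with a(2)[OF \<delta>(1)] directional_limit[OF u] directional_limit[OF v]
    have "AE g in P. \<bar>tconst u - tconst v\<bar> \<le> \<epsilon> / 4"
    proof eventually_elim
      case (elim g)
      then have g: "g \<in> Metrics" by (simp add: space_P)
      obtain N where N: "\<And>r x y. r \<ge> N \<Longrightarrow> norm x \<le> r \<Longrightarrow> norm y \<le> r \<Longrightarrow> norm (x - y) \<le> \<delta> * r \<Longrightarrow> rdist g x y \<le> a * \<delta> * r"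
        using elim by blast
      have "\<bar>rdist g 0 (t *\<^sub>R u) / t - rdist g 0 (t *\<^sub>R v) / t\<bar> \<le> \<epsilon> / 4" if t: "t \<ge> max N 1" for t
      proof -
        have "norm (t *\<^sub>R u - t *\<^sub>R v) \<le> \<delta> * t"
          unfolding scaleR_diff_right[symmetric] using uv t by (simp add: mult.commute)
        then have "rdist g (t *\<^sub>R u) (t *\<^sub>R v) \<le> a * \<delta> * t"
          using t u v by (intro N) auto
        then have "\<bar>rdist g 0 (t *\<^sub>R u) - rdist g 0 (t *\<^sub>R v)\<bar> \<le> \<epsilon> / 4 * t"
          using diff[OF g, of "t *\<^sub>R u" "t *\<^sub>R v"] unfolding \<delta>(2) by linarith
        then have "\<bar>rdist g 0 (t *\<^sub>R u) - rdist g 0 (t *\<^sub>R v)\<bar> / t \<le> \<epsilon> / 4"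
          using t by (simp add: pos_divide_le_eq)
        then show ?thesis using t by (simp add: diff_divide_distrib[symmetric])
      qed
      then have "eventually (\<lambda>t. \<bar>rdist g 0 (t *\<^sub>R u) / t - rdist g 0 (t *\<^sub>R v) / t\<bar> \<le> \<epsilon> / 4) at_top"
        unfolding eventually_at_top_linorder by blast
      moreover have "((\<lambda>t. \<bar>rdist g 0 (t *\<^sub>R u) / t - rdist g 0 (t *\<^sub>R v) / t\<bar>) \<longlongrightarrow> \<bar>tconst u - tconst v\<bar>) at_top"
        using elim by (intro tendsto_rabs tendsto_diff)
      ultimately show ?case
        by (intro tendsto_upperbound[where F = at_top]) auto
    qed
    then show ?thesis by simp
  qed
  obtain F where F: "finite F" "F \<subseteq> sphere (0::real^'n) 1" "sphere (0::real^'n) 1 \<subseteq> (\<Union>v\<in>F. ball v \<delta>)"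
    using seq_compact_imp_totally_bounded[rule_format, OF compact_imp_seq_compact[OF compact_sphere] \<delta>(1)]
    by metis
  have "AE g in P. \<forall>v\<in>F. ((\<lambda>t. rdist g 0 (t *\<^sub>R v) / t) \<longlongrightarrow> tconst v) at_top"
    using F by (intro AE_finite_allI directional_limit) auto
  moreover have "AE g in P. g \<in> space P" by (rule AE_space)
  ultimately show ?thesis using a(2)[OF \<delta>(1)]
  proof eventually_elim
    case (elim g)
    then have g: "g \<in> Metrics" by (simp add: space_P)
    obtain N where N: "\<And>r x y. r \<ge> N \<Longrightarrow> norm x \<le> r \<Longrightarrow> norm y \<le> r \<Longrightarrow> norm (x - y) \<le> \<delta> * r \<Longrightarrow> rdist g x y \<le> a * \<delta> * r"
      using elim by blast
    have "\<forall>v\<in>F. eventually (\<lambda>t. dist (rdist g 0 (t *\<^sub>R v) / t) (tconst v) < \<epsilon> / 4) at_top"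
      by (intro ballI tendstoD elim(1)[rule_format]) (use assms in simp_all)
    then have "eventually (\<lambda>t. \<forall>v\<in>F. dist (rdist g 0 (t *\<^sub>R v) / t) (tconst v) < \<epsilon> / 4) at_top"
      by (rule eventually_ball_finite[OF F(1)])
    then obtain M where M: "\<And>t v. t \<ge> M \<Longrightarrow> v \<in> F \<Longrightarrow> dist (rdist g 0 (t *\<^sub>R v) / t) (tconst v) < \<epsilon> / 4"
      unfolding eventually_at_top_linorder by blast
    show ?case
    proof (intro exI[of _ "Max {N, M, 1}"] allI impI)
      fix x :: "real^'n" assume "Max {N, M, 1} \<le> norm x"
      define t where "t = norm x"
      have t: "t \<ge> N" "t \<ge> M" "t \<ge> 1" unfolding t_def using \<open>Max {N, M, 1} \<le> norm x\<close> by auto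
      define u where "u = x /\<^sub>R t"
      have "norm x \<noteq> 0" using t(3) unfolding t_def by auto
      then have u: "norm u = 1" "x = t *\<^sub>R u" unfolding u_def t_def by auto
      obtain v where v: "v \<in> F" "norm (v - u) < \<delta>"
        using F(3) u(1) by (auto simp: dist_norm)
      have v1: "norm v = 1" using F(2) v by auto
      have "norm (x - t *\<^sub>R v) = t * norm (v - u)"
        unfolding u(2) scaleR_diff_right[symmetric] using t by (simp add: norm_minus_commute)
      also have "\<dots> \<le> \<delta> * t" using v t by (simp add: mult.commute)
      finally have "rdist g x (t *\<^sub>R v) \<le> a * \<delta> * t"
        using t v1 by (intro N) (auto simp: t_def)
      then have 1: "\<bar>rdist g 0 x - rdist g 0 (t *\<^sub>R v)\<bar> \<le> \<epsilon> / 4 * t"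
        using diff[OF g, of x "t *\<^sub>R v"] unfolding \<delta>(2) by linarith
      have "\<bar>rdist g 0 (t *\<^sub>R v) / t - tconst v\<bar> * t \<le> \<epsilon> / 4 * t"
        using M[OF t(2) v(1)] t by (intro mult_right_mono) (auto simp: dist_real_def)
      moreover have "\<bar>rdist g 0 (t *\<^sub>R v) / t - tconst v\<bar> * t = \<bar>(rdist g 0 (t *\<^sub>R v) / t - tconst v) * t\<bar>"
        using t by (simp add: abs_mult)
      moreover have "(rdist g 0 (t *\<^sub>R v) / t - tconst v) * t = rdist g 0 (t *\<^sub>R v) - tconst v * t"
        using t by (simp add: algebra_simps)
      ultimately have 2: "\<bar>rdist g 0 (t *\<^sub>R v) - tconst v * t\<bar> \<le> \<epsilon> / 4 * t" by simp
      have "\<bar>tconst v - tconst u\<bar> * t \<le> \<epsilon> / 4 * t"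
        using lip[OF v1 u(1)] v t by (intro mult_right_mono) auto
      moreover have "\<bar>tconst v - tconst u\<bar> * t = \<bar>tconst v * t - tconst u * t\<bar>"
        using t by (simp add: abs_mult left_diff_distrib[symmetric])
      ultimately have 3: "\<bar>tconst v * t - tconst u * t\<bar> \<le> \<epsilon> / 4 * t" by simp
      have "\<bar>rdist g 0 x - tconst u * t\<bar> \<le> \<epsilon> / 4 * t + \<epsilon> / 4 * t + \<epsilon> / 4 * t"
        using 1 2 3 by linarith
      also have "\<dots> \<le> \<epsilon> * t" using t assms by simp
      finally show "\<bar>rdist g 0 x - tconst (x /\<^sub>R norm x) * norm x\<bar> \<le> \<epsilon> * norm x"
        unfolding u_def t_def .
    qed
  qed
qed

section \<open>Homogeneity of \<open>mu\<close> and the two inclusions\<close>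

lemma mu_eq: "mu P x = tconst (x /\<^sub>R norm x) * norm x"
  unfolding mu_def by (auto simp: time_constant_eq)

lemma mu_scale: "mu P (s *\<^sub>R x) = \<bar>s\<bar> * mu P x"
proof (cases "s = 0 \<or> x = 0")
  case True
  then show ?thesis by (auto simp: mu_eq)
next
  case False
  have "tconst ((s *\<^sub>R x) /\<^sub>R norm (s *\<^sub>R x)) = tconst (x /\<^sub>R norm x)"
  proof (cases "s > 0")
    case True
    then have "inverse (norm (s *\<^sub>R x)) * s = inverse (norm x)" by simp
    then show ?thesis by (simp only: scaleR_scaleR)
  next
    case False
    then have "inverse (norm (s *\<^sub>R x)) * s = - inverse (norm x)"
      using \<open>\<not> (s = 0 \<or> x = 0)\<close> by simp
    then show ?thesis by (simp only: scaleR_scaleR scaleR_minus_left tconst_minus)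
  qed
  then show ?thesis unfolding mu_eq by simp
qed

text \<open>By symmetry \<open>(1 - \<epsilon>) A\<close> is
  \<open>\<bar>1 - \<epsilon>\<bar> A\<close>, and this factor is below 1 precisely when
  \<open>0 < \<epsilon> < 2\<close>. For larger \<open>\<epsilon>\<close> the scaled set contains
  \<open>A\<close> again, which is why the inner inclusion carries a guard.\<close>

lemma shape_theorem:
  assumes "\<epsilon> > 0"
  shows "AE g in P. \<exists>T>0. \<forall>t\<ge>T.
           (\<epsilon> < 2 \<longrightarrow> (\<lambda>x. (1 - \<epsilon>) *\<^sub>R x) ` limit_shape P \<subseteq> {x. t *\<^sub>R x \<in> rball g t}) \<and>
           {x. t *\<^sub>R x \<in> rball g t} \<subseteq> (\<lambda>x. (1 + \<epsilon>) *\<^sub>R x) ` limit_shape P"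
proof -
  obtain c where c: "c > 0" "\<And>v. norm v = 1 \<Longrightarrow> c \<le> tconst v" using tconst_lower by blast
  obtain C where C: "C > 0" "\<And>v. norm v = 1 \<Longrightarrow> tconst v \<le> C" using tconst_upper by blast
  have mu_ge: "c * norm x \<le> mu P x" for x
    unfolding mu_eq using c(2)[of "x /\<^sub>R norm x"] by (cases "x = 0") (auto intro!: mult_right_mono)
  have mu_le: "mu P x \<le> C * norm x" for x
    unfolding mu_eq using C(2)[of "x /\<^sub>R norm x"] by (cases "x = 0") (auto intro!: mult_right_mono)
  have mu0: "mu P x \<ge> 0" for x using mu_ge[of x] c(1) by (meson mult_nonneg_nonneg norm_ge_zero less_imp_le order_trans)
  \<comment> \<open>The relative error that both inclusions tolerate: the outer one needs
    \<open>1 / (1 - \<kappa>) \<le> 1 + \<epsilon>\<close>, the inner one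
    \<open>(1 + \<kappa>) * q \<le> 1\<close> for
    \<open>q = \<bar>1 - \<epsilon>\<bar> \<le> 1 - \<kappa>\<close>.\<close>
  define \<kappa> where "\<kappa> = (if \<epsilon> < 2 then min (\<epsilon> / (1 + \<epsilon>)) (1 - \<bar>1 - \<epsilon>\<bar>) else \<epsilon> / (1 + \<epsilon>))"
  have \<kappa>: "\<kappa> > 0" "\<kappa> \<le> \<epsilon> / (1 + \<epsilon>)" "\<epsilon> < 2 \<Longrightarrow> \<kappa> \<le> 1 - \<bar>1 - \<epsilon>\<bar>"
    unfolding \<kappa>_def using assms by (auto simp: abs_if)
  obtain a where a: "a > 0" "\<And>\<delta>. \<delta> > 0 \<Longrightarrow> AE g in P. \<exists>N. \<forall>r\<ge>N. \<forall>x y.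
      norm x \<le> r \<longrightarrow> norm y \<le> r \<longrightarrow> norm (x - y) \<le> \<delta> * r \<longrightarrow> rdist g x y \<le> a * \<delta> * r"
    using local_bound_real by blast
  \<comment> \<open>The factor \<open>c\<close> turns an error relative to the Euclidean norm into
    one relative to \<open>mu\<close>, since \<open>c * norm x \<le> mu P x\<close>.\<close>
  have "AE g in P. \<exists>N. \<forall>x. norm x \<ge> N \<longrightarrow> \<bar>rdist g 0 x - tconst (x /\<^sub>R norm x) * norm x\<bar> \<le> (\<kappa> * c) * norm x"
    by (rule uniform_limit) (use \<kappa> c in simp)
  with a(2)[OF zero_less_one] show ?thesis
  proof eventually_elim
    case (elim g)
    obtain N0 where N0: "\<And>x. norm x \<ge> N0 \<Longrightarrow> \<bar>rdist g 0 x - mu P x\<bar> \<le> (\<kappa> * c) * norm x"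
      using elim(2) unfolding mu_eq by blast
    obtain M where M: "\<And>r x y. r \<ge> M \<Longrightarrow> norm x \<le> r \<Longrightarrow> norm y \<le> r \<Longrightarrow> norm (x - y) \<le> 1 * r \<Longrightarrow> rdist g x y \<le> a * 1 * r"
      using elim(1) by blast
    define N where "N = Max {N0, M, 1}"
    have N: "N \<ge> N0" "N \<ge> M" "N \<ge> 1" unfolding N_def by auto
    have small: "rdist g 0 x \<le> a * N" if "norm x \<le> N" for x
      using M[of N 0 x] N that by simp
    have big: "\<bar>rdist g 0 x - mu P x\<bar> \<le> \<kappa> * mu P x" if "norm x \<ge> N" for x
    proof -
      have "\<kappa> * (c * norm x) \<le> \<kappa> * mu P x" using \<kappa>(1) by (intro mult_left_mono mu_ge) auto
      then show ?thesis using N0[of x] that N by simp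
    qed
    \<comment> \<open>Points \<open>t *\<^sub>R x\<close> of norm below \<open>N\<close> escape the
      asymptotics and fix the threshold: \<open>a * N\<close> bounds their distance from 0 for the
      inner inclusion, and \<open>C * N\<close> bounds their \<open>mu\<close> for the outer
      one.\<close>
    show ?case
    proof (intro exI[of _ "max (a * N) (C * N)"] conjI allI impI subsetI)
      show "0 < max (a * N) (C * N)" using a(1) N by (simp add: less_max_iff_disj)
      fix t assume t: "max (a * N) (C * N) \<le> t"
      then have t': "a * N \<le> t" "C * N \<le> t" by auto
      have "t > 0" using t' a(1) N by (meson less_le_trans mult_pos_pos zero_less_one)
      {
        fix x assume "\<epsilon> < 2" and "x \<in> (\<lambda>x. (1 - \<epsilon>) *\<^sub>R x) ` limit_shape P"
        then obtain y where y: "x = (1 - \<epsilon>) *\<^sub>R y" "mu P y \<le> 1" unfolding limit_shape_def by auto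
        define q where "q = \<bar>1 - \<epsilon>\<bar>"
        have q: "0 \<le> q" "q \<le> 1 - \<kappa>" using \<kappa>(3)[OF \<open>\<epsilon> < 2\<close>] unfolding q_def by auto
        have mx: "mu P x \<le> q" unfolding y(1) mu_scale q_def[symmetric] using q y(2) mult_left_mono[of "mu P y" 1 q] by simp
        have "rdist g 0 (t *\<^sub>R x) \<le> t"
        proof (cases "norm (t *\<^sub>R x) \<ge> N")
          case True
          have "mu P (t *\<^sub>R x) = t * mu P x" using mu_scale \<open>t > 0\<close> by simp
          then have "rdist g 0 (t *\<^sub>R x) \<le> (1 + \<kappa>) * (t * mu P x)"
            using big[OF True] by (simp add: algebra_simps abs_le_iff)
          also have "\<dots> \<le> (1 + \<kappa>) * (t * q)"
            using \<kappa>(1) \<open>t > 0\<close> mx by (intro mult_left_mono) auto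
          also have "\<dots> = t * (q + \<kappa> * q)" by (simp add: algebra_simps)
          also have "\<dots> \<le> t * 1"
          proof (rule mult_left_mono)
            have "\<kappa> * q \<le> \<kappa> * 1" using \<kappa>(1) q by (intro mult_left_mono) auto
            then show "q + \<kappa> * q \<le> 1" using q by simp
          qed (use \<open>t > 0\<close> in simp)
          finally show ?thesis by simp
        next
          case False
          then show ?thesis using small[of "t *\<^sub>R x"] t' by simp
        qed
        then show "x \<in> {x. t *\<^sub>R x \<in> rball g t}" unfolding rball_def by simp
      }
      {
        fix x assume "x \<in> {x. t *\<^sub>R x \<in> rball g t}"
        then have x: "rdist g 0 (t *\<^sub>R x) \<le> t" unfolding rball_def by simp
        have "mu P x \<le> 1 + \<epsilon>"
        proof (cases "norm (t *\<^sub>R x) \<ge> N")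
          case True
          have "mu P (t *\<^sub>R x) = t * mu P x" using mu_scale \<open>t > 0\<close> by simp
          then have "t * mu P x \<le> t + \<kappa> * (t * mu P x)"
            using big[OF True] x by (simp add: abs_le_iff)
          then have "t * ((1 - \<kappa>) * mu P x) \<le> t * 1" by (simp add: algebra_simps)
          then have 1: "(1 - \<kappa>) * mu P x \<le> 1" using \<open>t > 0\<close> by (simp only: mult_le_cancel_left_pos)
          have "1 / (1 + \<epsilon>) \<le> 1 - \<kappa>" using \<kappa>(2) assms by (simp add: field_simps)
          then have "1 / (1 + \<epsilon>) * mu P x \<le> (1 - \<kappa>) * mu P x" by (intro mult_right_mono mu0)
          with 1 have "1 / (1 + \<epsilon>) * mu P x \<le> 1" by linarith
          then show ?thesis using assms by (simp add: pos_divide_le_eq)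
        next
          case False
          then have "t * norm x \<le> N" using \<open>t > 0\<close> by simp
          then have "C * (t * norm x) \<le> C * N" using C(1) by (intro mult_left_mono) auto
          then have "t * (C * norm x) \<le> t * 1" using t' by (simp add: algebra_simps)
          then have "C * norm x \<le> 1" using \<open>t > 0\<close> by (simp only: mult_le_cancel_left_pos)
          then show ?thesis using mu_le[of x] assms by linarith
        qed
        then have "mu P ((1 / (1 + \<epsilon>)) *\<^sub>R x) \<le> 1" unfolding mu_scale using assms by (simp add: pos_divide_le_eq)
        then have "(1 / (1 + \<epsilon>)) *\<^sub>R x \<in> limit_shape P" unfolding limit_shape_def by simp
        moreover have "x = (1 + \<epsilon>) *\<^sub>R ((1 / (1 + \<epsilon>)) *\<^sub>R x)" using assms by simp
        ultimately show "x \<in> (\<lambda>x. (1 + \<epsilon>) *\<^sub>R x) ` limit_shape P" by (rule rev_image_eqI)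
      }
    qed
  qed
qed

end

theorem theorem3p1:
  fixes P :: "'n::finite metric_field measure" and \<epsilon> :: real
  assumes "CARD('n) \<ge> 2"
    and "prob_space P"
    and "sets P = sets metric_space_algebra"
    and "translation_invariant P"
    and "finite_range_dependence P"
    and "exponential_moments P"
    and "\<epsilon> > 0"
  shows "AE g in P. \<exists>T>0. \<forall>t\<ge>T.
           (\<epsilon> < 2 \<longrightarrow> (\<lambda>x. (1 - \<epsilon>) *\<^sub>R x) ` limit_shape P \<subseteq> {x. t *\<^sub>R x \<in> rball g t}) \<and>
           {x. t *\<^sub>R x \<in> rball g t} \<subseteq> (\<lambda>x. (1 + \<epsilon>) *\<^sub>R x) ` limit_shape P"
proof -
  interpret random_metric P
    using assms by (intro random_metric.intro random_metric_axioms.intro)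
  show ?thesis using \<open>\<epsilon> > 0\<close> by (rule shape_theorem)
qed

end
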